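(* Assume that $\frac1n\sum_{i=1}^n\delta_{x_i^{(n)}}\to\mu$ weakly as $n\to\infty$, where $\mu$ is a probability measure on $\mathbb{R}$ which is not a point mass and has support in $[a,b]$, and that $\frac{q_n}{n}\to\alpha\in(0,1)$ as $n\to\infty$. Then, given $c\in A_\alpha$, there exists $w_{\alpha,c}\in\mathbb{C}$ with $\mathrm{Im}(w_{\alpha,c})>0$ and $$\{w\in\mathbb{C}\setminus\mathbb{R} : wG_\mu(w+c)=1-\alpha\}=\{w_{\alpha,c},\overline{w_{\alpha,c}}\}.$$ Moreover, for all $c\in A_\alpha$ and all compact sets $U,V\subset\mathbb{R}$, $$\lim_{n\to\infty}\ \sup_{u\in U,\,v\in V}\left|\frac{(C_{\alpha,c})^{v-u}}{n\rho_\alpha(c)}\,K_n\!\left(\Big(q_n,c+\frac{u}{n\rho_\alpha(c)}\Big),\Big(q_n,c+\frac{v}{n\rho_\alpha(c)}\Big)\right)-\frac{\sin(\pi(v-u))}{\pi(v-u)}\right|=0,$$ where $\rho_\alpha(c):=-\frac{1-\alpha}{\pi}\,\mathrm{Im}\big(w_{\alpha,c}^{-1}\big)$ and $C_{\alpha,c}:=\exp\left(\pi\,\frac{\mathrm{Re}(w_{\alpha,c}^{-1})}{\mathrm{Im}(w_{\alpha,c}^{-1})}\right)$.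
   Context: Fix real numbers $a<b$. For each $n\in\mathbb{N}$ fix $q_n\in\{1,\ldots,n\}$ and $x^{(n)}=(x_1^{(n)},\ldots,x_n^{(n)})\in[a,b]^n$ with $x_1^{(n)}>x_2^{(n)}>\cdots>x_n^{(n)}$. The Cauchy transform of $\mu$ is $G_\mu(w):=\int_{-\infty}^\infty\frac{1}{w-x}\,\mu[dx]$ for $w\in\mathbb{C}\setminus\mathbb{R}$, and $$A_\alpha:=\{c\in(a,b) : \exists\, w\in\mathbb{C}\setminus\mathbb{R}\text{ with }wG_\mu(w+c)=1-\alpha\}.$$ For $r\in\{1,\ldots,n-1\}$, $s\in\{1,\ldots,n\}$ and $u,v\in[a,b]$ the kernel $K_n$ is $$K_n((r,u),(s,v))=\sum_{j=1}^n 1_{v\le u<x_j^{(n)}}\frac{(x_j^{(n)}-u)^{n-r-1}}{(n-r-1)!}\frac{\partial^{n-s}}{\partial v^{n-s}}\prod_{i\ne j}\left(\frac{v-x_i^{(n)}}{x_j^{(n)}-x_i^{(n)}}\right)-\sum_{j=1}^n 1_{v>u>x_j^{(n)}}\frac{(x_j^{(n)}-u)^{n-r-1}}{(n-r-1)!}\frac{\partial^{n-s}}{\partial v^{n-s}}\prod_{i\ne j}\left(\frac{v-x_i^{(n)}}{x_j^{(n)}-x_i^{(n)}}\right),$$ where the derivative acts only on the polynomial in $v$ to its right. (This is a correlation kernel of the eigenvalue minor process of $U_nB_nU_n^*$, where $B_n$ is a fixed Hermitian matrix with eigenvalues $x^{(n)}$ and $U_n$ is a Haar distributed $n\times n$ unitary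 matrix; $K_n((q_n,\cdot),(q_n,\cdot))$ is a correlation kernel of the eigenvalues of the upper left $q_n\times q_n$ block.) The quotient $\frac{\sin(\pi(v-u))}{\pi(v-u)}$ is read as $1$ when $u=v$. The expression inside the limit is well defined for all $n$ sufficiently large. *)

theory Defs
  imports "HOL-Probability.Probability"
begin

(* n^{-1} (delta_{x_1} + ... + delta_{x_n}), as the law of x_i for i uniform on {1..n} *)
definition empirical_measure :: "nat \<Rightarrow> (nat \<Rightarrow> real) \<Rightarrow> real measure" where
  "empirical_measure n x = distr (uniform_count_measure {1..n}) borel x"

definition measure_support :: "'a::topological_space measure \<Rightarrow> 'a set" where
  "measure_support M = {x. \<forall>S. open S \<longrightarrow> x \<in> S \<longrightarrow> emeasure M S > 0}"

definition cauchy_transform :: "real measure \<Rightarrow> complex \<Rightarrow> complex" where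
  "cauchy_transform M w = (\<integral>x. 1 / (w - of_real x) \<partial>M)"

definition nonreal_roots :: "real measure \<Rightarrow> real \<Rightarrow> real \<Rightarrow> complex set" where
  "nonreal_roots M \<alpha> c =
     {w. w \<notin> \<real> \<and> w * cauchy_transform M (w + of_real c) = of_real (1 - \<alpha>)}"

definition A_set :: "real \<Rightarrow> real \<Rightarrow> real measure \<Rightarrow> real \<Rightarrow> real set" where
  "A_set a b M \<alpha> = {c \<in> {a<..<b}. \<exists>w. w \<in> nonreal_roots M \<alpha> c}"

(* Meaningful for 1 \<le> r < n and 1 \<le> s \<le> n; the exponent n - r - 1 truncates to 0 for r \<ge> n. *)
definition minor_kernel ::
  "nat \<Rightarrow> (nat \<Rightarrow> real) \<Rightarrow> nat \<times> real \<Rightarrow> nat \<times> real \<Rightarrow> real" where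
  "minor_kernel n x = (\<lambda>(r, u) (s, v).
     (\<Sum>j=1..n. of_bool (v \<le> u \<and> u < x j) *
        ((x j - u) ^ (n - r - 1) / fact (n - r - 1)) *
        (deriv ^^ (n - s)) (\<lambda>t. \<Prod>i\<in>{1..n} - {j}. (t - x i) / (x j - x i)) v) -
     (\<Sum>j=1..n. of_bool (v > u \<and> u > x j) *
        ((x j - u) ^ (n - r - 1) / fact (n - r - 1)) *
        (deriv ^^ (n - s)) (\<lambda>t. \<Prod>i\<in>{1..n} - {j}. (t - x i) / (x j - x i)) v))"

(* In the next two definitions w is the root in the upper half-plane. *)
definition rho :: "real \<Rightarrow> complex \<Rightarrow> real" where
  "rho \<alpha> w = - ((1 - \<alpha>) / pi) * Im (inverse w)"

definition conj_const :: "complex \<Rightarrow> real" where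
  "conj_const w = exp (pi * (Re (inverse w) / Im (inverse w)))"

end

theory Submission
  imports Defs "HOL-Complex_Analysis.Complex_Analysis"
begin

text \<open>Translate \<open>c\<close> to \<open>0\<close> and put \<open>N = n - q n\<close>. By Lagrange interpolation the two sums of the kernel
agree, so that the kernel is \<open>N / (2 \<pi> \<i>)\<close> times the integral of \<open>Q w / (w - v) ^ (N + 1)\<close> over a circle,
where \<open>Q\<close> is the partial interpolation of \<open>(t - u) ^ (N - 1)\<close> at the nodes beyond \<open>u\<close>. Expressing \<open>Q\<close> as an
integral over a contour in \<open>z\<close> through the critical point of the logarithmic potential gives a double
integral and, on the arc of the circle to the right of the critical point, the residue at \<open>z = w\<close>. The residue has
the primitive \<open>((w - u) / (w - v)) ^ N\<close> and produces the sine kernel.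

For the double integral no steepest descent contours have to be constructed. On the circle through the
critical point the modulus of the integrand is maximal there, because \<open>1 + x \<le> exp x\<close>. The \<open>z\<close>-contour
leaves the critical point radially and then only has to stay in a superlevel set of the potential.
By the maximum modulus principle every circle of another radius contains a point above the
saddle level, and the superlevel set on each circle is an arc, since the potential is concave as a
function of the real part; hence such a path exists. Critical points for finite \<open>n\<close> come from Hurwitz's theorem.\<close>

subsection \<open>Lagrange interpolation and the kernel\<close>

text \<open>Only weak convergence of the empirical measures is available, so \<open>Hn\<close> tends
  to \<open>H\<close> uniformly on compact subsets of the open upper half-plane, and nothing is
  controlled near the axis, where nodes may lie arbitrarily close to \<open>u\<close>. Yet the
  circle and the z-contour both reach the axis. The estimates there are therefore exact inequalities
  at finite n: \<open>circle_maximum\<close> on the circle, \<open>vertical_bound\<close> above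
  \<open>u\<close>, \<open>Hn_outer\<close> beyond the support. At a critical point w the imaginary
  part of the equation says that the mean of \<open>t / |w - t|^2\<close> vanishes. This makes the
  circle a maximum and turns the second radial derivative into a mean of squares, hence positive: a
  strict radial minimum. The other difficulty is that the contours cross at the saddle, where
  \<open>1 / (w - z)\<close> is singular; the singularity is shared between the two integrations,
  and a factor \<open>n powr (-1/8)\<close> still remains as gain. Since u and v are of order 1/n,
  they change the integrand only by factors bounded in n, so everything is proved along arbitrary
  bounded sequences, which yields the supremum over U and V.\<close>

lemma funpow_deriv_poly:
  fixes p :: "'a::real_normed_field poly"
  shows "(deriv ^^ k) (\<lambda>t. poly p t) = (\<lambda>t. poly ((pderiv ^^ k) p) t)"
proof (induction k)
  case (Suc k)
  have "deriv (\<lambda>t. poly ((pderiv ^^ k) p) t) = (\<lambda>t. poly (pderiv ((pderiv ^^ k) p)) t)"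
    by (rule ext, rule DERIV_imp_deriv, rule poly_DERIV)
  with Suc show ?case by simp
qed simp

lemma pderiv_map_poly_of_real:
  "pderiv (map_poly of_real p :: complex poly) = map_poly of_real (pderiv p)"
  by (rule poly_eqI) (simp add: coeff_pderiv coeff_map_poly)

lemma funpow_pderiv_map_poly_of_real:
  "(pderiv ^^ k) (map_poly of_real p :: complex poly) = map_poly of_real ((pderiv ^^ k) p)"
  by (induction k) (simp_all add: pderiv_map_poly_of_real)

lemma poly_map_poly_of_real:
  "poly (map_poly of_real p :: complex poly) (of_real t) = of_real (poly p t)"
  by (induction p) (simp_all add: map_poly_pCons)

lemma Cauchy_higher_derivative_real_poly:
  fixes p :: "real poly"
  assumes "\<bar>v\<bar> < R"
  shows "((\<lambda>w. poly (map_poly of_real p) w / (w - of_real v) ^ Suc k) has_contour_integral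
      2 * pi * \<i> / fact k * of_real ((deriv ^^ k) (\<lambda>t. poly p t) v)) (circlepath 0 R)"
proof -
  let ?f = "\<lambda>w. poly (map_poly of_real p :: complex poly) w"
  have "((\<lambda>u. ?f u / (u - of_real v) ^ Suc k) has_contour_integral
      (2 * pi * \<i>) / (fact k) * (deriv ^^ k) ?f (of_real v)) (circlepath 0 R)"
    using assms by (intro Cauchy_has_contour_integral_higher_derivative_circlepath)
       (auto intro!: continuous_intros holomorphic_intros simp: poly_holomorphic_on)
  moreover have "(deriv ^^ k) ?f (of_real v) = of_real ((deriv ^^ k) (\<lambda>t. poly p t) v)"
    by (simp add: funpow_deriv_poly funpow_pderiv_map_poly_of_real
        poly_map_poly_of_real)
  ultimately show ?thesis by simp
qed

lemma funpow_deriv_shift: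
  fixes f :: "real \<Rightarrow> real"
  shows "(deriv ^^ k) (\<lambda>t. f (t + c)) = (\<lambda>t. (deriv ^^ k) f (t + c))"
proof (induction k)
  case (Suc k)
  have "deriv (\<lambda>t. g (t + c)) = (\<lambda>t. deriv g (t + c))" for g :: "real \<Rightarrow> real"
    unfolding deriv_def by (simp add: DERIV_shift)
  with Suc show ?case by simp
qed simp

text \<open>Polymorphic, so that the same product is the real basis polynomial of the kernel and its
  extension to complex contour points. \<open>lagrange_poly\<close> is the formal version, to which
  degree and \<open>pderiv\<close> arguments apply.\<close>

definition lagrange_basis :: "nat \<Rightarrow> (nat \<Rightarrow> real) \<Rightarrow> nat \<Rightarrow> 'a::real_field \<Rightarrow> 'a" where
  "lagrange_basis n x j t = (\<Prod>i\<in>{1..n} - {j}. (t - of_real (x i)) / of_real (x j - x i))"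

definition lagrange_poly :: "nat \<Rightarrow> (nat \<Rightarrow> real) \<Rightarrow> nat \<Rightarrow> real poly" where
  "lagrange_poly n x j = (\<Prod>i\<in>{1..n} - {j}. smult (1 / (x j - x i)) [:- x i, 1:])"

lemma poly_lagrange_poly: "poly (lagrange_poly n x j) t = lagrange_basis n x j t"
  by (simp add: lagrange_poly_def lagrange_basis_def poly_prod diff_divide_distrib add.commute)

lemma map_poly_of_real_mult:
  "map_poly of_real (p * r) = (map_poly of_real p * map_poly of_real r :: complex poly)"
  by (rule poly_eqI) (simp add: coeff_map_poly coeff_mult)

lemma map_poly_of_real_prod:
  "map_poly of_real (\<Prod>i\<in>S. f i) = (\<Prod>i\<in>S. map_poly of_real (f i) :: complex poly)"
  by (induction S rule: infinite_finite_induct) (simp_all add: map_poly_of_real_mult)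

lemma poly_map_lagrange_poly:
  "poly (map_poly of_real (lagrange_poly n x j)) w = (lagrange_basis n x j w :: complex)"
  by (simp add: lagrange_poly_def lagrange_basis_def poly_prod map_poly_of_real_prod map_poly_smult
      map_poly_pCons diff_divide_distrib add.commute)

lemma degree_lagrange_poly:
  assumes "j \<in> {1..n}"
  shows "degree (lagrange_poly n x j) < n"
proof -
  have "degree (lagrange_poly n x j) \<le> (\<Sum>i\<in>{1..n} - {j}. degree (smult (1 / (x j - x i)) [:- x i, 1:]))"
    unfolding lagrange_poly_def by (rule degree_prod_sum_le[unfolded o_def]) auto
  also have "\<dots> \<le> (\<Sum>i\<in>{1..n} - {j}. 1)"
    by (intro sum_mono) simp
  also have "\<dots> < n" using assms by simp
  finally show ?thesis .
qed

lemma lagrange_basis_node: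
  assumes "inj_on x {1..n}" "j \<in> {1..n}" "k \<in> {1..n}"
  shows "lagrange_basis n x j (x k) = (if k = j then 1 else 0 :: real)"
proof (cases "k = j")
  case True
  have "x j \<noteq> x i" if "i \<in> {1..n} - {j}" for i
    using assms(1,2) that by (auto dest: inj_onD)
  then have "(\<Prod>i\<in>{1..n} - {j}. (x j - x i) / (x j - x i)) = 1"
    by (intro prod.neutral) simp
  then show ?thesis using True by (simp add: lagrange_basis_def)
next
  case False
  have "lagrange_basis n x j (x k) = (0 :: real)"
    unfolding lagrange_basis_def
    by (rule prod_zero) (use False assms in \<open>auto intro!: bexI[of _ k]\<close>)
  then show ?thesis using False by simp
qed

lemma lagrange_interpolation:
  assumes "inj_on x {1..n}" "degree p < n"
  shows "p = (\<Sum>j=1..n. smult (poly p (x j)) (lagrange_poly n x j))"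
proof (rule poly_eqI_degree[where A = "x ` {1..n}"])
  fix t assume "t \<in> x ` {1..n}"
  then obtain k where k: "k \<in> {1..n}" "t = x k" by auto
  show "poly p t = poly (\<Sum>j=1..n. smult (poly p (x j)) (lagrange_poly n x j)) t"
  proof -
    have "(\<Sum>j=1..n. poly p (x j) * lagrange_basis n x j t)
        = (\<Sum>j=1..n. if k = j then poly p (x j) else 0)"
      using k by (intro sum.cong) (auto simp: lagrange_basis_node[OF assms(1)])
    also have "\<dots> = poly p t" using k by simp
    finally show ?thesis by (simp add: poly_sum poly_lagrange_poly)
  qed
next
  show "degree p < card (x ` {1..n})" using assms by (simp add: card_image)
  have "degree (\<Sum>j=1..n. smult (poly p (x j)) (lagrange_poly n x j)) < n"
    using assms(2) le_less_trans[OF degree_smult_le degree_lagrange_poly[of _ n x]]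
    by (intro degree_sum_less) auto
  then show "degree (\<Sum>j=1..n. smult (poly p (x j)) (lagrange_poly n x j)) < card (x ` {1..n})"
    using assms(1) by (simp add: card_image)
qed

text \<open>The polynomial Q of the overview, with \<open>m\<close> for N - 1. Up to
  \<open>fact m\<close>, the first sum of the kernel for v \<le> u is its derivative of order n - q
  at v.\<close>

definition upper_interpolant :: "nat \<Rightarrow> (nat \<Rightarrow> real) \<Rightarrow> nat \<Rightarrow> real \<Rightarrow> complex \<Rightarrow> complex" where
  "upper_interpolant n x m u w =
     (\<Sum>j\<in>{j\<in>{1..n}. u < x j}. of_real ((x j - u) ^ m) * lagrange_basis n x j w)"

lemma higher_pderiv_eq_0:
  fixes p :: "'a::{comm_semiring_1,semiring_no_zero_divisors} poly"
  shows "degree p < k \<Longrightarrow> (pderiv ^^ k) p = 0"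
  by (rule poly_eqI) (simp add: coeff_higher_pderiv coeff_eq_0)

lemma degree_shifted_power: "degree ([:- u, 1:] ^ m :: 'a::idom poly) = m"
  by (simp add: degree_power_eq)

text \<open>Splitting the interpolation of the polynomial \<open>(t - u) ^ m\<close> of degree \<open>m < n - q\<close> into the
  nodes above and below \<open>u\<close> turns the second sum of the kernel into the first one.\<close>

lemma minor_kernel_eq_upper:
  assumes inj: "inj_on x {1..n}" and q: "q + 2 \<le> n"
  defines "m \<equiv> n - q - 1"
  shows "minor_kernel n x (q, u) (q, v) =
    (deriv ^^ (n - q)) (\<lambda>t. poly (\<Sum>j\<in>{j\<in>{1..n}. u < x j}. smult ((x j - u) ^ m) (lagrange_poly n x j)) t) v / fact m"
proof -
  define D where "D p = poly ((pderiv ^^ (n - q)) p) v" for p :: "real poly"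
  let ?L = "lagrange_poly n x"
  have D_sum: "D (\<Sum>j\<in>J. smult (a j) (?L j)) = (\<Sum>j\<in>J. a j * D (?L j))" for J a
    by (simp add: D_def higher_pderiv_sum higher_pderiv_smult poly_sum)
  have basis: "(deriv ^^ (n - q)) (\<lambda>t. \<Prod>i\<in>{1..n} - {j}. (t - x i) / (x j - x i)) v = D (?L j)" for j
  proof -
    have "(\<lambda>t. \<Prod>i\<in>{1..n} - {j}. (t - x i) / (x j - x i)) = (\<lambda>t. poly (?L j) t)"
      by (simp add: poly_lagrange_poly lagrange_basis_def fun_eq_iff)
    then show ?thesis by (simp only: funpow_deriv_poly D_def)
  qed
  have m: "0 < m" "m < n - q" "m < n" using q by (auto simp: m_def)
  have up: "(deriv ^^ (n - q)) (\<lambda>t. poly (\<Sum>j\<in>{j\<in>{1..n}. u < x j}. smult ((x j - u) ^ m) (?L j)) t) v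
      = (\<Sum>j\<in>{j\<in>{1..n}. u < x j}. (x j - u) ^ m * D (?L j))"
    by (simp only: funpow_deriv_poly flip: D_sum) (simp only: D_def)
  have first: "(\<Sum>j=1..n. of_bool (u < x j) * ((x j - u) ^ m / fact m) * D (?L j))
      = (\<Sum>j\<in>{j\<in>{1..n}. u < x j}. (x j - u) ^ m * D (?L j)) / fact m"
    unfolding sum_divide_distrib by (rule sum.mono_neutral_cong_right) auto
  have second: "(\<Sum>j=1..n. of_bool (u > x j) * ((x j - u) ^ m / fact m) * D (?L j))
      = (\<Sum>j\<in>{j\<in>{1..n}. x j < u}. (x j - u) ^ m * D (?L j)) / fact m"
    unfolding sum_divide_distrib by (rule sum.mono_neutral_cong_right) auto
  have "[:- u, 1:] ^ m = (\<Sum>j=1..n. smult (poly ([:- u, 1:] ^ m) (x j)) (?L j))"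
    using m by (intro lagrange_interpolation inj) (simp add: degree_shifted_power)
  then have "D ([:- u, 1:] ^ m) = (\<Sum>j=1..n. poly ([:- u, 1:] ^ m) (x j) * D (?L j))"
    by (subst D_sum [symmetric]) (rule arg_cong[where f = D])
  then have "D ([:- u, 1:] ^ m) = (\<Sum>j=1..n. (x j - u) ^ m * D (?L j))"
    by (simp add: poly_power)
  moreover have "D ([:- u, 1:] ^ m) = 0"
    using m by (simp add: D_def higher_pderiv_eq_0 degree_shifted_power)
  \<comment> \<open>A node equal to \<open>u\<close> is in neither set; its term vanishes because
    \<open>m\<close> is positive, which is what \<open>q + 2 \<le> n\<close> secures.\<close>
  moreover have "(\<Sum>j=1..n. (x j - u) ^ m * D (?L j)) =
     (\<Sum>j\<in>{j\<in>{1..n}. u < x j}. (x j - u) ^ m * D (?L j)) + (\<Sum>j\<in>{j\<in>{1..n}. x j < u}. (x j - u) ^ m * D (?L j))"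
    using m by (subst sum.union_disjoint [symmetric]) (auto intro!: sum.mono_neutral_right)
  ultimately have total: "(\<Sum>j\<in>{j\<in>{1..n}. u < x j}. (x j - u) ^ m * D (?L j))
      = - (\<Sum>j\<in>{j\<in>{1..n}. x j < u}. (x j - u) ^ m * D (?L j))"
    by simp
  have K: "minor_kernel n x (q, u) (q, v) =
      (\<Sum>j=1..n. of_bool (v \<le> u \<and> u < x j) * ((x j - u) ^ m / fact m) * D (?L j)) -
      (\<Sum>j=1..n. of_bool (v > u \<and> u > x j) * ((x j - u) ^ m / fact m) * D (?L j))"
    by (simp only: minor_kernel_def prod.case basis m_def)
  show ?thesis
  proof (cases "v \<le> u")
    case True
    then show ?thesis
      using first up by (simp add: K)
  next
    case False
    then show ?thesis
      using second up total by (simp add: K)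
  qed
qed

lemma poly_map_upper:
  "poly (map_poly of_real (\<Sum>j\<in>{j\<in>{1..n}. u < x j}. smult ((x j - u) ^ m) (lagrange_poly n x j))) w
    = upper_interpolant n x m u w"
proof -
  have "map_poly of_real (\<Sum>j\<in>J. f j) = (\<Sum>j\<in>J. map_poly of_real (f j) :: complex poly)" for J :: "nat set" and f
    by (rule poly_eqI) (simp add: coeff_map_poly coeff_sum)
  then show ?thesis
    by (simp add: upper_interpolant_def poly_sum map_poly_smult poly_map_lagrange_poly)
qed

text \<open>Cauchy's formula for the derivative of order n - q brings in
  \<open>fact (n - q)\<close>, and the \<open>fact m\<close> of the kernel with m = n - q - 1
  cancels all of it but the factor n - q. That factor is of order n and is absorbed later by the
  normalisation with \<open>n * rho\<close>.\<close>

lemma minor_kernel_contour: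
  assumes inj: "inj_on x {1..n}" and q: "q + 2 \<le> n" and v: "\<bar>v\<bar> < R"
  defines "m \<equiv> n - q - 1"
  shows "((\<lambda>w. upper_interpolant n x m u w / (w - of_real v) ^ (m + 2)) has_contour_integral
      2 * pi * \<i> / of_real (real (n - q)) * of_real (minor_kernel n x (q, u) (q, v))) (circlepath 0 R)"
proof -
  have N: "Suc (n - q) = m + 2" "fact (n - q) = real (n - q) * fact m"
    using q by (auto simp: m_def fact_reduce simp flip: One_nat_def)
  have N': "(fact (n - q) :: complex) = of_real (real (n - q) * fact m)"
    by (simp only: N(2)[symmetric] of_real_fact)
  define N where "N = n - q"
  have "N \<noteq> 0" using q by (simp add: N_def)
  then show ?thesis
    using Cauchy_higher_derivative_real_poly[OF v, where k = "n - q" and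
      p = "\<Sum>j\<in>{j\<in>{1..n}. u < x j}. smult ((x j - u) ^ m) (lagrange_poly n x j)"]
    unfolding poly_map_upper minor_kernel_eq_upper[OF inj q, folded m_def] N N' of_real_divide
    unfolding N_def [symmetric]
    by (simp add: mult_ac)
qed

text \<open>By conjugation symmetry the substitution t to 2 pi - t maps the lower half of the circle
  to the conjugate of the upper half. Afterwards only the upper half has to be estimated, which
  meets one critical point instead of a conjugate pair.\<close>

lemma circle_integral_symmetric:
  assumes f: "(f has_contour_integral I) (circlepath 0 R)"
    and cont: "continuous_on (sphere 0 R) f" and R: "0 < R"
    and sym: "\<And>w. f (cnj w) = cnj (f w)"
  shows "I / (2 * pi * \<i>) = of_real (Re (integral {0..pi} (\<lambda>t. f (R * cis t) * (R * cis t))) / pi)"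
proof -
  define g where "g = (\<lambda>t. f (R * cis t) * (R * cis t))"
  have contg: "continuous_on S g" for S
  proof -
    have "continuous_on S (\<lambda>t. f (R * cis t))"
      by (rule continuous_on_compose2[OF cont]) (use R in \<open>auto intro!: continuous_intros simp: norm_mult\<close>)
    then show ?thesis unfolding g_def by (intro continuous_intros)
  qed
  have I: "((\<lambda>t. f (0 + R * cis t) * R * \<i> * cis t) has_integral I) {0..2*pi}"
    using f unfolding circlepath_def by (subst (asm) has_contour_integral_part_circlepath_iff) auto
  have "((\<lambda>t. \<i> * g t) has_integral I) {0..2*pi}"
    using I by (simp add: g_def mult_ac)
  moreover have "((\<lambda>t. \<i> * g t) has_integral \<i> * integral {0..2*pi} g) {0..2*pi}"
    by (intro has_integral_mult_right integrable_integral integrable_continuous_real contg)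
  ultimately have I2: "I = \<i> * integral {0..2*pi} g" by (rule has_integral_unique)
  have "((\<lambda>t. g (- 1 *\<^sub>R t + 2 * pi)) has_integral (1 / \<bar>- 1\<bar> ^ DIM(real)) *\<^sub>R integral {pi..2*pi} g)
     ((\<lambda>x. (1 / - 1) *\<^sub>R x + - ((1 / - 1) *\<^sub>R (2 * pi))) ` {pi..2*pi})"
    using integrable_integral[OF integrable_continuous_real[OF contg[of "{pi..2*pi}"]]]
    by (intro has_integral_affinity[of g "integral {pi..2*pi} g" pi "2*pi" "-1" "2*pi", unfolded cbox_interval]) auto
  moreover have "(\<lambda>x. (1 / - 1) *\<^sub>R x + - ((1 / - 1) *\<^sub>R (2 * pi))) ` {pi..2*pi} = {0..pi}"
  proof -
    have "(\<lambda>x. 2 * pi - x) ` {pi..2*pi} = {2*pi - 2*pi..2*pi - pi}"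
      by (rule image_diff_atLeastAtMost)
    then show ?thesis by simp
  qed
  moreover have "g (- 1 *\<^sub>R t + 2 * pi) = cnj (g t)" for t
  proof -
    have "cis (2 * pi - t) = cnj (cis t)"
      by (simp add: cis.ctr complex_eq_iff)
    then show ?thesis using sym[of "R * cis t"] by (simp add: g_def)
  qed
  ultimately have "((\<lambda>t. cnj (g t)) has_integral integral {pi..2*pi} g) {0..pi}"
    by simp
  then have "integral {pi..2*pi} g = cnj (integral {0..pi} g)"
    by (simp add: integral_cnj integral_unique)
  moreover have "integral {0..2*pi} g = integral {0..pi} g + integral {pi..2*pi} g"
    by (rule Henstock_Kurzweil_Integration.integral_combine [symmetric])
       (auto intro!: integrable_continuous_real contg)
  ultimately have "integral {0..2*pi} g = of_real (2 * Re (integral {0..pi} g))"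
    by (simp add: complex_eq_iff)
  then have "I / (2 * pi * \<i>) = of_real (Re (integral {0..pi} g) / pi)"
    unfolding I2 by (simp add: field_simps)
  then show ?thesis unfolding g_def .
qed

lemma lagrange_basis_cnj: "lagrange_basis n x j (cnj w) = cnj (lagrange_basis n x j w)"
  by (simp add: lagrange_basis_def cnj_prod)

lemma upper_interpolant_cnj: "upper_interpolant n x m u (cnj w) = cnj (upper_interpolant n x m u w)"
  by (simp add: upper_interpolant_def lagrange_basis_cnj cnj_sum)

lemma continuous_on_upper_interpolant [continuous_intros]:
  "continuous_on S (upper_interpolant n x m u)"
  unfolding upper_interpolant_def lagrange_basis_def divide_inverse by (intro continuous_intros)

lemma minor_kernel_half_circle:
  fixes R :: real
  assumes inj: "inj_on x {1..n}" and q: "q + 2 \<le> n" and v: "\<bar>v\<bar> < R"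
  defines "m \<equiv> n - q - 1"
  shows "minor_kernel n x (q, u) (q, v) = real (n - q) / pi * Re (integral {0..pi}
     (\<lambda>t. upper_interpolant n x m u (R * cis t) / (R * cis t - v) ^ (m + 2) * (R * cis t)))"
proof -
  let ?f = "\<lambda>w. upper_interpolant n x m u w / (w - of_real v) ^ (m + 2)"
  have ne: "w \<noteq> complex_of_real v" if "cmod w = R" for w
    using that v by auto
  note 1 = minor_kernel_contour[OF inj q v, of u, folded m_def]
  have 2: "continuous_on (sphere (0::complex) R) ?f"
    using ne by (auto intro!: continuous_intros)
  have 3: "0 < R" using v by simp
  have 4: "?f (cnj w) = cnj (?f w)" for w
    by (simp add: upper_interpolant_cnj)
  note circle_integral_symmetric[OF 1 2 3 4]
  then have "complex_of_real (minor_kernel n x (q, u) (q, v) / real (n - q))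
     = of_real (Re (integral {0..pi} (\<lambda>t. ?f (R * cis t) * (R * cis t))) / pi)"
    by simp
  then have "minor_kernel n x (q, u) (q, v) / real (n - q)
     = Re (integral {0..pi} (\<lambda>t. ?f (R * cis t) * (R * cis t))) / pi"
    by (simp only: of_real_eq_iff)
  then show ?thesis using q by (simp add: field_simps)
qed

lemma minor_kernel_shift:
  "minor_kernel n x (r, c + u) (s, c + v) = minor_kernel n (\<lambda>i. x i - c) (r, u) (s, v)"
proof -
  have "(deriv ^^ k) (\<lambda>t. \<Prod>i\<in>A. (t - x i) / (x j - x i)) (c + v)
      = (deriv ^^ k) (\<lambda>t. \<Prod>i\<in>A. (t - (x i - c)) / (x j - c - (x i - c))) v" for k j A
    using fun_cong[OF funpow_deriv_shift[of k "\<lambda>t. \<Prod>i\<in>A. (t - x i) / (x j - x i)" c], of v]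
    by (simp add: algebra_simps)
  then show ?thesis
    unfolding minor_kernel_def by (simp add: algebra_simps)
qed

section \<open>Partial fractions of the integrand\<close>

definition node_poly :: "nat \<Rightarrow> (nat \<Rightarrow> real) \<Rightarrow> complex \<Rightarrow> complex" where
  "node_poly n x w = (\<Prod>i=1..n. w - of_real (x i))"

text \<open>The residue at \<open>x j\<close> of
  \<open>(z - u) ^ m / node_poly n x z\<close>.\<close>

definition pf_coeff :: "nat \<Rightarrow> (nat \<Rightarrow> real) \<Rightarrow> nat \<Rightarrow> real \<Rightarrow> nat \<Rightarrow> real" where
  "pf_coeff n x m u j = (x j - u) ^ m / (\<Prod>i\<in>{1..n} - {j}. x j - x i)"

text \<open>The node \<open>x j = u\<close>, whose coefficient vanishes, is left out so that the function is regular
  at the end point \<open>u\<close> of the contours below.\<close>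

definition pf_sum :: "nat \<Rightarrow> (nat \<Rightarrow> real) \<Rightarrow> nat \<Rightarrow> real \<Rightarrow> complex \<Rightarrow> complex" where
  "pf_sum n x m u z = (\<Sum>j\<in>{j\<in>{1..n}. x j \<noteq> u}. of_real (pf_coeff n x m u j) / (z - of_real (x j)))"

lemma lagrange_basis_eq:
  assumes "w \<notin> of_real ` x ` {1..n}" "j \<in> {1..n}"
  shows "of_real ((x j - u) ^ m) * lagrange_basis n x j w
     = node_poly n x w * (of_real (pf_coeff n x m u j) / (w - of_real (x j)))"
proof -
  have "node_poly n x w = (w - of_real (x j)) * (\<Prod>i\<in>{1..n} - {j}. w - of_real (x i))"
    unfolding node_poly_def using assms(2) by (subst prod.remove[of _ j]) auto
  moreover have "w - of_real (x j) \<noteq> 0" using assms by auto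
  ultimately show ?thesis
    by (simp add: lagrange_basis_def pf_coeff_def prod_dividef del: of_real_diff)
qed

lemma upper_interpolant_eq:
  assumes "w \<notin> of_real ` x ` {1..n}"
  shows "upper_interpolant n x m u w = node_poly n x w *
    (\<Sum>j\<in>{j\<in>{1..n}. u < x j}. of_real (pf_coeff n x m u j) / (w - of_real (x j)))"
  unfolding upper_interpolant_def sum_distrib_left
  by (intro sum.cong refl lagrange_basis_eq[OF assms]) auto

lemma node_poly_nonzero: "w \<notin> of_real ` x ` {1..n} \<Longrightarrow> node_poly n x w \<noteq> 0"
  by (auto simp: node_poly_def)

text \<open>Interpolation at all nodes reproduces \<open>(w - u) ^ m\<close> because m < n; division
  by the node polynomial turns it into partial fractions. A node at \<open>u\<close> has coefficient
  \<open>0 ^ m = 0\<close>, as m > 0, so leaving it out of \<open>pf_sum\<close> changes nothing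
  away from the nodes.\<close>

lemma pf_sum_eq:
  assumes inj: "inj_on x {1..n}" and m: "0 < m" "m < n" and w: "w \<notin> of_real ` x ` {1..n}"
  shows "pf_sum n x m u w = (w - of_real u) ^ m / node_poly n x w"
proof -
  have "[:- u, 1:] ^ m = (\<Sum>j=1..n. smult (poly ([:- u, 1:] ^ m) (x j)) (lagrange_poly n x j))"
    using m by (intro lagrange_interpolation inj) (simp add: degree_shifted_power)
  then have "poly (map_poly of_real ([:- u, 1:] ^ m)) w =
      poly (map_poly of_real (\<Sum>j=1..n. smult ((x j - u) ^ m) (lagrange_poly n x j))) w"
    by (simp add: poly_power)
  moreover have "map_poly of_real (\<Sum>j\<in>J. f j) = (\<Sum>j\<in>J. map_poly of_real (f j) :: complex poly)"
    for J :: "nat set" and f by (rule poly_eqI) (simp add: coeff_map_poly coeff_sum)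
  moreover have "map_poly of_real ([:- u, 1:] ^ m) = ([:- of_real u, 1:] ^ m :: complex poly)"
    by (induction m) (simp_all add: map_poly_of_real_mult map_poly_pCons del: mult_pCons_left)
  ultimately have "(w - of_real u) ^ m = (\<Sum>j=1..n. of_real ((x j - u) ^ m) * lagrange_basis n x j w)"
    by (simp add: poly_sum map_poly_smult poly_map_lagrange_poly poly_power)
  also have "\<dots> = (\<Sum>j=1..n. node_poly n x w * (of_real (pf_coeff n x m u j) / (w - of_real (x j))))"
    by (intro sum.cong refl lagrange_basis_eq w)
  also have "\<dots> = (\<Sum>j\<in>{j\<in>{1..n}. x j \<noteq> u}. node_poly n x w * (of_real (pf_coeff n x m u j) / (w - of_real (x j))))"
    by (rule sum.mono_neutral_right) (use m in \<open>auto simp: pf_coeff_def\<close>)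
  also have "\<dots> = node_poly n x w * pf_sum n x m u w"
    by (simp add: pf_sum_def sum_distrib_left)
  finally show ?thesis using node_poly_nonzero[OF w] by (simp add: field_simps)
qed

subsection \<open>Contours in the upper half-plane\<close>

text \<open>Only the upper half of a closed contour is constructed; the lower half is its mirror
  image. The end point \<open>B\<close> will lie to the right of all nodes, so that the closed
  contour separates the nodes beyond \<open>u\<close> from those below.\<close>

locale upper_path =
  fixes \<gamma> :: "real \<Rightarrow> complex" and u B :: real
  assumes valid: "valid_path \<gamma>"
    and start: "pathstart \<gamma> = of_real u" and finish: "pathfinish \<gamma> = of_real B"
    and image: "path_image \<gamma> \<subseteq> {z. Im z > 0} \<union> {of_real u, of_real B}"
begin

text \<open>Out through the upper half-plane from \<open>u\<close> to \<open>B\<close> and back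
  through the lower one, hence clockwise: this is the origin of the winding number -1 and of the
  minus signs below.\<close>

definition double :: "real \<Rightarrow> complex" where
  "double = \<gamma> +++ reversepath (cnj \<circ> \<gamma>)"

lemma valid_cnj: "valid_path (cnj \<circ> \<gamma>)"
  using valid by (simp add: valid_path_cnj)

lemma valid_double: "valid_path double"
  unfolding double_def using valid valid_cnj finish
  by (auto intro!: valid_path_join simp: pathfinish_compose)

lemma closed_double: "pathfinish double = pathstart double"
  using start by (simp add: double_def pathstart_compose)

lemma path_image_double: "path_image double = path_image \<gamma> \<union> cnj ` path_image \<gamma>"
  using valid_cnj valid finish
  by (simp add: double_def path_image_join pathfinish_compose path_image_compose)

lemma not_in_path_image_cnj: "w \<notin> path_image double \<Longrightarrow> cnj w \<notin> path_image \<gamma>"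
  by (metis (no_types, lifting) UnCI complex_cnj_cnj image_eqI path_image_double)

lemma integrable_Cauchy_kernel:
  "w \<notin> path_image \<gamma> \<Longrightarrow> (\<lambda>z. 1 / (z - w)) contour_integrable_on \<gamma>"
  using valid by (intro contour_integrable_holomorphic_simple[of _ "- {w}"]) (auto intro!: holomorphic_intros)

lemma contour_integral_double:
  assumes "w \<notin> path_image double"
  shows "2 * pi * \<i> * winding_number double w =
    contour_integral \<gamma> (\<lambda>z. 1 / (z - w)) - cnj (contour_integral \<gamma> (\<lambda>z. 1 / (z - cnj w)))"
proof -
  have w: "w \<notin> path_image \<gamma>" "w \<notin> path_image (cnj \<circ> \<gamma>)" "cnj w \<notin> path_image \<gamma>"
    using assms not_in_path_image_cnj[OF assms] by (auto simp: path_image_double path_image_compose)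
  have int: "(\<lambda>z. 1 / (z - w)) contour_integrable_on (cnj \<circ> \<gamma>)"
    using valid_cnj w by (intro contour_integrable_holomorphic_simple[of _ "- {w}"]) (auto intro!: holomorphic_intros)
  have "2 * pi * \<i> * winding_number double w = contour_integral double (\<lambda>z. 1 / (z - w))"
    using winding_number_valid_path[OF valid_double assms] by simp
  also have "\<dots> = contour_integral \<gamma> (\<lambda>z. 1 / (z - w)) - contour_integral (cnj \<circ> \<gamma>) (\<lambda>z. 1 / (z - w))"
    unfolding double_def using valid valid_cnj int integrable_Cauchy_kernel[OF w(1)]
    by (subst contour_integral_join) (auto simp: contour_integral_reversepath contour_integrable_reversepath)
  also have "contour_integral (cnj \<circ> \<gamma>) (\<lambda>z. 1 / (z - w)) = cnj (contour_integral \<gamma> (\<lambda>z. 1 / (z - cnj w)))"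
    by (subst contour_integral_cnj[OF valid]) (simp add: o_def)
  finally show ?thesis .
qed

text \<open>\<open>Ln (- \<i> (z - x))\<close> is a primitive of \<open>1 / (z - x)\<close> on the closed upper half-plane without \<open>x\<close>,
  because its branch cut points downwards.\<close>

lemma Im_contour_integral_Cauchy_kernel:
  assumes "x \<noteq> u" "x < B"
  shows "Im (contour_integral \<gamma> (\<lambda>z. 1 / (z - of_real x))) = (if u < x then - pi else 0)"
proof -
  let ?S = "{z. - \<i> * (z - of_real x) \<notin> \<real>\<^sub>\<le>\<^sub>0}"
  have sub: "path_image \<gamma> \<subseteq> ?S"
    using image assms by (auto simp: complex_nonpos_Reals_iff)
  have "((\<lambda>z. 1 / (z - of_real x)) has_contour_integral
      Ln (- \<i> * (pathfinish \<gamma> - of_real x)) - Ln (- \<i> * (pathstart \<gamma> - of_real x))) \<gamma>"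
  proof (rule contour_integral_primitive[OF _ valid sub])
    fix z assume z: "z \<in> ?S"
    then have "z \<noteq> of_real x" by auto
    then show "((\<lambda>z. Ln (- \<i> * (z - of_real x))) has_field_derivative 1 / (z - of_real x)) (at z within ?S)"
      using z by (auto intro!: derivative_eq_intros simp: field_simps)
  qed
  then have int: "contour_integral \<gamma> (\<lambda>z. 1 / (z - of_real x)) =
      Ln (- \<i> * of_real (B - x)) - Ln (- \<i> * of_real (u - x))"
    by (simp add: contour_integral_unique start finish)
  have Im_Ln: "Im (Ln (- \<i> * of_real t)) = (if t > 0 then - pi / 2 else pi / 2)" if "t \<noteq> 0" for t
  proof (cases "t > 0")
    case True
    have "Ln (of_real t * (- \<i>)) = of_real (ln t) + Ln (- \<i>)"
      using Ln_times_of_real[OF True, of "- \<i>"] True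
      by (simp add: Ln_of_real del: mult_minus_right)
    then show ?thesis using True by (simp add: mult.commute)
  next
    case False
    have "Ln (of_real (- t) * \<i>) = of_real (ln (- t)) + Ln \<i>"
      using Ln_times_of_real[of "- t" \<i>] False that by (simp add: Ln_of_real del: of_real_minus)
    then show ?thesis using False that by (simp add: mult.commute)
  qed
  show ?thesis
    unfolding int minus_complex.sel using assms by (simp only: Im_Ln) (auto simp: Im_Ln)
qed

text \<open>In partial fractions \<open>pf_sum / (w - z)\<close> has poles at the nodes and at
  \<open>w\<close>, and \<open>I w - cnj (I (cnj w))\<close> is its integral over
  \<open>double\<close>. The nodes beyond \<open>u\<close> contribute the terms of the interpolant.
  The pole at \<open>w\<close> contributes the complete sum, which \<open>pf_sum_eq\<close>
  evaluates as \<open>(w - u) ^ m / node_poly\<close>; this is the residue that carries the sine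
  kernel.\<close>

lemma upper_interpolant_contour:
  assumes nodes: "\<And>j. j \<in> {1..n} \<Longrightarrow> x j < B" and inj: "inj_on x {1..n}" and m: "0 < m" "m < n"
    and w: "w \<notin> path_image double" "w \<notin> of_real ` x ` {1..n}"
  defines "I \<equiv> \<lambda>w. contour_integral \<gamma> (\<lambda>z. pf_sum n x m u z / (w - z))"
  shows "upper_interpolant n x m u w + winding_number double w * (w - of_real u) ^ m
     = - node_poly n x w * (I w - cnj (I (cnj w))) / (2 * pi * \<i>)"
proof -
  have alg2: "p / (w - y) * (1 / (z - y) - 1 / (z - w)) = p / (z - y) / (w - z)"
    if "w \<noteq> y" "z \<noteq> y" "z \<noteq> w" for p w y z :: complex
  proof -
    have "1 / (z - y) - 1 / (z - w) = (w - y) / ((z - y) * (w - z))"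
      using that by (simp add: divide_simps) (simp add: algebra_simps)
    then show ?thesis using that by simp
  qed
  have alg1: "p * (c * (- b - N)) = - c * (b * p + N * p)" for p c b N :: complex
    by (simp add: algebra_simps)
  define J where "J = {j\<in>{1..n}. x j \<noteq> u}"
  define a where "a j = pf_coeff n x m u j" for j
  define L where "L w = contour_integral \<gamma> (\<lambda>z. 1 / (z - w))" for w
  have xJ: "complex_of_real (x j) \<notin> path_image \<gamma>" if "j \<in> J" for j
    using image nodes that by (force simp: J_def)
  have I: "I w = (\<Sum>j\<in>J. a j / (w - x j) * (L (x j) - L w))"
    if w: "w \<notin> path_image \<gamma>" "w \<notin> of_real ` x ` {1..n}" for w :: complex
  proof -
    have "((\<lambda>z. \<Sum>j\<in>J. a j / (w - x j) * (1 / (z - x j) - 1 / (z - w))) has_contour_integral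
        (\<Sum>j\<in>J. a j / (w - x j) * (L (x j) - L w))) \<gamma>"
      unfolding L_def
      by (intro has_contour_integral_sum has_contour_integral_lmul has_contour_integral_diff
          has_contour_integral_integral integrable_Cauchy_kernel xJ w) (auto simp: J_def)
    moreover have "(\<Sum>j\<in>J. a j / (w - x j) * (1 / (z - x j) - 1 / (z - w))) = pf_sum n x m u z / (w - z)"
      if "z \<in> path_image \<gamma>" for z :: complex
    proof -
      have "a j / (w - x j) * (1 / (z - x j) - 1 / (z - w)) = a j / (z - x j) / (w - z)" if "j \<in> J" for j
      proof -
        have "w \<noteq> x j" "z \<noteq> x j" "z \<noteq> w"
          using w xJ[OF that] \<open>z \<in> path_image \<gamma>\<close> that by (auto simp: J_def)
        then show ?thesis by (rule alg2)
      qed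
      then show ?thesis by (simp add: pf_sum_def a_def J_def sum_divide_distrib)
    qed
    ultimately have "((\<lambda>z. pf_sum n x m u z / (w - z)) has_contour_integral
        (\<Sum>j\<in>J. a j / (w - x j) * (L (x j) - L w))) \<gamma>"
      by (rule has_contour_integral_eq)
    then show ?thesis unfolding I_def by (rule contour_integral_unique)
  qed
  have w': "w \<notin> path_image \<gamma>" "cnj w \<notin> path_image \<gamma>" "cnj w \<notin> of_real ` x ` {1..n}"
    using w not_in_path_image_cnj by (auto simp: path_image_double complex_eq_iff)
  have cI: "cnj (I (cnj w)) = (\<Sum>j\<in>J. a j / (w - x j) * (cnj (L (x j)) - cnj (L (cnj w))))"
    using w' by (simp add: I cnj_sum)
  have distr: "p * (A - B) - p * (C - D) = p * ((A - C) - (B - D))" for p A B C D :: complex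
    by (simp add: algebra_simps)
  have "I w - cnj (I (cnj w)) = (\<Sum>j\<in>J. a j / (w - x j) * ((L (x j) - cnj (L (x j))) - (L w - cnj (L (cnj w)))))"
    by (simp only: I[OF w'(1) w(2)] cI sum_subtractf [symmetric] distr)
  also have "\<dots> = (\<Sum>j\<in>J. a j / (w - x j) * ((2 * pi * \<i>) * (- of_bool (u < x j) - winding_number double w)))"
  proof (intro sum.cong refl arg_cong2[where f = "(*)"])
    fix j assume "j \<in> J"
    then have "x j \<noteq> u" "x j < B" using nodes by (auto simp: J_def)
    \<comment> \<open>Subtracting the conjugate leaves 2 i times the imaginary part, so only the
      nodes beyond \<open>u\<close> survive, each with the constant - 2 pi i.\<close>
    then have Im_L: "Im (L (x j)) = - pi * of_bool (u < x j)"
      unfolding L_def using Im_contour_integral_Cauchy_kernel by auto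
    have 1: "L (x j) - cnj (L (x j)) = 2 * pi * \<i> * (- of_bool (u < x j))"
      by (rule complex_eqI) (simp_all add: Im_L)
    have 2: "L w - cnj (L (cnj w)) = 2 * pi * \<i> * winding_number double w"
      using contour_integral_double[OF w(1)] by (simp add: L_def)
    show "(L (x j) - cnj (L (x j))) - (L w - cnj (L (cnj w)))
        = (2 * pi * \<i>) * (- of_bool (u < x j) - winding_number double w)"
      unfolding 1 2 by (rule right_diff_distrib [symmetric])
  qed
  also have "(\<Sum>j\<in>J. a j / (w - x j) * ((2 * pi * \<i>) * (- of_bool (u < x j) - winding_number double w)))
    = (\<Sum>j\<in>J. - (2 * pi * \<i>) * (of_bool (u < x j) * (a j / (w - x j))
      + winding_number double w * (a j / (w - x j))))"
    by (intro sum.cong refl alg1)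
  also have "\<dots> = - (2 * pi * \<i>) * ((\<Sum>j\<in>J. of_bool (u < x j) * (a j / (w - x j)))
      + winding_number double w * (\<Sum>j\<in>J. a j / (w - x j)))"
    by (simp only: sum.distrib flip: sum_distrib_left)
  also have "(\<Sum>j\<in>J. of_bool (u < x j) * (a j / (w - x j))) = (\<Sum>j\<in>{j\<in>{1..n}. u < x j}. a j / (w - x j))"
    by (rule sum.mono_neutral_cong_right) (auto simp: J_def)
  also have "(\<Sum>j\<in>J. a j / (w - x j)) = (w - of_real u) ^ m / node_poly n x w"
    using pf_sum_eq[OF inj m w(2), of u] by (simp add: pf_sum_def a_def J_def)
  finally have *: "I w - cnj (I (cnj w)) = - (2 * pi * \<i>) *
     ((\<Sum>j\<in>{j\<in>{1..n}. u < x j}. a j / (w - x j)) + winding_number double w * ((w - of_real u) ^ m / node_poly n x w))" .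
  have alg: "p * S + N * g = - p * (- c * (S + N * (g / p))) / c" if "p \<noteq> 0" "c \<noteq> 0" for p S N g c :: complex
    using that by (simp add: field_simps)
  show ?thesis
    unfolding * upper_interpolant_eq[OF w(2)] a_def
    by (rule alg) (use node_poly_nonzero[OF w(2)] in auto)
qed

end

subsection \<open>Convergence of means and the critical point\<close>

definition mean :: "nat \<Rightarrow> (nat \<Rightarrow> real) \<Rightarrow> (real \<Rightarrow> 'a) \<Rightarrow> 'a::real_field" where
  "mean n x g = (\<Sum>i=1..n. g (x i)) / of_nat n"

lemma Re_mean: "Re (mean n x g) = mean n x (\<lambda>t. Re (g t))"
  by (simp add: mean_def)

lemma Im_mean: "Im (mean n x g) = mean n x (\<lambda>t. Im (g t))"
  by (simp add: mean_def)

lemma mean_of_real: "mean n x (\<lambda>t. complex_of_real (g t)) = of_real (mean n x g)"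
  by (simp add: mean_def)

lemma mean_diff: "mean n x (\<lambda>t. f t - g t) = mean n x f - mean n x g"
  by (simp add: mean_def sum_subtractf diff_divide_distrib)

lemma mean_const: "0 < n \<Longrightarrow> mean n x (\<lambda>t. c) = c"
  by (simp add: mean_def)

lemma mean_mono:
  "(\<And>i. i \<in> {1..n} \<Longrightarrow> f (x i) \<le> g (x i)) \<Longrightarrow> mean n x f \<le> (mean n x g :: real)"
  unfolding mean_def by (intro divide_right_mono sum_mono) auto

lemma norm_mean_le:
  fixes g :: "real \<Rightarrow> complex"
  assumes "\<And>i. i \<in> {1..n} \<Longrightarrow> norm (g (x i)) \<le> B" "0 \<le> B"
  shows "norm (mean n x g) \<le> B"
proof (cases "n = 0")
  case False
  have "norm (\<Sum>i=1..n. g (x i)) \<le> of_nat (card {1..n}) * B"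
    by (rule sum_norm_bound) (use assms in auto)
  then show ?thesis using False by (simp add: mean_def norm_divide field_simps)
qed (use assms in \<open>simp add: mean_def\<close>)

text \<open>Convergence is required for every continuous complex function, bounded or not: the
  common bound \<open>Y\<close> on nodes and support lets unbounded kernels such as
  \<open>ln (cmod (z - t))\<close> be inserted without truncation.\<close>

locale node_limit =
  fixes \<nu> :: "real measure" and Y :: real and y :: "nat \<Rightarrow> nat \<Rightarrow> real"
  assumes prob: "prob_space \<nu>" and sets_\<nu> [measurable_cong]: "sets \<nu> = sets borel"
    and support: "AE t in \<nu>. \<bar>t\<bar> \<le> Y"
    and nodes: "\<And>n i. i \<in> {1..n} \<Longrightarrow> \<bar>y n i\<bar> \<le> Y"
    and mean_tendsto: "\<And>g :: real \<Rightarrow> complex. continuous_on UNIV g \<Longrightarrow>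
      (\<lambda>n. mean n (y n) g) \<longlonglongrightarrow> (\<integral>t. g t \<partial>\<nu>)"
begin

sublocale prob_space \<nu> by (rule prob)

lemma integrable_continuous:
  fixes g :: "real \<Rightarrow> 'b::{banach, second_countable_topology}"
  assumes "continuous_on UNIV g"
  shows "integrable \<nu> g"
proof -
  have "compact (g ` {-Y..Y})"
    by (intro compact_continuous_image continuous_on_subset[OF assms]) auto
  then obtain C where C: "\<forall>t\<in>{-Y..Y}. norm (g t) \<le> C"
    using compact_imp_bounded[of "g ` {-Y..Y}"] unfolding bounded_iff by auto
  have "AE t in \<nu>. norm (g t) \<le> C"
    using support by (rule eventually_mono) (use C in \<open>auto simp: abs_le_iff\<close>)
  moreover have "g \<in> borel_measurable \<nu>"
    using borel_measurable_continuous_onI[OF assms] by (simp cong: measurable_cong_sets)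
  ultimately show ?thesis by (intro integrable_const_bound) auto
qed

lemma norm_integral_le:
  fixes g :: "real \<Rightarrow> complex"
  assumes "continuous_on UNIV g" "\<And>t. \<bar>t\<bar> \<le> Y \<Longrightarrow> norm (g t) \<le> B"
  shows "norm (\<integral>t. g t \<partial>\<nu>) \<le> B"
proof -
  have "norm (\<integral>t. g t \<partial>\<nu>) \<le> (\<integral>t. norm (g t) \<partial>\<nu>)"
    by (rule integral_norm_bound)
  also have "\<dots> \<le> (\<integral>t. B \<partial>\<nu>)"
    using support assms
    by (intro integral_mono_AE integrable_continuous continuous_intros) (auto elim!: eventually_mono)
  finally show ?thesis by (simp add: prob_space)
qed

text \<open>Pointwise convergence becomes uniform by equicontinuity: the kernel is uniformly
  continuous on the product of \<open>K\<close> with [-Y, Y], so convergence on a finite net in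
  \<open>K\<close> decides. Each of the three distances involved costs at most e / 4.\<close>

lemma mean_uniform_limit:
  fixes k :: "complex \<Rightarrow> real \<Rightarrow> complex"
  assumes K: "compact K" and cont: "continuous_on (K \<times> UNIV) (\<lambda>(z, t). k z t)"
  shows "uniform_limit K (\<lambda>n z. mean n (y n) (k z)) (\<lambda>z. \<integral>t. k z t \<partial>\<nu>) sequentially"
proof (rule uniform_limitI)
  fix e :: real assume "0 < e"
  have conts: "continuous_on UNIV (k z)" if "z \<in> K" for z
    using continuous_on_compose2[OF cont continuous_on_Pair[OF continuous_on_const continuous_on_id], of z UNIV] that
    by auto
  have "uniformly_continuous_on (K \<times> {-Y..Y}) (\<lambda>(z, t). k z t)"
    using K by (intro compact_uniformly_continuous continuous_on_subset[OF cont] compact_Times) auto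
  with \<open>0 < e\<close> obtain d where d: "0 < d" and
    d': "\<And>p p'. \<lbrakk>p \<in> K \<times> {-Y..Y}; p' \<in> K \<times> {-Y..Y}; dist p' p < d\<rbrakk>
      \<Longrightarrow> dist (case p' of (z, t) \<Rightarrow> k z t) (case p of (z, t) \<Rightarrow> k z t) < e / 4"
    unfolding uniformly_continuous_on_def by (metis divide_pos_pos zero_less_numeral)
  have close: "norm (k z t - k z' t) \<le> e / 4"
    if "z \<in> K" "z' \<in> K" "dist z z' < d" "\<bar>t\<bar> \<le> Y" for z z' t
    using d'[of "(z', t)" "(z, t)"] that by (simp add: dist_Pair_Pair dist_norm abs_le_iff)
  obtain F where F: "finite F" "F \<subseteq> K" "K \<subseteq> (\<Union>z\<in>F. ball z d)"
    using compactE_image[OF K, of K "\<lambda>z. ball z d"] d by (metis UN_I centre_in_ball open_ball subsetI)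
  have "\<forall>\<^sub>F n in sequentially. \<forall>z\<in>F. dist (mean n (y n) (k z)) (\<integral>t. k z t \<partial>\<nu>) < e / 4"
    using F \<open>0 < e\<close> by (intro eventually_ball_finite ballI tendstoD mean_tendsto conts) auto
  then show "\<forall>\<^sub>F n in sequentially. \<forall>z\<in>K. dist (mean n (y n) (k z)) (\<integral>t. k z t \<partial>\<nu>) < e"
  proof eventually_elim
    case (elim n)
    show ?case
    proof
      fix z assume z: "z \<in> K"
      then obtain z' where z': "z' \<in> F" "dist z z' < d" using F(3) by (auto simp: dist_commute)
      then have z'K: "z' \<in> K" using F by auto
      have "norm (mean n (y n) (\<lambda>t. k z t - k z' t)) \<le> e / 4"
        using close[OF z z'K z'(2)] nodes \<open>0 < e\<close> by (intro norm_mean_le) auto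
      then have 1: "dist (mean n (y n) (k z)) (mean n (y n) (k z')) \<le> e / 4"
        by (simp add: dist_norm mean_diff)
      have "norm (\<integral>t. k z t - k z' t \<partial>\<nu>) \<le> e / 4"
        using close[OF z z'K z'(2)] by (intro norm_integral_le continuous_intros conts z z'K)
      then have 2: "dist (\<integral>t. k z' t \<partial>\<nu>) (\<integral>t. k z t \<partial>\<nu>) \<le> e / 4"
        using integrable_continuous[OF conts[OF z]] integrable_continuous[OF conts[OF z'K]]
        by (simp add: dist_norm norm_minus_commute)
      have "dist (mean n (y n) (k z')) (\<integral>t. k z' t \<partial>\<nu>) < e / 4"
        using elim z' by auto
      with 1 2 show "dist (mean n (y n) (k z)) (\<integral>t. k z t \<partial>\<nu>) < e"
        using dist_triangle[of "mean n (y n) (k z)" "\<integral>t. k z t \<partial>\<nu>" "mean n (y n) (k z')"]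
          dist_triangle[of "mean n (y n) (k z')" "\<integral>t. k z t \<partial>\<nu>" "\<integral>t. k z' t \<partial>\<nu>"] \<open>0 < e\<close>
        by linarith
    qed
  qed
qed

lemma mean_uniform_limit_real:
  fixes k :: "complex \<Rightarrow> real \<Rightarrow> real"
  assumes "compact K" "continuous_on (K \<times> UNIV) (\<lambda>(z, t). k z t)"
  shows "uniform_limit K (\<lambda>n z. mean n (y n) (k z)) (\<lambda>z. \<integral>t. k z t \<partial>\<nu>) sequentially"
proof -
  have "continuous_on (K \<times> UNIV) (\<lambda>(z, t). complex_of_real (k z t))"
    using assms(2) by (auto simp: case_prod_unfold intro!: continuous_on_of_real)
  from mean_uniform_limit[OF assms(1) this]
  show ?thesis
    by (simp add: uniform_limit_iff mean_of_real)
qed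

text \<open>The integral is a local uniform limit of finite means, whose continuity it
  inherits.\<close>

lemma continuous_on_integral:
  fixes k :: "complex \<Rightarrow> real \<Rightarrow> complex"
  assumes S: "open S" and cont: "continuous_on (S \<times> UNIV) (\<lambda>(z, t). k z t)"
  shows "continuous_on S (\<lambda>z. \<integral>t. k z t \<partial>\<nu>)"
proof (rule continuous_at_imp_continuous_on, rule ballI)
  fix z assume "z \<in> S"
  then obtain e where e: "0 < e" "cball z e \<subseteq> S" using S open_contains_cball by blast
  have cont': "continuous_on (cball z e \<times> UNIV) (\<lambda>(z, t). k z t)"
    using e by (intro continuous_on_subset[OF cont]) auto
  have "continuous_on (cball z e) (\<lambda>z. \<integral>t. k z t \<partial>\<nu>)"
  proof (rule uniform_limit_theorem[OF _ mean_uniform_limit[OF compact_cball cont']])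
    have "continuous_on (cball z e) (\<lambda>z. k z (y n i))" for n i
      using continuous_on_compose2[OF cont' continuous_on_Pair[OF continuous_on_id continuous_on_const], of "y n i" "cball z e"]
      by auto
    then show "\<forall>\<^sub>F n in sequentially. continuous_on (cball z e) (\<lambda>z. mean n (y n) (k z))"
      unfolding mean_def divide_inverse by (intro always_eventually allI continuous_intros)
  qed auto
  then show "isCont (\<lambda>z. \<integral>t. k z t \<partial>\<nu>) z"
    using e by (simp add: continuous_on_interior)
qed

lemma continuous_on_integral_real:
  fixes k :: "complex \<Rightarrow> real \<Rightarrow> real"
  assumes S: "open S" and cont: "continuous_on (S \<times> UNIV) (\<lambda>(z, t). k z t)"
  shows "continuous_on S (\<lambda>z. \<integral>t. k z t \<partial>\<nu>)"
proof -
  have "continuous_on (S \<times> UNIV) (\<lambda>(z, t). complex_of_real (k z t))"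
    using assms(2) by (auto simp: case_prod_unfold intro!: continuous_on_of_real)
  from continuous_on_Re[OF continuous_on_integral[OF S this]]
  show ?thesis by simp
qed

end

section \<open>The critical equation: moment identities and uniqueness of the root\<close>

lemma minus_of_real_nonzero: "Im w \<noteq> 0 \<Longrightarrow> w - of_real t \<noteq> 0"
  by (metis Im_complex_of_real eq_iff_diff_eq_0)

lemma cmod_minus_of_real_pos: "Im w \<noteq> 0 \<Longrightarrow> 0 < cmod (w - of_real t)"
  using minus_of_real_nonzero by simp

lemma sq_cmod_minus_of_real: "(cmod (w - of_real t))\<^sup>2 = (Re w - t)\<^sup>2 + (Im w)\<^sup>2"
  by (simp add: cmod_power2)

lemma inverse_minus_of_real:
  assumes "Im w \<noteq> 0"
  shows "1 / (w - of_real t) = (cnj w - of_real t) / of_real ((cmod (w - of_real t))\<^sup>2)"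
proof -
  have "cnj w - of_real t \<noteq> 0" using assms by (intro minus_of_real_nonzero) simp
  moreover have "of_real ((cmod (w - of_real t))\<^sup>2) = (w - of_real t) * (cnj w - of_real t)"
    by (simp only: complex_norm_square complex_cnj_diff complex_cnj_complex_of_real)
  ultimately show ?thesis by (simp del: of_real_power)
qed

text \<open>Together with the real part below, this expresses the critical equation through the two
  kernels \<open>t / |w - t|^2\<close> and \<open>|w|^2 / |w - t|^2\<close>; the mean of the former
  must vanish at a critical point.\<close>

lemma Im_div_minus_of_real:
  "Im w \<noteq> 0 \<Longrightarrow> Im (w / (w - of_real t)) = - Im w * (t / (cmod (w - of_real t))\<^sup>2)"
  using minus_of_real_nonzero[of w t]
  by (simp add: Im_divide sq_cmod_minus_of_real field_simps)

lemma Re_div_minus_of_real: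
  "Im w \<noteq> 0 \<Longrightarrow> Re (w / (w - of_real t)) =
     (cmod w)\<^sup>2 / (cmod (w - of_real t))\<^sup>2 - Re w * (t / (cmod (w - of_real t))\<^sup>2)"
  unfolding Re_divide sq_cmod_minus_of_real cmod_power2
  by (simp add: diff_divide_distrib [symmetric]) (simp add: power2_eq_square algebra_simps)

text \<open>Integrands such as t^2 times a positive weight vanish only at 0, so their integrals are
  positive unless the translated law sits at 0, that is, unless the original one is the point mass
  at \<open>c\<close>.\<close>

locale nondegenerate_node_limit = node_limit +
  assumes nondegenerate: "\<not> (AE t in \<nu>. t = 0)"
begin

lemma integral_pos:
  fixes g :: "real \<Rightarrow> real"
  assumes cont: "continuous_on UNIV g" and g: "\<And>t. 0 \<le> g t" "\<And>t. t \<noteq> 0 \<Longrightarrow> g t \<noteq> 0"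
  shows "0 < (\<integral>t. g t \<partial>\<nu>)"
proof -
  have "(\<integral>t. g t \<partial>\<nu>) \<noteq> 0"
  proof
    assume "(\<integral>t. g t \<partial>\<nu>) = 0"
    then have "AE t in \<nu>. g t = 0"
      using integral_nonneg_eq_0_iff_AE[OF integrable_continuous[OF cont]] g by simp
    then have "AE t in \<nu>. t = 0" by eventually_elim (use g in auto)
    with nondegenerate show False by simp
  qed
  moreover have "0 \<le> (\<integral>t. g t \<partial>\<nu>)" using g by (intro integral_nonneg_AE) simp
  ultimately show ?thesis by simp
qed

text \<open>Two distinct roots v1, v2 make \<open>t / ((v1 - t) (v2 - t))\<close> integrate to 0.
  Along with w2 also \<open>cnj w2\<close> is a root, since the common value is real; subtracting
  the relations for (w1, w2) and (w1, cnj w2) puts \<open>|w2 - t|^2\<close> in place of the second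
  factor. The imaginary part of the outcome and then its real part force the integral of t^2 times a
  positive weight to vanish.\<close>

lemma root_unique:
  assumes w: "0 < Im w1" "0 < Im w2"
    and eq: "(\<integral>t. w1 / (w1 - of_real t) \<partial>\<nu>) = of_real \<beta>" "(\<integral>t. w2 / (w2 - of_real t) \<partial>\<nu>) = of_real \<beta>"
  shows "w1 = w2"
proof (rule ccontr)
  assume "w1 \<noteq> w2"
  have ne: "w - of_real t \<noteq> 0" if "w \<in> {w1, w2, cnj w2}" for w t
    using that w by (intro minus_of_real_nonzero) auto
  have orth: "(\<integral>t. of_real t / ((v1 - of_real t) * (v2 - of_real t)) \<partial>\<nu>) = 0"
    if v: "v1 \<in> {w1, w2, cnj w2}" "v2 \<in> {w1, w2, cnj w2}" "v1 \<noteq> v2"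
      and eq: "(\<integral>t. v1 / (v1 - of_real t) \<partial>\<nu>) = (\<integral>t. v2 / (v2 - of_real t) \<partial>\<nu>)" for v1 v2
  proof -
    have "v1 / (v1 - of_real t) - v2 / (v2 - of_real t)
        = (v2 - v1) * (of_real t / ((v1 - of_real t) * (v2 - of_real t)))" for t
      using ne[OF v(1), of t] ne[OF v(2), of t] by (simp add: divide_simps) (simp add: algebra_simps)
    then have "(\<integral>t. v1 / (v1 - of_real t) - v2 / (v2 - of_real t) \<partial>\<nu>)
        = (v2 - v1) * (\<integral>t. of_real t / ((v1 - of_real t) * (v2 - of_real t)) \<partial>\<nu>)"
      by (simp only: integral_mult_right_zero)
    moreover have "(\<integral>t. v1 / (v1 - of_real t) - v2 / (v2 - of_real t) \<partial>\<nu>) = 0"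
      using eq ne[OF v(1)] ne[OF v(2)]
      by (subst Bochner_Integration.integral_diff) (auto intro!: integrable_continuous continuous_intros)
    ultimately show ?thesis using v by simp
  qed
  have "(\<integral>t. cnj w2 / (cnj w2 - of_real t) \<partial>\<nu>) = cnj (\<integral>t. w2 / (w2 - of_real t) \<partial>\<nu>)"
    by (subst Bochner_Integration.integral_cnj [symmetric]) simp
  then have eq': "(\<integral>t. cnj w2 / (cnj w2 - of_real t) \<partial>\<nu>) = of_real \<beta>" using eq by simp
  have "w1 \<noteq> cnj w2" using w by (auto simp: complex_eq_iff)
  define h where "h t = of_real t / ((w1 - of_real t) * of_real ((cmod (w2 - of_real t))\<^sup>2))" for t :: real
  have conth: "continuous_on UNIV h"
    unfolding h_def using ne by (auto intro!: continuous_intros)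
  have "of_real t / ((w1 - of_real t) * (w2 - of_real t)) - of_real t / ((w1 - of_real t) * (cnj w2 - of_real t))
      = (cnj w2 - w2) * h t" for t
  proof -
    have c: "of_real ((cmod (w2 - of_real t))\<^sup>2) = (w2 - of_real t) * (cnj w2 - of_real t)"
      by (simp only: complex_norm_square complex_cnj_diff complex_cnj_complex_of_real)
    show ?thesis unfolding h_def c using ne[of w1 t] ne[of w2 t] ne[of "cnj w2" t]
      by (simp add: divide_simps) (simp add: algebra_simps)
  qed
  then have "(\<integral>t. of_real t / ((w1 - of_real t) * (w2 - of_real t)) - of_real t / ((w1 - of_real t) * (cnj w2 - of_real t)) \<partial>\<nu>)
      = (cnj w2 - w2) * (\<integral>t. h t \<partial>\<nu>)"
    by (simp only: integral_mult_right_zero)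
  moreover have "(\<integral>t. of_real t / ((w1 - of_real t) * (w2 - of_real t)) - of_real t / ((w1 - of_real t) * (cnj w2 - of_real t)) \<partial>\<nu>) = 0"
    using orth[of w1 w2] orth[of w1 "cnj w2"] \<open>w1 \<noteq> w2\<close> \<open>w1 \<noteq> cnj w2\<close> eq eq' ne
    by (subst Bochner_Integration.integral_diff) (auto intro!: integrable_continuous continuous_intros)
  moreover have "cnj w2 - w2 \<noteq> 0" using w by (auto simp: complex_eq_iff)
  ultimately have h0: "(\<integral>t. h t \<partial>\<nu>) = 0" by simp
  define p where "p t = 1 / ((cmod (w1 - of_real t))\<^sup>2 * (cmod (w2 - of_real t))\<^sup>2)" for t :: real
  have h: "h t = of_real (t * p t) * (cnj w1 - of_real t)" for t
  proof -
    have "h t = of_real t * (1 / (w1 - of_real t)) / of_real ((cmod (w2 - of_real t))\<^sup>2)"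
      by (simp add: h_def)
    also have "\<dots> = of_real (t * p t) * (cnj w1 - of_real t)"
      using w by (subst inverse_minus_of_real) (simp_all add: p_def)
    finally show ?thesis .
  qed
  have contp: "continuous_on UNIV p"
    unfolding p_def using ne by (auto intro!: continuous_intros)
  have "Re (\<integral>t. h t \<partial>\<nu>) = (\<integral>t. Re (h t) \<partial>\<nu>)" "Im (\<integral>t. h t \<partial>\<nu>) = (\<integral>t. Im (h t) \<partial>\<nu>)"
    using integrable_continuous[OF conth] by simp_all
  then have 1: "(\<integral>t. Re (h t) \<partial>\<nu>) = 0" and 2: "(\<integral>t. Im (h t) \<partial>\<nu>) = 0"
    using h0 by simp_all
  have "(\<integral>t. Im (h t) \<partial>\<nu>) = - Im w1 * (\<integral>t. t * p t \<partial>\<nu>)"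
    by (subst integral_mult_right_zero [symmetric]) (simp add: h mult_ac)
  then have tp: "(\<integral>t. t * p t \<partial>\<nu>) = 0" using 2 w by simp
  have "Re (h t) = Re w1 * (t * p t) - t\<^sup>2 * p t" for t
    by (simp add: h algebra_simps power2_eq_square)
  then have "(\<integral>t. Re (h t) \<partial>\<nu>) = Re w1 * (\<integral>t. t * p t \<partial>\<nu>) - (\<integral>t. t\<^sup>2 * p t \<partial>\<nu>)"
    using contp by (simp add: integrable_continuous continuous_intros)
  then have "(\<integral>t. t\<^sup>2 * p t \<partial>\<nu>) = 0" using 1 tp by simp
  moreover have "0 < (\<integral>t. t\<^sup>2 * p t \<partial>\<nu>)"
    using ne[of w1] ne[of w2] by (intro integral_pos continuous_intros contp) (auto simp: p_def)
  ultimately show False by simp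
qed

end

abbreviation upper_halfplane :: "complex set" where
  "upper_halfplane \<equiv> {z. 0 < Im z}"

lemma open_upper_halfplane: "open upper_halfplane"
  by (rule open_halfspace_Im_gt)

lemma continuous_on_ln_cmod:
  "S \<subseteq> upper_halfplane \<Longrightarrow> continuous_on (S \<times> UNIV) (\<lambda>(z, t). ln (cmod (z - of_real t)))"
  unfolding case_prod_unfold
  by (intro continuous_intros ballI) (use cmod_minus_of_real_pos in force)

lemma continuous_on_div_kernel:
  assumes "S \<subseteq> upper_halfplane"
  shows "continuous_on (S \<times> UNIV) (\<lambda>(z, t). z ^ k / (z - of_real t) ^ k)"
proof -
  have "z - of_real t \<noteq> 0" if "z \<in> S" for z t
    using that assms by (intro minus_of_real_nonzero) auto
  then show ?thesis
    unfolding case_prod_unfold by (intro continuous_intros) auto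
qed

text \<open>The data of the theorem after translation by \<open>c\<close>; \<open>root\<close> is
  the equation w G(w + c) = 1 - \<alpha> in terms of the translated law.\<close>

locale saddle_point = nondegenerate_node_limit +
  fixes \<alpha> :: real and w0 :: complex and q :: "nat \<Rightarrow> nat"
  assumes \<alpha>: "0 < \<alpha>" "\<alpha> < 1"
    and q: "\<And>n. n \<ge> 1 \<Longrightarrow> q n \<in> {1..n}"
    and q_tendsto: "(\<lambda>n. real (q n) / real n) \<longlonglongrightarrow> \<alpha>"
    and inj: "\<And>n. inj_on (y n) {1..n}"
    and w0: "0 < Im w0"
    and root: "(\<integral>t. w0 / (w0 - of_real t) \<partial>\<nu>) = of_real (1 - \<alpha>)"
begin

definition b :: "nat \<Rightarrow> real" where "b n = real (n - q n) / real n"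

lemma b_tendsto: "b \<longlonglongrightarrow> 1 - \<alpha>"
proof -
  have "(\<lambda>n. 1 - real (q n) / real n) \<longlonglongrightarrow> 1 - \<alpha>"
    by (intro tendsto_intros q_tendsto)
  moreover have "\<forall>\<^sub>F n in sequentially. 1 - real (q n) / real n = b n"
    using eventually_ge_at_top[of 1]
  proof eventually_elim
    case (elim n)
    then show ?case using q[of n] by (simp add: b_def field_simps of_nat_diff)
  qed
  ultimately show ?thesis by (rule Lim_transform_eventually)
qed

text \<open>\<open>n * Hn n z\<close> is the logarithm of
  \<open>|node_poly z| / |z| ^ (n - q n)\<close>, which is the exponential part of the weight in w
  and, inverted, of the integrand in z.\<close>

definition Hn :: "nat \<Rightarrow> complex \<Rightarrow> real" where
  "Hn n z = mean n (y n) (\<lambda>t. ln (cmod (z - of_real t))) - b n * ln (cmod z)"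

definition H :: "complex \<Rightarrow> real" where
  "H z = (\<integral>t. ln (cmod (z - of_real t)) \<partial>\<nu>) - (1 - \<alpha>) * ln (cmod z)"

text \<open>\<open>z\<close> times the derivative of the (multivalued) holomorphic function with
  real part \<open>Hn n\<close>, so its zeros are the critical points. In the same way
  \<open>Sn\<close> is z^2 times the second derivative.\<close>

definition Fn :: "nat \<Rightarrow> complex \<Rightarrow> complex" where
  "Fn n z = mean n (y n) (\<lambda>t. z / (z - of_real t)) - of_real (b n)"

definition Sn :: "nat \<Rightarrow> complex \<Rightarrow> complex" where
  "Sn n z = of_real (b n) - mean n (y n) (\<lambda>t. z\<^sup>2 / (z - of_real t)\<^sup>2)"

lemma Hn_uniform_limit:
  assumes K: "compact K" "K \<subseteq> upper_halfplane"
  shows "uniform_limit K Hn H sequentially"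
proof -
  have "bounded ((\<lambda>z. ln (cmod z)) ` K)"
    using K by (intro compact_imp_bounded compact_continuous_image continuous_intros) auto
  moreover have "bounded ((\<lambda>z::complex. 1 - \<alpha>) ` K)"
    by (rule bounded_subset[of "{1 - \<alpha>}"]) auto
  ultimately have 1: "uniform_limit K (\<lambda>n z. b n * ln (cmod z)) (\<lambda>z. (1 - \<alpha>) * ln (cmod z)) sequentially"
    by (intro bounded_bilinear.bounded_uniform_limit[OF bounded_bilinear_mult] uniform_limit_const)
       (auto simp: uniform_limit_iff b_tendsto[THEN tendstoD])
  show ?thesis
    unfolding Hn_def[abs_def] H_def[abs_def]
    by (intro uniform_limit_minus 1 mean_uniform_limit_real K continuous_on_ln_cmod)
qed

lemma Fn_uniform_limit:
  assumes K: "compact K" "K \<subseteq> upper_halfplane"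
  shows "uniform_limit K Fn (\<lambda>z. (\<integral>t. z / (z - of_real t) \<partial>\<nu>) - of_real (1 - \<alpha>)) sequentially"
proof -
  have 1: "uniform_limit K (\<lambda>n z. complex_of_real (b n)) (\<lambda>z. of_real (1 - \<alpha>)) sequentially"
    using tendsto_of_real[OF b_tendsto] by (auto simp: uniform_limit_iff dest: tendstoD)
  show ?thesis
    unfolding Fn_def[abs_def]
    using continuous_on_div_kernel[OF K(2), of 1]
    by (intro uniform_limit_minus 1 mean_uniform_limit K) simp
qed

lemma Sn_uniform_limit:
  assumes K: "compact K" "K \<subseteq> upper_halfplane"
  shows "uniform_limit K Sn (\<lambda>z. of_real (1 - \<alpha>) - (\<integral>t. z\<^sup>2 / (z - of_real t)\<^sup>2 \<partial>\<nu>)) sequentially"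
proof -
  have 1: "uniform_limit K (\<lambda>n z. complex_of_real (b n)) (\<lambda>z. of_real (1 - \<alpha>)) sequentially"
    using tendsto_of_real[OF b_tendsto] by (auto simp: uniform_limit_iff dest: tendstoD)
  show ?thesis
    unfolding Sn_def[abs_def]
    by (intro uniform_limit_minus 1 mean_uniform_limit K continuous_on_div_kernel)
qed

lemma continuous_on_H: "continuous_on upper_halfplane H"
  unfolding H_def[abs_def]
  by (intro continuous_intros continuous_on_integral_real open_upper_halfplane continuous_on_ln_cmod) auto

lemma b_le: "b n \<le> 1" "0 \<le> b n"
  by (auto simp: b_def divide_le_eq)

lemma Fn_zero:
  assumes "Fn n w = 0" "0 < Im w" "0 < n"
  shows "mean n (y n) (\<lambda>t. t / (cmod (w - of_real t))\<^sup>2) = 0"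
    and "mean n (y n) (\<lambda>t. (cmod w)\<^sup>2 / (cmod (w - of_real t))\<^sup>2) = b n"
proof -
  have c: "mean n (y n) (\<lambda>t. c * g t) = c * mean n (y n) g" for c :: real and g
    by (simp add: mean_def sum_distrib_left)
  have nz: "Im w \<noteq> 0" using assms by simp
  have "mean n (y n) (\<lambda>t. Im (w / (w - of_real t))) = 0"
    using arg_cong[OF assms(1), of Im] by (simp add: Fn_def flip: Im_mean)
  then have "- Im w * mean n (y n) (\<lambda>t. t / (cmod (w - of_real t))\<^sup>2) = 0"
    by (simp only: Im_div_minus_of_real[OF nz] c)
  then show 1: "mean n (y n) (\<lambda>t. t / (cmod (w - of_real t))\<^sup>2) = 0"
    using nz by simp
  have "mean n (y n) (\<lambda>t. Re (w / (w - of_real t))) = b n"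
    using arg_cong[OF assms(1), of Re] by (simp add: Fn_def flip: Re_mean)
  then have "mean n (y n) (\<lambda>t. (cmod w)\<^sup>2 / (cmod (w - of_real t))\<^sup>2)
      - Re w * mean n (y n) (\<lambda>t. t / (cmod (w - of_real t))\<^sup>2) = b n"
    by (simp only: Re_div_minus_of_real[OF nz] mean_diff c)
  then show "mean n (y n) (\<lambda>t. (cmod w)\<^sup>2 / (cmod (w - of_real t))\<^sup>2) = b n"
    using 1 by simp
qed

lemma ne0: "w0 - of_real t \<noteq> 0"
  using w0 by (intro minus_of_real_nonzero) simp

lemma w0_moment: "(\<integral>t. t / (cmod (w0 - of_real t))\<^sup>2 \<partial>\<nu>) = 0"
proof -
  have "continuous_on UNIV (\<lambda>t. w0 / (w0 - of_real t))"
    using ne0 by (intro continuous_intros) auto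
  then have "Im (\<integral>t. w0 / (w0 - of_real t) \<partial>\<nu>) = (\<integral>t. Im (w0 / (w0 - of_real t)) \<partial>\<nu>)"
    by (simp add: integrable_continuous)
  also have "\<dots> = - Im w0 * (\<integral>t. t / (cmod (w0 - of_real t))\<^sup>2 \<partial>\<nu>)"
    using w0 by (simp only: Im_div_minus_of_real less_imp_neq [symmetric] integral_mult_right_zero not_False_eq_True)
  finally show ?thesis using w0 by (simp add: root)
qed

lemma continuous_on_w0_kernels:
  "continuous_on UNIV (\<lambda>t. g t / (cmod (w0 - of_real t))\<^sup>2)" if "continuous_on UNIV g" for g :: "real \<Rightarrow> real"
  using that ne0 by (intro continuous_intros) auto

text \<open>The integrand is 1 at t = 0, so the identity limits the atom of the law at 0 to mass 1 -
  \<alpha>; \<open>small_mass\<close> sharpens this to a strict inequality.\<close>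

lemma w0_mass: "(\<integral>t. (cmod w0)\<^sup>2 / (cmod (w0 - of_real t))\<^sup>2 \<partial>\<nu>) = 1 - \<alpha>"
proof -
  have "continuous_on UNIV (\<lambda>t. w0 / (w0 - of_real t))"
    using ne0 by (intro continuous_intros) auto
  then have "Re (\<integral>t. w0 / (w0 - of_real t) \<partial>\<nu>) = (\<integral>t. Re (w0 / (w0 - of_real t)) \<partial>\<nu>)"
    by (simp add: integrable_continuous)
  also have "\<dots> = (\<integral>t. (cmod w0)\<^sup>2 / (cmod (w0 - of_real t))\<^sup>2 - Re w0 * (t / (cmod (w0 - of_real t))\<^sup>2) \<partial>\<nu>)"
    using w0 by (simp only: Re_div_minus_of_real less_imp_neq [symmetric] not_False_eq_True)
  also have "\<dots> = (\<integral>t. (cmod w0)\<^sup>2 / (cmod (w0 - of_real t))\<^sup>2 \<partial>\<nu>) - Re w0 * (\<integral>t. t / (cmod (w0 - of_real t))\<^sup>2 \<partial>\<nu>)"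
    by (subst Bochner_Integration.integral_diff)
       (simp_all only: integral_mult_right_zero integrable_continuous continuous_on_w0_kernels continuous_on_mult_left continuous_on_const continuous_on_id)
  finally show ?thesis by (simp add: root w0_moment)
qed

text \<open>For c = w / (w - t) one has Re (c - c^2) = Re c - |c|^2 + 2 (Im c)^2. The term |w|^2 /
  |w - t|^2 of Re c is exactly |c|^2 and cancels, leaving a square and a multiple of the kernel
  whose integral vanishes at the root.\<close>

lemma Re_second_kernel:
  assumes "Im w \<noteq> 0"
  shows "Re (w / (w - of_real t) - w\<^sup>2 / (w - of_real t)\<^sup>2) =
    2 * (Im w)\<^sup>2 * (t / (cmod (w - of_real t))\<^sup>2)\<^sup>2 - Re w * (t / (cmod (w - of_real t))\<^sup>2)"
proof -
  define c where "c = w / (w - of_real t)"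
  have I: "Im c = - Im w * (t / (cmod (w - of_real t))\<^sup>2)"
    and R: "Re c = (cmod w)\<^sup>2 / (cmod (w - of_real t))\<^sup>2 - Re w * (t / (cmod (w - of_real t))\<^sup>2)"
    using Im_div_minus_of_real[OF assms] Re_div_minus_of_real[OF assms] by (simp_all add: c_def)
  have n: "(cmod c)\<^sup>2 = (cmod w)\<^sup>2 / (cmod (w - of_real t))\<^sup>2"
    by (simp add: c_def norm_divide power_divide)
  have "Re (c - c\<^sup>2) = Re c - (cmod c)\<^sup>2 + 2 * (Im c)\<^sup>2"
    by (simp add: cmod_power2 Re_power2)
  also have "\<dots> = 2 * (Im w)\<^sup>2 * (t / (cmod (w - of_real t))\<^sup>2)\<^sup>2 - Re w * (t / (cmod (w - of_real t))\<^sup>2)"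
    unfolding n R I by (simp add: power_mult_distrib power_divide)
  finally show ?thesis by (simp add: c_def power_divide)
qed

text \<open>Writing 1 - \<alpha> as the integral of w0 / (w0 - t) brings the second derivative into
  the form of \<open>Re_second_kernel\<close>. Positivity makes the saddle nondegenerate, with a
  minimum of the potential in the radial direction; this is why the z-contour can leave
  radially.\<close>

lemma Re_S_pos: "0 < Re (of_real (1 - \<alpha>) - (\<integral>t. w0\<^sup>2 / (w0 - of_real t)\<^sup>2 \<partial>\<nu>))"
proof -
  let ?f = "\<lambda>t. w0 / (w0 - of_real t) - w0\<^sup>2 / (w0 - of_real t)\<^sup>2"
  have i1: "integrable \<nu> (\<lambda>t. w0 / (w0 - of_real t))" and i2: "integrable \<nu> (\<lambda>t. w0\<^sup>2 / (w0 - of_real t)\<^sup>2)"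
    using ne0 by (intro integrable_continuous continuous_intros; simp)+
  let ?g = "\<lambda>t. t / (cmod (w0 - of_real t))\<^sup>2"
  have g: "continuous_on UNIV ?g"
    by (rule continuous_on_w0_kernels[OF continuous_on_id])
  have "of_real (1 - \<alpha>) - (\<integral>t. w0\<^sup>2 / (w0 - of_real t)\<^sup>2 \<partial>\<nu>) = (\<integral>t. ?f t \<partial>\<nu>)"
    using i1 i2 by (simp add: root)
  also have "Re \<dots> = (\<integral>t. Re (?f t) \<partial>\<nu>)"
    using i1 i2 by (simp del: minus_complex.sel)
  also have "\<dots> = (\<integral>t. 2 * (Im w0)\<^sup>2 * (?g t)\<^sup>2 - Re w0 * ?g t \<partial>\<nu>)"
    using w0 by (simp only: Re_second_kernel less_imp_neq [symmetric] not_False_eq_True)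
  also have "\<dots> = 2 * (Im w0)\<^sup>2 * (\<integral>t. (?g t)\<^sup>2 \<partial>\<nu>) - Re w0 * (\<integral>t. ?g t \<partial>\<nu>)"
    using integrable_continuous[OF g] integrable_continuous[OF continuous_on_power[OF g]]
    by (subst Bochner_Integration.integral_diff) (simp_all only: integral_mult_right_zero integrable_mult_right)
  also have "\<dots> = 2 * (Im w0)\<^sup>2 * (\<integral>t. (?g t)\<^sup>2 \<partial>\<nu>)"
    by (simp add: w0_moment)
  also have "\<dots> > 0"
    using w0 ne0 by (intro mult_pos_pos integral_pos continuous_on_power[OF g]) auto
  finally show ?thesis .
qed

end

section \<open>Rays and circles through a critical point\<close>

lemma has_real_derivative_ln_cmod_affine:
  assumes "z + of_real s * w \<noteq> 0"
  shows "((\<lambda>s. ln (cmod (z + of_real s * w))) has_real_derivative Re (w / (z + of_real s * w))) (at s)"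
proof -
  let ?r = "\<lambda>s. (Re z + s * Re w)\<^sup>2 + (Im z + s * Im w)\<^sup>2"
  have eq: "(cmod (z + of_real s * w))\<^sup>2 = ?r s" for s
    by (simp add: cmod_power2)
  have pos: "0 < ?r s"
    using assms by (metis eq zero_less_norm_iff zero_less_power)
  have half_ln: "ln (cmod (z + of_real s * w)) = ln (?r s) / 2" for s
    by (simp add: ln_realpow flip: eq)
  have "((\<lambda>s. ln (?r s) / 2) has_real_derivative Re (w / (z + of_real s * w))) (at s)"
  proof (rule DERIV_cong)
    show "((\<lambda>s. ln (?r s) / 2) has_real_derivative
        (1 / ?r s * (2 * ((Re z + s * Re w) * Re w) + 2 * ((Im z + s * Im w) * Im w))) / 2) (at s)"
      using pos by (intro DERIV_cdivide DERIV_chain2[OF DERIV_ln_divide])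
        (auto intro!: derivative_eq_intros)
    show "(1 / ?r s * (2 * ((Re z + s * Re w) * Re w) + 2 * ((Im z + s * Im w) * Im w))) / 2
        = Re (w / (z + of_real s * w))"
    proof -
      have half: "(1 / r * (2 * p + 2 * p')) / 2 = (p + p') / r" for r p p' :: real
        by (cases "r = 0") (simp_all add: field_simps)
      show ?thesis unfolding half by (simp add: Re_divide mult.commute)
    qed
  qed
  then show ?thesis unfolding half_ln .
qed

lemma has_real_derivative_Re_affine:
  assumes "z + of_real s * w \<noteq> 0"
  shows "((\<lambda>s. Re (w / (z + of_real s * w))) has_real_derivative - Re (w\<^sup>2 / (z + of_real s * w)\<^sup>2)) (at s)"
proof -
  have "((\<lambda>s. w / (z + s * w)) has_field_derivative - (w\<^sup>2 / (z + of_real s * w)\<^sup>2)) (at (of_real s))"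
    using assms by (auto intro!: derivative_eq_intros simp: power2_eq_square)
  then have "((\<lambda>s. w / (z + of_real s * w)) has_vector_derivative - (w\<^sup>2 / (z + of_real s * w)\<^sup>2)) (at s)"
    by (rule has_vector_derivative_real_field)
  from bounded_linear.has_vector_derivative[OF bounded_linear_Re this]
  show ?thesis by (simp add: has_real_derivative_iff_has_vector_derivative)
qed

text \<open>\<open>f - \<kappa> s^2\<close> is convex, hence lies above its tangent at 0, which is
  horizontal.\<close>

lemma quadratic_lower_bound:
  fixes f :: "real \<Rightarrow> real"
  assumes f: "\<And>s. \<bar>s\<bar> \<le> \<sigma> \<Longrightarrow> (f has_real_derivative f' s) (at s)"
    and f': "\<And>s. \<bar>s\<bar> \<le> \<sigma> \<Longrightarrow> (f' has_real_derivative f'' s) (at s)"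
    and f'': "\<And>s. \<bar>s\<bar> \<le> \<sigma> \<Longrightarrow> 2 * \<kappa> \<le> f'' s"
    and "f' 0 = 0" "\<bar>s\<bar> \<le> \<sigma>"
  shows "f 0 + \<kappa> * s\<^sup>2 \<le> f s"
proof -
  let ?g = "\<lambda>s. f s - \<kappa> * s\<^sup>2"
  have "(f' 0 - \<kappa> * (2 * 0)) * (s - 0) \<le> ?g s - ?g 0"
  proof (rule f''_imp_f'[where C = "{-\<sigma>..\<sigma>}" and f'' = "\<lambda>s. f'' s - \<kappa> * 2"])
    show "(?g has_real_derivative f' s - \<kappa> * (2 * s)) (at s)" if "s \<in> {-\<sigma>..\<sigma>}" for s
      using f[of s] that by (auto intro!: derivative_eq_intros simp: abs_le_iff)
    show "((\<lambda>s. f' s - \<kappa> * (2 * s)) has_real_derivative f'' s - \<kappa> * 2) (at s)" if "s \<in> {-\<sigma>..\<sigma>}" for s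
      using f'[of s] that by (auto intro!: derivative_eq_intros simp: abs_le_iff)
    show "0 \<le> f'' s - \<kappa> * 2" if "s \<in> {-\<sigma>..\<sigma>}" for s
      using f''[of s] that by (simp add: abs_le_iff)
  qed (use assms in \<open>auto simp: abs_le_iff\<close>)
  then show ?thesis using assms by simp
qed

lemma Re_of_real_times: "Re (of_real r * z) = r * Re z"
  by simp

lemma node_poly_holomorphic [holomorphic_intros]: "node_poly n x holomorphic_on S"
  unfolding node_poly_def by (intro holomorphic_intros)

lemma cmod_node_poly: "cmod (node_poly n x z) = (\<Prod>i=1..n. cmod (z - of_real (x i)))"
  by (simp add: node_poly_def prod_norm)

context saddle_point
begin

lemma cmod_node_poly_eq_exp:
  assumes "z \<notin> of_real ` y n ` {1..n}" "z \<noteq> 0" "0 < n"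
  shows "cmod (node_poly n (y n) z) = exp (n * Hn n z) * cmod z ^ (n - q n)"
proof -
  have "cmod (node_poly n (y n) z) = (\<Prod>i=1..n. exp (ln (cmod (z - of_real (y n i)))))"
    unfolding cmod_node_poly
  proof (intro prod.cong refl)
    fix i assume "i \<in> {1..n}"
    then have "z - of_real (y n i) \<noteq> 0" using assms(1) by auto
    then show "cmod (z - of_real (y n i)) = exp (ln (cmod (z - of_real (y n i))))" by simp
  qed
  also have "\<dots> = exp (\<Sum>i=1..n. ln (cmod (z - of_real (y n i))))"
    by (simp add: exp_sum)
  also have "(\<Sum>i=1..n. ln (cmod (z - of_real (y n i)))) = n * Hn n z + (n - q n) * ln (cmod z)"
    using assms q[of n] by (simp add: Hn_def mean_def b_def field_simps)
  also have "exp \<dots> = exp (n * Hn n z) * cmod z ^ (n - q n)"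
    using assms q[of n] by (simp add: exp_add exp_of_nat_mult flip: of_nat_diff)
  finally show ?thesis .
qed

text \<open>Since \<open>1 + x \<le> exp x\<close>, the product of the ratios \<open>|v - t|\<^sup>2 / |w - t|\<^sup>2\<close> is at most the exponential of
  the sum of their deviations from 1, which vanishes at a critical point.\<close>

lemma circle_maximum:
  assumes F: "Fn n w = 0" "0 < Im w" "0 < n" and v: "cmod v = cmod w"
  shows "cmod (node_poly n (y n) v) \<le> cmod (node_poly n (y n) w)"
proof -
  let ?r = "\<lambda>t. (cmod (v - of_real t))\<^sup>2 / (cmod (w - of_real t))\<^sup>2"
  have pos: "0 < cmod (w - of_real t)" for t using F by (intro cmod_minus_of_real_pos) simp
  have vw: "(Re v)\<^sup>2 + (Im v)\<^sup>2 = (Re w)\<^sup>2 + (Im w)\<^sup>2" using v by (simp add: cmod_def)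
  \<comment> \<open>Equal moduli cancel the quadratic terms, so the deviation from 1 is linear in
    \<open>t / |w - t|^2\<close>, whose mean vanishes by \<open>Fn_zero\<close>.\<close>
  have r: "?r t - 1 = 2 * (Re w - Re v) * (t / (cmod (w - of_real t))\<^sup>2)" for t
  proof -
    have "(cmod (v - of_real t))\<^sup>2 = (cmod (w - of_real t))\<^sup>2 + 2 * (Re w - Re v) * t"
      using vw by (simp add: sq_cmod_minus_of_real power2_diff algebra_simps)
    then show ?thesis using pos[of t] by (simp add: divide_simps)
  qed
  have "(\<Prod>i=1..n. ?r (y n i)) \<le> (\<Prod>i=1..n. exp (?r (y n i) - 1))"
  proof (intro prod_mono conjI)
    show "?r (y n i) \<le> exp (?r (y n i) - 1)" for i
      using exp_ge_add_one_self[of "?r (y n i) - 1"] by simp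
  qed simp
  also have "\<dots> = exp (\<Sum>i=1..n. ?r (y n i) - 1)" by (simp add: exp_sum)
  also have "(\<Sum>i=1..n. ?r (y n i) - 1) = 2 * (Re w - Re v) * (\<Sum>i=1..n. y n i / (cmod (w - of_real (y n i)))\<^sup>2)"
    by (simp only: r sum_distrib_left)
  also have "\<dots> = 0"
    using Fn_zero(1)[OF F] F by (simp add: mean_def)
  finally have "(\<Prod>i=1..n. ?r (y n i)) \<le> 1" by simp
  moreover have "(\<Prod>i=1..n. ?r (y n i)) = (cmod (node_poly n (y n) v))\<^sup>2 / (cmod (node_poly n (y n) w))\<^sup>2"
    by (simp add: cmod_node_poly prod_dividef prod_power_distrib)
  moreover have "0 < cmod (node_poly n (y n) w)"
    using pos by (auto simp: cmod_node_poly intro!: prod_pos)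
  ultimately show ?thesis
    by (simp add: divide_le_eq power_mono_iff)
qed

text \<open>On the ray z = (1 + s) w each differentiation in s brings a factor w = z / (1 + s),
  whence the divisor \<open>(1 + s)^2\<close> under \<open>Sn\<close>.\<close>

lemma radial_derivatives:
  assumes "0 < Im w" "\<bar>s\<bar> < 1"
  shows "((\<lambda>s. Hn n (w + of_real s * w)) has_real_derivative
      Re (mean n (y n) (\<lambda>t. w / (w + of_real s * w - of_real t)) - of_real (b n) * (w / (w + of_real s * w)))) (at s)"
    and "((\<lambda>s. Re (mean n (y n) (\<lambda>t. w / (w + of_real s * w - of_real t)) - of_real (b n) * (w / (w + of_real s * w))))
      has_real_derivative Re (Sn n (w + of_real s * w)) / (1 + s)\<^sup>2) (at s)"
proof -
  have im: "Im (w + of_real s * w) = (1 + s) * Im w" by (simp add: algebra_simps)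
  have "0 < (1 + s) * Im w" using assms by (intro mult_pos_pos) auto
  then have nz: "w + of_real s * w - of_real t \<noteq> 0" for t
    by (intro minus_of_real_nonzero) (simp only: im)
  have nzt: "(w - of_real t) + of_real s * w \<noteq> 0" for t
    using nz[of t] by (simp add: algebra_simps)
  have nz0: "w + of_real s * w \<noteq> 0" using nz[of 0] by simp
  have swap: "w + of_real s * w - of_real t = (w - of_real t) + of_real s * w" for s t :: real
    by simp
  show "((\<lambda>s. Hn n (w + of_real s * w)) has_real_derivative
      Re (mean n (y n) (\<lambda>t. w / (w + of_real s * w - of_real t)) - of_real (b n) * (w / (w + of_real s * w)))) (at s)"
    unfolding Hn_def mean_def minus_complex.sel Re_divide_of_nat Re_sum swap Re_of_real_times
    by (intro DERIV_diff DERIV_cdivide DERIV_sum DERIV_cmult has_real_derivative_ln_cmod_affine nzt nz0)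
  have e: "Re (Sn n (w + of_real s * w)) / (1 + s)\<^sup>2 =
     (\<Sum>i=1..n. - Re (w\<^sup>2 / ((w - of_real (y n i)) + of_real s * w)\<^sup>2)) / of_nat n
       - b n * - Re (w\<^sup>2 / (w + of_real s * w)\<^sup>2)"
  proof -
    have f: "w + of_real s * w = of_real (1 + s) * w" by (simp add: algebra_simps)
    have "1 + s \<noteq> 0" using assms by auto
    have 1: "Re ((w + of_real s * w)\<^sup>2 / c) / (1 + s)\<^sup>2 = Re (w\<^sup>2 / c)" for c
    proof -
      have "(w + of_real s * w)\<^sup>2 / c = of_real ((1 + s)\<^sup>2) * (w\<^sup>2 / c)"
        unfolding f by (simp only: power_mult_distrib of_real_power times_divide_eq_right)
      then have "Re ((w + of_real s * w)\<^sup>2 / c) = (1 + s)\<^sup>2 * Re (w\<^sup>2 / c)"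
        by (simp only: Re_of_real_times)
      then show ?thesis using \<open>1 + s \<noteq> 0\<close> by simp
    qed
    have 2: "Re (w\<^sup>2 / (w + of_real s * w)\<^sup>2) = 1 / (1 + s)\<^sup>2"
    proof -
      have "w\<^sup>2 / (w + of_real s * w)\<^sup>2 = of_real (1 / (1 + s)\<^sup>2)"
        using nz0 assms unfolding f by (simp add: power_mult_distrib)
      then show ?thesis by (simp only: Re_complex_of_real)
    qed
    have 3: "Re (mean n (y n) (\<lambda>t. (w + of_real s * w)\<^sup>2 / (w + of_real s * w - of_real t)\<^sup>2)) / (1 + s)\<^sup>2
        = (\<Sum>i=1..n. Re (w\<^sup>2 / (w + of_real s * w - of_real (y n i))\<^sup>2)) / of_nat n"
      unfolding 1 [symmetric] mean_def Re_divide_of_nat Re_sum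
      by (simp only: sum_divide_distrib [symmetric] divide_divide_eq_left mult.commute)
    show ?thesis
      unfolding 2 by (simp add: Sn_def diff_divide_distrib 3[unfolded swap] sum_negf swap)
  qed
  show "((\<lambda>s. Re (mean n (y n) (\<lambda>t. w / (w + of_real s * w - of_real t)) - of_real (b n) * (w / (w + of_real s * w))))
      has_real_derivative Re (Sn n (w + of_real s * w)) / (1 + s)\<^sup>2) (at s)"
    unfolding e mean_def minus_complex.sel Re_divide_of_nat Re_sum swap Re_of_real_times
    by (intro DERIV_diff DERIV_cdivide DERIV_sum DERIV_cmult has_real_derivative_Re_affine nzt nz0)
qed

end

section \<open>Critical points for finite n and the radial minimum at them\<close>

context saddle_point
begin

lemma Fn_holomorphic:
  assumes "S \<subseteq> upper_halfplane"
  shows "Fn n holomorphic_on S"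
proof -
  have "z - of_real t \<noteq> 0" if "z \<in> S" for z t
    using that assms by (intro minus_of_real_nonzero) auto
  then show ?thesis
    unfolding Fn_def[abs_def] mean_def divide_inverse by (intro holomorphic_intros)
qed

text \<open>Otherwise a subsequence is free of zeros in the ball, and by Hurwitz its limit is either
  free of zeros or constant there. The limit vanishes at w0; if it were constant, w0 + r / 2 would
  be another root in the upper half-plane, against \<open>root_unique\<close>.\<close>

lemma eventually_Fn_zero:
  assumes "0 < r" "cball w0 r \<subseteq> upper_halfplane"
  shows "\<forall>\<^sub>F n in sequentially. \<exists>z\<in>ball w0 r. Fn n z = 0"
proof (rule ccontr)
  let ?g = "\<lambda>z. (\<integral>t. z / (z - of_real t) \<partial>\<nu>) - of_real (1 - \<alpha>)"
  assume "\<not> ?thesis"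
  then have "frequently (\<lambda>n. \<forall>z\<in>ball w0 r. Fn n z \<noteq> 0) sequentially"
    by (simp add: not_eventually)
  then have "infinite {n. \<forall>z\<in>ball w0 r. Fn n z \<noteq> 0}"
    by (simp add: frequently_cofinite flip: cofinite_eq_sequentially)
  then obtain s :: "nat \<Rightarrow> nat" where s: "strict_mono s" "\<And>n. s n \<in> {n. \<forall>z\<in>ball w0 r. Fn n z \<noteq> 0}"
    using infinite_enumerate by blast
  have sub: "ball w0 r \<subseteq> upper_halfplane" by (rule order_trans[OF ball_subset_cball assms(2)])
  have lim: "uniform_limit K (\<lambda>n. Fn (s n)) ?g sequentially" if "compact K" "K \<subseteq> ball w0 r" for K
    by (rule filterlim_compose[OF Fn_uniform_limit[OF that(1) order_trans[OF that(2) sub]] filterlim_subseq[OF s(1)]])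
  have hol: "?g holomorphic_on ball w0 r"
  proof (rule holomorphic_uniform_sequence)
    show "Fn (s n) holomorphic_on ball w0 r" for n by (rule Fn_holomorphic[OF sub])
    fix x assume "x \<in> ball w0 r"
    then have "\<exists>d>0. cball x d \<subseteq> ball w0 r"
      by (rule bspec[OF open_contains_cball[THEN iffD1, OF open_ball]])
    then obtain d where d: "0 < d" "cball x d \<subseteq> ball w0 r"
      by (elim exE conjE)
    then show "\<exists>d>0. cball x d \<subseteq> ball w0 r \<and> uniform_limit (cball x d) (\<lambda>n. Fn (s n)) ?g sequentially"
      by (intro exI[of _ d] conjI lim compact_cball)
  qed simp
  have g0: "?g w0 = 0" using root by simp
  have nonconst: "\<not> ?g constant_on ball w0 r"
  proof
    assume "?g constant_on ball w0 r"
    then have eq: "?g z = 0" if "z \<in> ball w0 r" for z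
    proof -
      obtain c where "\<And>x. x \<in> ball w0 r \<Longrightarrow> ?g x = c"
        using \<open>?g constant_on ball w0 r\<close> unfolding constant_on_def by (elim exE) (rule that, auto)
      from this[OF that] this[of w0] show ?thesis using g0 assms(1) by simp
    qed
    let ?z = "w0 + of_real (r / 2)"
    have "?z \<in> ball w0 r" using assms(1) by (simp add: dist_norm)
    then have "(\<integral>t. ?z / (?z - of_real t) \<partial>\<nu>) = of_real (1 - \<alpha>)"
      by (rule eq[THEN eq_iff_diff_eq_0[THEN iffD2]])
    moreover have "0 < Im ?z" using w0 by simp
    ultimately have "?z = w0"
      by (intro root_unique[OF _ w0 _ root])
    with assms(1) show False by simp
  qed
  have "?g w0 \<noteq> 0"
  proof (rule Hurwitz_no_zeros[of "ball w0 r" "\<lambda>n. Fn (s n)" ?g])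
    show "Fn (s n) z \<noteq> 0" if "z \<in> ball w0 r" for n z using s(2) that by blast
  qed (use lim hol nonconst Fn_holomorphic[OF sub] assms(1) in simp_all)
  with g0 show False by simp
qed

lemma Fn_zero_sequence:
  obtains w where "w \<longlonglongrightarrow> w0" "\<forall>\<^sub>F n in sequentially. Fn n (w n) = 0"
proof -
  obtain r where r: "0 < r" "cball w0 r \<subseteq> upper_halfplane"
    using open_contains_cball open_upper_halfplane w0 by (metis mem_Collect_eq)
  define Z where "Z n = {z \<in> ball w0 r. Fn n z = 0}" for n
  define d where "d n = Inf ((\<lambda>z. dist z w0) ` Z n)" for n
  \<comment> \<open>A zero that is nearest to w0 up to 1 / Suc n. A single choice thus serves every
    radius e, and the infimum need not be attained.\<close>
  have "\<exists>z. Z n \<noteq> {} \<longrightarrow> z \<in> Z n \<and> dist z w0 < d n + 1 / Suc n" for n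
  proof (cases "Z n = {}")
    case False
    then have "\<exists>x\<in>(\<lambda>z. dist z w0) ` Z n. x < d n + 1 / Suc n"
      unfolding d_def by (intro cInf_lessD) auto
    then show ?thesis by auto
  qed auto
  then obtain w where w: "\<And>n. Z n \<noteq> {} \<Longrightarrow> w n \<in> Z n \<and> dist (w n) w0 < d n + 1 / Suc n" by metis
  have ne: "\<forall>\<^sub>F n in sequentially. Z n \<noteq> {}"
    using eventually_Fn_zero[OF r] by eventually_elim (auto simp: Z_def)
  have "w \<longlonglongrightarrow> w0"
  proof (rule tendstoI)
    fix e :: real assume "0 < e"
    define e' where "e' = min (e / 2) r"
    have e': "0 < e'" "cball w0 e' \<subseteq> upper_halfplane"
      using \<open>0 < e\<close> r by (auto simp: e'_def)
    have "\<forall>\<^sub>F n in sequentially. 1 / real (Suc n) < e / 2"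
      using order_tendstoD(2)[OF LIMSEQ_inverse_real_of_nat, of "e / 2"] \<open>0 < e\<close>
      by (simp add: inverse_eq_divide)
    with eventually_Fn_zero[OF e'] show "\<forall>\<^sub>F n in sequentially. dist (w n) w0 < e"
    proof eventually_elim
      case (elim n)
      then obtain z where "z \<in> ball w0 e'" "Fn n z = 0" by blast
      then have z: "z \<in> Z n" "dist z w0 < e / 2"
        by (simp_all add: Z_def e'_def dist_commute)
      then have "d n \<le> dist z w0"
        unfolding d_def by (intro cInf_lower) (auto intro!: bdd_belowI[where m = 0])
      with w[of n] z elim show ?case by force
    qed
  qed
  moreover have "\<forall>\<^sub>F n in sequentially. Fn n (w n) = 0"
    using ne by eventually_elim (use w Z_def in auto)
  ultimately show thesis by (rule that)
qed

text \<open>\<open>Sn\<close> converges uniformly near w0 to a function with positive real part, so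
  the second radial derivative has a positive lower bound independent of n, while the first vanishes
  at w n.\<close>

lemma radial_minimum:
  assumes w: "w \<longlonglongrightarrow> w0" "\<forall>\<^sub>F n in sequentially. Fn n (w n) = 0"
  obtains \<sigma> \<kappa> where "0 < \<sigma>" "\<sigma> < 1" "0 < \<kappa>"
    "\<forall>\<^sub>F n in sequentially. \<forall>s. \<bar>s\<bar> \<le> \<sigma> \<longrightarrow> Hn n (w n) + \<kappa> * s\<^sup>2 \<le> Hn n (w n + of_real s * w n)"
proof -
  let ?S = "\<lambda>z. of_real (1 - \<alpha>) - (\<integral>t. z\<^sup>2 / (z - of_real t)\<^sup>2 \<partial>\<nu>)"
  \<comment> \<open>A quarter, so that the limit exceeds 3 k near w0; the approximation error k
    leaves 2 k, and the divisor \<open>(1 + s)^2 \<le> 2\<close> leaves k, so that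
    \<open>\<kappa> = k / 2\<close>.\<close>
  define k where "k = Re (?S w0) / 4"
  have k: "0 < k" "3 * k < Re (?S w0)" using Re_S_pos by (auto simp: k_def)
  have "continuous_on upper_halfplane (\<lambda>z. Re (?S z))"
    by (intro continuous_intros continuous_on_integral open_upper_halfplane continuous_on_div_kernel) auto
  then have "\<forall>\<^sub>F z in at w0. 3 * k < Re (?S z)"
    using k(2) open_upper_halfplane w0
    by (intro order_tendstoD) (auto simp: continuous_on_eq_continuous_at isCont_def)
  then have "\<forall>\<^sub>F z in nhds w0. 3 * k < Re (?S z)"
    using k(2) by (simp add: eventually_nhds_conv_at)
  moreover have "\<forall>\<^sub>F z in nhds w0. z \<in> upper_halfplane"
    using open_upper_halfplane w0 by (intro eventually_nhds_in_open) auto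
  ultimately have "\<forall>\<^sub>F z in nhds w0. 3 * k < Re (?S z) \<and> z \<in> upper_halfplane"
    by (rule eventually_conj)
  then obtain r' where r': "0 < r'" "\<And>z. dist z w0 < r' \<Longrightarrow> 3 * k < Re (?S z) \<and> z \<in> upper_halfplane"
    unfolding eventually_nhds_metric by blast
  define r where "r = r' / 2"
  have r: "0 < r" "\<And>z. z \<in> cball w0 r \<Longrightarrow> 3 * k < Re (?S z)" "cball w0 r \<subseteq> upper_halfplane"
    using r' by (auto simp: r_def dist_commute)
  define M where "M = cmod w0 + r"
  have M: "0 < M" using r by (simp add: M_def add_nonneg_pos)
  \<comment> \<open>The 1/4 gives \<open>(1 + s)^2 \<le> 25/16\<close>; the second entry keeps the
    whole segment within r / 2 of w n, hence in \<open>cball w0 r\<close>.\<close>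
  define \<sigma> where "\<sigma> = min (1 / 4) (r / (2 * M))"
  have \<sigma>: "0 < \<sigma>" "\<sigma> \<le> 1 / 4" "\<sigma> < 1" "\<sigma> * M \<le> r / 2"
  proof -
    show "0 < \<sigma>" using r M by (simp add: \<sigma>_def)
    have "\<sigma> * M \<le> r / (2 * M) * M"
      using M by (intro mult_right_mono) (auto simp: \<sigma>_def)
    then show "\<sigma> * M \<le> r / 2" using M by simp
  qed (auto simp: \<sigma>_def)
  have "\<forall>\<^sub>F n in sequentially. \<forall>z\<in>cball w0 r. dist (Sn n z) (?S z) < k"
    using Sn_uniform_limit[OF compact_cball r(3)] k by (auto dest: uniform_limitD)
  moreover have "\<forall>\<^sub>F n in sequentially. dist (w n) w0 < r / 2"
    using w(1) r(1) by (intro tendstoD) auto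
  ultimately have "\<forall>\<^sub>F n in sequentially. \<forall>s. \<bar>s\<bar> \<le> \<sigma> \<longrightarrow> Hn n (w n) + (k / 2) * s\<^sup>2 \<le> Hn n (w n + of_real s * w n)"
    using w(2) eventually_gt_at_top[of 0]
  proof eventually_elim
    case (elim n)
    have wn: "0 < Im (w n)" using elim(2) r by (auto simp: dist_commute subset_iff)
    let ?f = "\<lambda>s. Hn n (w n + of_real s * w n)"
    have nw: "cmod (w n) \<le> M"
      using elim(2) norm_triangle_ineq2[of "w n" w0] r(1) by (simp add: dist_norm M_def)
    have "?f 0 + (k / 2) * s\<^sup>2 \<le> ?f s" if s: "\<bar>s\<bar> \<le> \<sigma>" for s
    proof (rule quadratic_lower_bound[OF radial_derivatives(1)[OF wn] radial_derivatives(2)[OF wn] _ _ s])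
      fix s assume s: "\<bar>s\<bar> \<le> \<sigma>"
      then show "\<bar>s\<bar> < 1" "\<bar>s\<bar> < 1" using \<sigma> by auto
      let ?z = "w n + of_real s * w n"
      have "cmod (of_real s * w n) \<le> r / 2"
        using mult_mono[OF s nw] \<sigma> by (simp add: norm_mult)
      then have "?z \<in> cball w0 r"
        using elim(2) norm_triangle_ineq[of "w n - w0" "of_real s * w n"]
        by (simp add: dist_norm norm_minus_commute algebra_simps)
      then have "cmod (Sn n ?z - ?S ?z) < k" "3 * k < Re (?S ?z)"
        using elim(1) r(2) by (simp_all only: dist_norm)
      then have "2 * k \<le> Re (Sn n ?z)"
        using abs_Re_le_cmod[of "Sn n ?z - ?S ?z"] unfolding minus_complex.sel by linarith
      moreover have "(1 + s)\<^sup>2 \<le> 2" "0 < (1 + s)\<^sup>2"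
      proof -
        have "\<bar>1 + s\<bar> \<le> 5 / 4" using s \<sigma> by auto
        then have "(1 + s)\<^sup>2 \<le> (5 / 4)\<^sup>2" using power_mono[of "\<bar>1 + s\<bar>" "5 / 4" 2] by simp
        then show "(1 + s)\<^sup>2 \<le> 2" by (simp add: power2_eq_square)
        show "0 < (1 + s)\<^sup>2" using s \<sigma> by auto
      qed
      moreover have "k * (1 + s)\<^sup>2 \<le> k * 2"
        using \<open>(1 + s)\<^sup>2 \<le> 2\<close> k(1) by (intro mult_left_mono) auto
      ultimately show "2 * (k / 2) \<le> Re (Sn n ?z) / (1 + s)\<^sup>2"
        by (simp add: pos_le_divide_eq)
    next
      have "Re (Fn n (w n)) = 0" using elim by simp
      moreover have "w n \<noteq> 0" using wn by auto
      ultimately show "Re (mean n (y n) (\<lambda>t. w n / (w n + of_real 0 * w n - of_real t)) - of_real (b n) * (w n / (w n + of_real 0 * w n))) = 0"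
        by (simp add: Fn_def)
    qed
    then show ?case by simp
  qed
  then show thesis using \<sigma> k by (intro that[of \<sigma> "k / 2"]) auto
qed

end

subsection \<open>Superlevel paths of the potential\<close>

text \<open>On a circle about 0 the square \<open>|z - t|^2 = r^2 + t^2 - 2 t Re z\<close> is affine
  in Re z, and ln is concave.\<close>

lemma ln_cmod_concave:
  assumes r: "cmod z1 = r" "cmod z2 = r" "cmod z3 = r"
    and Re: "Re z3 = (1 - u) * Re z1 + u * Re z2" and u: "0 \<le> u" "u \<le> 1"
    and nz: "z1 \<noteq> of_real t" "z2 \<noteq> of_real t"
  shows "(1 - u) * ln (cmod (z1 - of_real t)) + u * ln (cmod (z2 - of_real t)) \<le> ln (cmod (z3 - of_real t))"
proof -
  have sq: "(cmod (z - of_real t))\<^sup>2 = r\<^sup>2 + t\<^sup>2 - 2 * t * Re z" if "cmod z = r" for z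
    using that unfolding sq_cmod_minus_of_real by (auto simp: cmod_power2 power2_diff)
  have ln2: "ln (cmod v) = ln ((cmod v)\<^sup>2) / 2" for v
    by (cases "v = 0") (simp_all add: ln_realpow)
  have pos: "0 < (cmod (z1 - of_real t))\<^sup>2" "0 < (cmod (z2 - of_real t))\<^sup>2" using nz by auto
  have "(1 - u) * ln ((cmod (z1 - of_real t))\<^sup>2) + u * ln ((cmod (z2 - of_real t))\<^sup>2)
      \<le> ln ((1 - u) * (cmod (z1 - of_real t))\<^sup>2 + u * (cmod (z2 - of_real t))\<^sup>2)"
    using concave_onD[OF ln_concave u, of "(cmod (z1 - of_real t))\<^sup>2" "(cmod (z2 - of_real t))\<^sup>2"] pos
    by simp
  also have "(1 - u) * (cmod (z1 - of_real t))\<^sup>2 + u * (cmod (z2 - of_real t))\<^sup>2 = (cmod (z3 - of_real t))\<^sup>2"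
    by (simp add: sq r Re algebra_simps)
  finally have "((1 - u) * ln ((cmod (z1 - of_real t))\<^sup>2) + u * ln ((cmod (z2 - of_real t))\<^sup>2)) / 2
      \<le> ln ((cmod (z3 - of_real t))\<^sup>2) / 2"
    by (rule divide_right_mono) simp
  then show ?thesis
    unfolding ln2[of "z1 - of_real t"] ln2[of "z2 - of_real t"] ln2[of "z3 - of_real t"]
    by (simp only: add_divide_distrib times_divide_eq_right)
qed

text \<open>The upper semicircle parametrised by the real part, the coordinate in which the
  potential is concave.\<close>

definition circle_point :: "real \<Rightarrow> real \<Rightarrow> complex" where
  "circle_point r s = Complex s (sqrt (r\<^sup>2 - s\<^sup>2))"

lemma cmod_circle_point:
  assumes "\<bar>s\<bar> \<le> r"
  shows "cmod (circle_point r s) = r"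
proof -
  have "s\<^sup>2 \<le> r\<^sup>2" using power_mono[OF assms, of 2] by simp
  then show ?thesis using assms by (simp add: circle_point_def cmod_def)
qed

lemma Im_circle_point_pos: "\<bar>s\<bar> < r \<Longrightarrow> 0 < Im (circle_point r s)"
  using power_strict_mono[of "\<bar>s\<bar>" r 2] by (simp add: circle_point_def)

lemma circle_point_Re: "0 < Im z \<Longrightarrow> circle_point (cmod z) (Re z) = z"
  by (simp add: circle_point_def complex_eq_iff cmod_def)

text \<open>Rescaling z to modulus r' moves it by exactly |r' - r|, hence not out of a small
  ball.\<close>

lemma open_cmod_image:
  assumes "open S" "0 \<notin> S"
  shows "open (cmod ` S)"
  unfolding open_dist
proof (intro ballI)
  fix r assume "r \<in> cmod ` S"
  then obtain z where z: "z \<in> S" "r = cmod z" by auto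
  then have "0 < r" using assms by auto
  obtain e where e: "0 < e" "\<And>v. dist v z < e \<Longrightarrow> v \<in> S" using assms(1) z unfolding open_dist by blast
  show "\<exists>e>0. \<forall>r'. dist r' r < e \<longrightarrow> r' \<in> cmod ` S"
  proof (intro exI[of _ "min e r"] conjI allI impI)
    fix r' assume r': "dist r' r < min e r"
    let ?v = "of_real (r' / r) * z"
    have "?v - z = of_real ((r' - r) / r) * z"
      using \<open>0 < r\<close> by (simp add: field_simps)
    then have "dist ?v z = cmod (of_real ((r' - r) / r) * z)" by (simp only: dist_norm)
    also have "\<dots> = \<bar>r' - r\<bar>"
      unfolding norm_mult norm_of_real using \<open>0 < r\<close> z by simp
    finally have "dist ?v z = \<bar>r' - r\<bar>" .
    then have "?v \<in> S" using e r' by (simp add: dist_real_def)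
    moreover have "cmod ?v = r'"
    proof -
      have "\<bar>r' - r\<bar> < r" using r' by (simp add: dist_real_def)
      then have "0 < r'" by linarith
      then show ?thesis unfolding norm_mult norm_of_real using \<open>0 < r\<close> z by simp
    qed
    ultimately show "r' \<in> cmod ` S" by force
  qed (use e \<open>0 < r\<close> in auto)
qed

context saddle_point
begin

lemma Hn_tendsto:
  assumes "z \<longlonglongrightarrow> v" "0 < Im v"
  shows "(\<lambda>n. Hn n (z n)) \<longlonglongrightarrow> H v"
proof -
  obtain r where r: "0 < r" "cball v r \<subseteq> upper_halfplane"
    using open_contains_cball open_upper_halfplane assms(2) by (metis mem_Collect_eq)
  have isC: "isCont H v"
    using continuous_on_H open_upper_halfplane assms(2) by (simp add: continuous_on_eq_continuous_at)
  then have "(\<lambda>n. H (z n)) \<longlonglongrightarrow> H v" by (rule isCont_tendsto_compose[OF _ assms(1)])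
  moreover have "(\<lambda>n. Hn n (z n) - H (z n)) \<longlonglongrightarrow> 0"
  proof (rule tendstoI)
    fix e :: real assume "0 < e"
    have "\<forall>\<^sub>F n in sequentially. \<forall>z\<in>cball v r. dist (Hn n z) (H z) < e"
      by (rule uniform_limitD[OF Hn_uniform_limit[OF compact_cball r(2)] \<open>0 < e\<close>])
    moreover have "\<forall>\<^sub>F n in sequentially. dist (z n) v < r"
      using assms(1) r(1) by (rule tendstoD)
    ultimately show "\<forall>\<^sub>F n in sequentially. dist (Hn n (z n) - H (z n)) 0 < e"
    proof eventually_elim
      case (elim n)
      then have "z n \<in> cball v r" by (simp add: dist_commute)
      with elim(1) show ?case by (simp add: dist_real_def)
    qed
  qed
  ultimately show ?thesis using tendsto_add by fastforce
qed

text \<open>In contrast to the version for \<open>H\<close>, the end points may be real as long as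
  they are no nodes. This matters because the point supplied by \<open>circle_exceeds\<close> may
  lie on the axis or below it.\<close>

lemma Hn_concave:
  assumes "cmod z1 = r" "cmod z2 = r" "cmod z3 = r" "Re z3 = (1 - u) * Re z1 + u * Re z2" "0 \<le> u" "u \<le> 1"
    and nz: "z1 \<notin> of_real ` y n ` {1..n}" "z2 \<notin> of_real ` y n ` {1..n}"
  shows "(1 - u) * Hn n z1 + u * Hn n z2 \<le> Hn n z3"
proof -
  have c: "mean n (y n) (\<lambda>t. c * g t) = c * mean n (y n) g" for c :: real and g
    by (simp add: mean_def sum_distrib_left)
  have a: "mean n (y n) (\<lambda>t. f t + g t) = mean n (y n) f + mean n (y n) g" for f g :: "real \<Rightarrow> real"
    by (simp add: mean_def sum.distrib add_divide_distrib)
  have "(1 - u) * mean n (y n) (\<lambda>t. ln (cmod (z1 - of_real t))) + u * mean n (y n) (\<lambda>t. ln (cmod (z2 - of_real t)))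
      \<le> mean n (y n) (\<lambda>t. ln (cmod (z3 - of_real t)))"
    unfolding c[symmetric] a[symmetric]
  proof (intro mean_mono)
    fix i assume "i \<in> {1..n}"
    then have "z1 \<noteq> of_real (y n i)" "z2 \<noteq> of_real (y n i)" using nz by auto
    then show "(1 - u) * ln (cmod (z1 - of_real (y n i))) + u * ln (cmod (z2 - of_real (y n i)))
        \<le> ln (cmod (z3 - of_real (y n i)))"
      by (intro ln_cmod_concave[OF assms(1-6)])
  qed
  then show ?thesis using assms(1-3) by (simp add: Hn_def algebra_simps)
qed

lemma H_concave:
  assumes "cmod z1 = r" "cmod z2 = r" "cmod z3 = r" "Re z3 = (1 - u) * Re z1 + u * Re z2" "0 \<le> u" "u \<le> 1"
    and im: "0 < Im z1" "0 < Im z2" "0 < Im z3"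
  shows "(1 - u) * H z1 + u * H z2 \<le> H z3"
proof -
  have nz: "z \<notin> of_real ` A" if "0 < Im z" for z A using that by auto
  have *: "(\<lambda>n. Hn n z) \<longlonglongrightarrow> H z" if "0 < Im z" for z
    using Hn_tendsto[OF tendsto_const that] .
  have "(\<lambda>n. (1 - u) * Hn n z1 + u * Hn n z2) \<longlonglongrightarrow> (1 - u) * H z1 + u * H z2"
    by (intro tendsto_intros * im)
  from this *[OF im(3)] show ?thesis
    by (rule LIMSEQ_le) (auto intro!: Hn_concave[OF assms(1-6)] nz im)
qed

text \<open>The maximum modulus principle in the annulus between the circles of radius \<open>r\<close> and \<open>|w n|\<close>, applied to
  \<open>node_poly z / z ^ (n - q n)\<close>: a point on a radial segment beats the circle through \<open>w n\<close>, hence so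
  does some point of the circle of radius \<open>r\<close>.\<close>

lemma circle_exceeds:
  assumes F: "Fn n w = 0" "0 < Im w" "0 < n" and r: "0 < r" "r \<noteq> cmod w"
    and v: "0 < Im v" "cmod v \<in> {min r (cmod w)<..<max r (cmod w)}"
    and B: "Hn n w < B" "B < Hn n v"
  obtains z where "cmod z = r" "z \<notin> of_real ` y n ` {1..n}" "B < Hn n z"
proof -
  let ?N = "of_real ` y n ` {1..n} :: complex set"
  let ?F = "\<lambda>z. node_poly n (y n) z / z ^ (n - q n)"
  define a b where "a = min r (cmod w)" and "b = max r (cmod w)"
  have ab: "0 < a" "a < b" "a < cmod v" "cmod v < b" using r F v by (auto simp: a_def b_def)
  define S where "S = cball (0::complex) b - ball 0 a"
  have S: "z \<in> S \<longleftrightarrow> a \<le> cmod z \<and> cmod z \<le> b" for z by (auto simp: S_def)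
  have nz: "z \<noteq> 0" if "z \<in> S" for z using that ab by (auto simp: S)
  have "closed S" by (auto simp: S_def)
  have F_eq: "cmod (?F z) = exp (n * Hn n z)" if "z \<notin> ?N" "z \<noteq> 0" for z
    using cmod_node_poly_eq_exp[OF that F(3)] that by (simp add: norm_divide norm_power)
  have notN: "z \<notin> ?N" if "0 < Im z" for z using that by auto
  have "\<exists>z\<in>frontier S. exp (n * B) < cmod (?F z)"
  proof (rule ccontr)
    assume neg: "\<not> ?thesis"
    have sub: "interior S \<subseteq> S" "closure S = S"
      using \<open>closed S\<close> by (simp_all add: interior_subset)
    have "cmod (?F v) \<le> exp (n * B)"
    proof (rule maximum_modulus_frontier[of ?F S])
      show "?F holomorphic_on interior S"
        by (intro holomorphic_intros) (use nz sub in auto)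
      show "continuous_on (closure S) ?F"
        unfolding sub node_poly_def by (intro continuous_intros) (use nz in auto)
      show "bounded S" unfolding S_def by (rule bounded_diff) simp
      show "v \<in> S" using ab by (simp add: S)
      show "cmod (?F z) \<le> exp (n * B)" if "z \<in> frontier S" for z
        using neg that by (meson linorder_not_less)
    qed
    moreover have "v \<noteq> 0" using v(1) by auto
    ultimately have "exp (n * Hn n v) \<le> exp (n * B)" using F_eq[OF notN[OF v(1)]] by simp
    then show False using B F by simp
  qed
  then obtain z where z: "z \<in> frontier S" "exp (n * B) < cmod (?F z)" by blast
  have "interior S \<supseteq> ball 0 b - cball 0 a"
    by (rule interior_maximal) (auto simp: S_def)
  then have "cmod z = a \<or> cmod z = b"
    using z(1) \<open>closed S\<close> S[of z] by (force simp: frontier_def)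
  moreover have "z \<noteq> 0" using nz z(1) \<open>closed S\<close> by (simp add: frontier_def)
  have "cmod z \<noteq> cmod w"
  proof
    assume "cmod z = cmod w"
    then have "cmod (?F z) \<le> cmod (?F w)"
      using circle_maximum[OF F] by (simp add: norm_divide norm_power divide_right_mono)
    also have "\<dots> = exp (n * Hn n w)" using F by (intro F_eq notN) auto
    also have "\<dots> < exp (n * B)" using B F by simp
    finally show False using z by simp
  qed
  ultimately have "cmod z = r" by (auto simp: a_def b_def min_def max_def split: if_splits)
  moreover have zN: "z \<notin> ?N"
  proof
    assume "z \<in> ?N"
    then have "node_poly n (y n) z = 0" by (auto simp: node_poly_def)
    with z(2) show False by simp
  qed
  moreover have "B < Hn n z"
    using z(2) F_eq[OF zN \<open>z \<noteq> 0\<close>] F by simp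
  ultimately show thesis by (rule that)
qed

text \<open>\<open>circle_exceeds\<close> yields a point for each large n, but possibly close to the
  axis, where \<open>Hn\<close> need not be near \<open>H\<close>. Concavity along the circle allows
  it to be pulled by a fixed fraction \<eta> towards i r at a small loss of level. The new points
  stay in a compact part of the open upper half-plane, where the convergence is uniform.\<close>

lemma exceeds_H_w0:
  assumes r: "0 < r" "r \<noteq> cmod w0"
  obtains z where "cmod z = r" "0 < Im z" "H w0 < H z"
proof -
  obtain w where w: "w \<longlonglongrightarrow> w0" "\<forall>\<^sub>F n in sequentially. Fn n (w n) = 0" by (rule Fn_zero_sequence)
  obtain \<sigma> \<kappa> where \<sigma>: "0 < \<sigma>" "\<sigma> < 1" "0 < \<kappa>" and
    rad: "\<forall>\<^sub>F n in sequentially. \<forall>s. \<bar>s\<bar> \<le> \<sigma> \<longrightarrow> Hn n (w n) + \<kappa> * s\<^sup>2 \<le> Hn n (w n + of_real s * w n)"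
    by (rule radial_minimum[OF w])
  let ?R = "cmod w0"
  have R: "0 < ?R" using w0 by auto
  \<comment> \<open>At most half of the relative distance, so that the radius |w0| (1 + s) is
    strictly between r and |w0|, as \<open>circle_exceeds\<close> requires.\<close>
  define s' where "s' = min \<sigma> (\<bar>r - ?R\<bar> / (2 * ?R))"
  define s where "s = (if r < ?R then - s' else s')"
  have s': "0 < s'" "s' \<le> \<sigma>" "s' * ?R \<le> \<bar>r - ?R\<bar> / 2"
  proof -
    show "0 < s'" using \<sigma> r R by (auto simp: s'_def)
    have "s' * ?R \<le> \<bar>r - ?R\<bar> / (2 * ?R) * ?R" using R by (intro mult_right_mono) (auto simp: s'_def)
    then show "s' * ?R \<le> \<bar>r - ?R\<bar> / 2" using R by simp
  qed (auto simp: s'_def)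
  have s: "\<bar>s\<bar> \<le> \<sigma>" "s \<noteq> 0" using s' by (auto simp: s_def)
  have mid: "?R * (1 + s) \<in> {min r ?R<..<max r ?R}"
    using s' r mult_pos_pos[OF s'(1) R] by (auto simp: s_def algebra_simps abs_if split: if_splits)
  \<comment> \<open>The ray gains 2 \<delta> over a starting level above L - \<delta>/4, which
    leaves room above L + \<delta>/4 for \<open>circle_exceeds\<close>. Pulling the point inwards
    costs \<delta>/8, by the choice of \<open>\<eta>\<close>, and passing from \<open>Hn\<close> to
    \<open>H\<close> less than \<delta>/8, so that the result still exceeds L.\<close>
  define \<delta> where "\<delta> = \<kappa> * s\<^sup>2 / 2"
  have \<delta>: "0 < \<delta>" using \<sigma> s by (simp add: \<delta>_def)
  define L where "L = H w0"
  define M where "M = \<bar>L + \<delta> / 4 - (H (Complex 0 r) - 1)\<bar> + 1"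
  define \<eta> where "\<eta> = min (1 / 2) (\<delta> / 8 / M)"
  have M: "0 < M" by (simp add: M_def)
  have \<eta>: "0 < \<eta>" "\<eta> < 1" "\<eta> * M \<le> \<delta> / 8"
  proof -
    have "\<eta> * M \<le> \<delta> / 8 / M * M" using M by (intro mult_right_mono) (auto simp: \<eta>_def)
    then show "\<eta> * M \<le> \<delta> / 8" using M by simp
  qed (use \<delta> M in \<open>auto simp: \<eta>_def\<close>)
  have mix: "L + \<delta> / 8 \<le> (1 - \<eta>) * (L + \<delta> / 4) + \<eta> * (H (Complex 0 r) - 1)"
  proof -
    have "\<eta> * (L + \<delta> / 4 - (H (Complex 0 r) - 1)) \<le> \<eta> * M"
      using \<eta> by (intro mult_left_mono) (auto simp: M_def)
    moreover have "(1 - \<eta>) * A + \<eta> * A' = A - \<eta> * (A - A')" for A A' :: real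
      by (simp add: algebra_simps)
    ultimately show ?thesis using \<eta>(3) by simp
  qed
  let ?K = "{z \<in> sphere 0 r. \<bar>Re z\<bar> \<le> (1 - \<eta>) * r \<and> 0 \<le> Im z}"
  have "closed {z. \<bar>Re z\<bar> \<le> (1 - \<eta>) * r}" "closed {z. 0 \<le> Im z}"
    by (intro closed_Collect_le continuous_intros)+
  then have "compact (sphere 0 r \<inter> ({z. \<bar>Re z\<bar> \<le> (1 - \<eta>) * r} \<inter> {z. 0 \<le> Im z}))"
    by (intro compact_Int_closed closed_Int) auto
  also have "sphere 0 r \<inter> ({z. \<bar>Re z\<bar> \<le> (1 - \<eta>) * r} \<inter> {z. 0 \<le> Im z}) = ?K" by auto
  finally have K: "compact ?K" .
  have Ksub: "?K \<subseteq> upper_halfplane"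
  proof
    fix z assume z: "z \<in> ?K"
    have "(1 - \<eta>) * r < r" using \<eta> r by simp
    then have "\<bar>Re z\<bar> < cmod z" using z by auto
    then have "Im z \<noteq> 0" by (auto simp: cmod_def)
    then show "z \<in> upper_halfplane" using z by auto
  qed
  have lim_w: "(\<lambda>n. Hn n (w n)) \<longlonglongrightarrow> L" unfolding L_def by (rule Hn_tendsto[OF w(1) w0])
  have lim_r: "(\<lambda>n. Hn n (Complex 0 r)) \<longlonglongrightarrow> H (Complex 0 r)"
    using r by (intro Hn_tendsto) auto
  have lim_mod: "(\<lambda>n. cmod (w n)) \<longlonglongrightarrow> ?R" by (intro tendsto_norm w)
  have lim_mid: "(\<lambda>n. cmod (w n) * (1 + s)) \<longlonglongrightarrow> ?R * (1 + s)" by (intro tendsto_intros lim_mod)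
  have e_mid: "\<forall>\<^sub>F n in sequentially. cmod (w n) * (1 + s) \<in> {min r (cmod (w n))<..<max r (cmod (w n))}"
  proof -
    have lim1: "(\<lambda>n. cmod (w n) * (1 + s) - min r (cmod (w n))) \<longlonglongrightarrow> ?R * (1 + s) - min r ?R"
      and lim2: "(\<lambda>n. max r (cmod (w n)) - cmod (w n) * (1 + s)) \<longlonglongrightarrow> max r ?R - ?R * (1 + s)"
      by (intro tendsto_intros lim_mid lim_mod)+
    have "0 < ?R * (1 + s) - min r ?R" "0 < max r ?R - ?R * (1 + s)" using mid by auto
    from order_tendstoD(1)[OF lim1 this(1)] order_tendstoD(1)[OF lim2 this(2)]
    show ?thesis by eventually_elim auto
  qed
  have "\<forall>\<^sub>F n in sequentially. cmod (w n) \<noteq> r"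
    using r by (intro tendsto_imp_eventually_ne[OF lim_mod]) auto
  moreover have "\<forall>\<^sub>F n in sequentially. 0 < Im (w n)"
    using order_tendstoD(1)[OF tendsto_Im[OF w(1)]] w0 by simp
  moreover have "\<forall>\<^sub>F n in sequentially. L - \<delta> / 4 < Hn n (w n)" "\<forall>\<^sub>F n in sequentially. Hn n (w n) < L + \<delta> / 4"
    using order_tendstoD[OF lim_w] \<delta> by auto
  moreover have "\<forall>\<^sub>F n in sequentially. H (Complex 0 r) - 1 < Hn n (Complex 0 r)"
    using order_tendstoD(1)[OF lim_r] by auto
  moreover have "\<forall>\<^sub>F n in sequentially. \<forall>z\<in>?K. dist (Hn n z) (H z) < \<delta> / 8"
    using \<delta> by (intro uniform_limitD[OF Hn_uniform_limit[OF K Ksub]]) auto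
  ultimately have "\<forall>\<^sub>F n in sequentially. \<exists>z\<in>?K. H w0 < H z"
    using w(2) rad e_mid eventually_gt_at_top[of 0]
  proof eventually_elim
    case (elim n)
    let ?v = "w n + of_real s * w n"
    have "?v = of_real (1 + s) * w n" by (simp add: algebra_simps)
    moreover have "0 < 1 + s" using s \<sigma> by auto
    ultimately have v: "0 < Im ?v" "cmod ?v = cmod (w n) * (1 + s)"
      using elim(2) by (simp_all add: norm_mult del: of_real_add)
    have "L + \<delta> / 4 < Hn n ?v"
      using elim(3) elim(8)[rule_format, OF s(1)] \<delta> by (simp add: \<delta>_def)
    then obtain z where z: "cmod z = r" "z \<notin> of_real ` y n ` {1..n}" "L + \<delta> / 4 < Hn n z"
      using circle_exceeds[OF elim(7) elim(2) elim(10) r(1) elim(1)[symmetric] v(1) _ elim(4)] elim(9) v(2) by auto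
    \<comment> \<open>On a circle \<open>Hn\<close> depends on the real part only, so this convex
      combination of Re z and 0 can be taken on the upper semicircle wherever z lies.\<close>
    let ?z = "circle_point r ((1 - \<eta>) * Re z)"
    have Rez: "\<bar>(1 - \<eta>) * Re z\<bar> \<le> (1 - \<eta>) * r"
      using z(1) abs_Re_le_cmod[of z] \<eta> by (auto simp: abs_mult intro: mult_left_mono)
    also have "\<dots> < r" using \<eta> r by simp
    finally have lt: "\<bar>(1 - \<eta>) * Re z\<bar> < r" .
    have zK: "?z \<in> ?K"
      using Rez lt cmod_circle_point[of "(1 - \<eta>) * Re z" r] Im_circle_point_pos[OF lt]
      by (simp add: circle_point_def)
    have "(1 - \<eta>) * Hn n z + \<eta> * Hn n (Complex 0 r) \<le> Hn n ?z"
      using lt z \<eta> r by (intro Hn_concave[where r = r]) (auto simp: cmod_circle_point, auto simp: circle_point_def cmod_def complex_eq_iff)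
    moreover have "(1 - \<eta>) * (L + \<delta> / 4) \<le> (1 - \<eta>) * Hn n z"
      "\<eta> * (H (Complex 0 r) - 1) \<le> \<eta> * Hn n (Complex 0 r)"
      using z elim \<eta> by (auto intro!: mult_left_mono)
    ultimately have "L + \<delta> / 8 \<le> Hn n ?z" using mix by linarith
    moreover have "dist (Hn n ?z) (H ?z) < \<delta> / 8" using elim(6) zK by blast
    ultimately have "H w0 < H ?z" unfolding dist_real_def L_def by linarith
    then show ?case using zK by blast
  qed
  then obtain z where "z \<in> ?K" "H w0 < H z"
    using eventually_happens' sequentially_bot by blast
  then show thesis using Ksub by (intro that[of z]) auto
qed

text \<open>The modulus maps the set onto the interval I, by \<open>exceeds_H_w0\<close>; it is an
  open map, and its fibres are arcs, being images under \<open>circle_point\<close> of sets of real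
  parts that are convex by \<open>H_concave\<close>. An open map with connected fibres onto a
  connected set has a connected domain.\<close>

lemma connected_superlevel:
  assumes I: "open I" "connected I" "\<And>r. r \<in> I \<Longrightarrow> 0 < r \<and> r \<noteq> cmod w0"
  defines "S \<equiv> {z. 0 < Im z \<and> cmod z \<in> I \<and> H w0 < H z}"
  shows "open S" "connected S"
proof -
  have "open (cmod -` I)" by (intro open_vimage I continuous_intros)
  moreover have "open (H -` {H w0<..} \<inter> upper_halfplane)"
    using continuous_on_H by (simp add: continuous_on_open_vimage[OF open_upper_halfplane])
  ultimately have "open (cmod -` I \<inter> (H -` {H w0<..} \<inter> upper_halfplane))" by (rule open_Int)
  also have "cmod -` I \<inter> (H -` {H w0<..} \<inter> upper_halfplane) = S" by (auto simp: S_def)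
  finally show openS: "open S" .
  have "connected (S \<inter> cmod -` I)"
  proof (rule connected_open_monotone_preimage[where T = I])
    show "continuous_on S cmod" by (intro continuous_intros)
    show "cmod ` S = I"
    proof (intro equalityI subsetI)
      fix r assume r: "r \<in> I"
      then obtain z where "cmod z = r" "0 < Im z" "H w0 < H z" using exceeds_H_w0[of r] I(3) by blast
      then show "r \<in> cmod ` S" using r by (auto simp: S_def)
    qed (auto simp: S_def)
    show "openin (top_of_set I) (cmod ` C)" if "openin (top_of_set S) C" for C
    proof -
      have "open C" "C \<subseteq> S" using that openS by (auto simp: openin_open_eq)
      then show ?thesis
        using I(1) by (auto simp: openin_open_eq S_def intro!: open_cmod_image)
    qed
    show "connected (S \<inter> cmod -` {r})" if r: "r \<in> I" for r
    proof -
      define T where "T = {s. \<bar>s\<bar> < r \<and> H w0 < H (circle_point r s)}"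
      have "convex T"
        unfolding convex_alt
      proof (intro ballI allI impI)
        fix s1 s2 u assume s: "s1 \<in> T" "s2 \<in> T" and u: "0 \<le> u \<and> u \<le> (1::real)"
        let ?s = "(1 - u) *\<^sub>R s1 + u *\<^sub>R s2"
        have "\<bar>?s\<bar> \<le> (1 - u) * \<bar>s1\<bar> + u * \<bar>s2\<bar>"
          using u abs_triangle_ineq[of "(1 - u) * s1" "u * s2"] by (simp add: abs_mult)
        also have "\<dots> < r"
          using s u by (intro convex_bound_lt) (auto simp: T_def)
        finally have lt: "\<bar>?s\<bar> < r" .
        have "(1 - u) * H (circle_point r s1) + u * H (circle_point r s2) \<le> H (circle_point r ?s)"
          using s u lt by (intro H_concave[where r = r])
            (auto simp: T_def cmod_circle_point Im_circle_point_pos, auto simp: circle_point_def)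
        moreover have "H w0 < (1 - u) * H (circle_point r s1) + u * H (circle_point r s2)"
          using s u convex_bound_lt[of "- H (circle_point r s1)" "- H w0" "- H (circle_point r s2)" "1 - u" u]
          by (auto simp: T_def)
        ultimately show "?s \<in> T" using lt by (simp add: T_def)
      qed
      then have "connected (circle_point r ` T)"
        unfolding circle_point_def Complex_eq
        by (intro connected_continuous_image convex_connected) (auto intro!: continuous_intros)
      also have "circle_point r ` T = S \<inter> cmod -` {r}"
      proof (intro equalityI subsetI)
        fix z assume "z \<in> S \<inter> cmod -` {r}"
        then have z: "0 < Im z" "cmod z = r" "H w0 < H z" by (auto simp: S_def)
        moreover have "\<bar>Re z\<bar> < cmod z" using z(1) by (auto simp: cmod_def intro!: real_less_rsqrt)
        ultimately show "z \<in> circle_point r ` T"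
          using circle_point_Re[OF z(1)] by (intro image_eqI[of _ _ "Re z"]) (auto simp: T_def)
      qed (use r in \<open>auto simp: T_def S_def cmod_circle_point Im_circle_point_pos\<close>)
      finally show ?thesis .
    qed
  qed (use I in auto)
  also have "S \<inter> cmod -` I = S" by (auto simp: S_def)
  finally show "connected S" .
qed

end

text \<open>With p = \<epsilon>^2 / |u + i \<epsilon> - t|^2, the squared distance to t at height
  \<eta> divided by that at height \<epsilon> is the convex combination (1 - p) 1 + p (\<eta> /
  \<epsilon>)^2, and ln is concave. For \<eta> < \<epsilon> this limits how fast the logarithm can
  fall, even when t is very close to u.\<close>

lemma ln_cmod_vertical:
  assumes "0 < \<epsilon>" "0 < \<eta>"
  shows "ln (cmod (Complex u \<epsilon> - of_real t)) + \<epsilon>\<^sup>2 / (cmod (Complex u \<epsilon> - of_real t))\<^sup>2 * ln (\<eta> / \<epsilon>)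
    \<le> ln (cmod (Complex u \<eta> - of_real t))"
proof -
  have sq: "(cmod (Complex u s - of_real t))\<^sup>2 = (u - t)\<^sup>2 + s\<^sup>2" for s
    by (simp add: sq_cmod_minus_of_real)
  have pos: "0 < (cmod (Complex u s - of_real t))\<^sup>2" if "0 < s" for s
    using that unfolding sq by (simp add: add_nonneg_pos)
  have ln2: "ln (cmod v) = ln ((cmod v)\<^sup>2) / 2" for v
    by (cases "v = 0") (simp_all add: ln_realpow)
  define A where "A = (cmod (Complex u \<epsilon> - of_real t))\<^sup>2"
  define p where "p = \<epsilon>\<^sup>2 / A"
  have A: "0 < A" "\<epsilon>\<^sup>2 \<le> A" using pos[OF assms(1)] sq[of \<epsilon>] by (auto simp: A_def)
  then have p: "0 \<le> p" "p \<le> 1" by (auto simp: p_def)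
  have "(1 - p) * ln 1 + p * ln ((\<eta> / \<epsilon>)\<^sup>2) \<le> ln ((1 - p) * 1 + p * (\<eta> / \<epsilon>)\<^sup>2)"
    using concave_onD[OF ln_concave p, of 1 "(\<eta> / \<epsilon>)\<^sup>2"] assms by simp
  also have "(1 - p) * 1 + p * (\<eta> / \<epsilon>)\<^sup>2 = (cmod (Complex u \<eta> - of_real t))\<^sup>2 / A"
  proof -
    have "A = (u - t)\<^sup>2 + \<epsilon>\<^sup>2" by (simp add: A_def sq)
    then show ?thesis unfolding p_def sq[of \<eta>] using assms A
      by (simp add: divide_simps)
  qed
  also have "ln \<dots> = ln ((cmod (Complex u \<eta> - of_real t))\<^sup>2) - ln A"
    using A pos[OF assms(2)] by (intro ln_divide_pos) auto
  also have "ln ((\<eta> / \<epsilon>)\<^sup>2) = 2 * ln (\<eta> / \<epsilon>)"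
    using assms by (simp add: ln_realpow)
  finally have "ln A / 2 + p * ln (\<eta> / \<epsilon>) \<le> ln ((cmod (Complex u \<eta> - of_real t))\<^sup>2) / 2"
    by simp
  then show ?thesis unfolding ln2[of "Complex u \<epsilon> - of_real t"] ln2[of "Complex u \<eta> - of_real t"] p_def A_def .
qed

text \<open>A bound on the speed serves as C. It is independent of the integrand, which will vary
  with n while the path stays fixed.\<close>

lemma polynomial_path_bound:
  assumes "polynomial_function (p :: real \<Rightarrow> complex)"
  obtains C where "0 \<le> C" "\<And>f B. \<lbrakk>f contour_integrable_on p; 0 \<le> B; \<And>z. z \<in> path_image p \<Longrightarrow> cmod (f z) \<le> B\<rbrakk>
    \<Longrightarrow> cmod (contour_integral p f) \<le> C * B"
proof -
  obtain p' where p': "polynomial_function p'" "\<And>x. (p has_vector_derivative p' x) (at x)"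
    using has_vector_derivative_polynomial_function[OF assms] by blast
  have "compact (p' ` {0..1})"
    by (intro compact_continuous_image continuous_on_polymonial_function p') simp
  then obtain C where C: "\<forall>x\<in>{0..1}. cmod (p' x) \<le> C"
    using compact_imp_bounded[of "p' ` {0..1}"] unfolding bounded_iff by auto
  have "0 \<le> C" using order_trans[OF norm_ge_zero C[rule_format, of 0]] by simp
  show thesis
  proof (rule that[OF \<open>0 \<le> C\<close>])
    fix f B assume f: "f contour_integrable_on p" "0 \<le> B" "\<And>z. z \<in> path_image p \<Longrightarrow> cmod (f z) \<le> B"
    have "((\<lambda>x. f (p x) * p' x) has_integral contour_integral p f) {0..1}"
      using has_contour_integral_integral[OF f(1)]
      by (simp add: has_contour_integral vector_derivative_at[OF p'(2)])
    moreover have "cmod (f (p x) * p' x) \<le> C * B" if "x \<in> {0..1}" for x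
      using mult_mono[OF C[rule_format, OF that] f(3)[of "p x"] \<open>0 \<le> C\<close>] that
      by (simp add: norm_mult mult.commute path_image_def)
    ultimately show "cmod (contour_integral p f) \<le> C * B"
      using has_integral_bound[of "C * B" "\<lambda>x. f (p x) * p' x" "contour_integral p f" 0 1] f(2) \<open>0 \<le> C\<close>
      by (simp add: cbox_interval)
  qed
qed

context saddle_point
begin

lemma kernel_vertical_continuous: "0 < \<epsilon> \<Longrightarrow> continuous_on UNIV (\<lambda>t. \<epsilon>\<^sup>2 / (cmod (Complex 0 \<epsilon> - of_real t))\<^sup>2)"
  using minus_of_real_nonzero[of "Complex 0 \<epsilon>"] by (intro continuous_intros) auto

text \<open>As \<epsilon> tends to 0 the integral tends to the mass of the atom at 0. The integrand
  of \<open>w0_mass\<close> is positive everywhere and 1 at 0, so this mass is at most 1 - \<alpha>,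
  with equality only for a law concentrated at 0.\<close>

lemma small_mass:
  obtains \<epsilon> where "0 < \<epsilon>" "(\<integral>t. \<epsilon>\<^sup>2 / (cmod (Complex 0 \<epsilon> - of_real t))\<^sup>2 \<partial>\<nu>) < 1 - \<alpha>"
proof -
  let ?e = "\<lambda>k. inverse (real (Suc k))"
  let ?g = "\<lambda>e t. e\<^sup>2 / (cmod (Complex 0 e - of_real t))\<^sup>2"
  have g: "?g e t = e\<^sup>2 / (t\<^sup>2 + e\<^sup>2)" for e t :: real
    by (simp add: sq_cmod_minus_of_real)
  have "(\<lambda>k. \<integral>t. ?g (?e k) t \<partial>\<nu>) \<longlonglongrightarrow> (\<integral>t. indicat_real {0} t \<partial>\<nu>)"
  proof (rule integral_dominated_convergence[where w = "\<lambda>_. 1"])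
    show "AE t in \<nu>. (\<lambda>k. ?g (?e k) t) \<longlonglongrightarrow> indicat_real {0} t"
    proof (intro AE_I2)
      fix t :: real
      show "(\<lambda>k. ?g (?e k) t) \<longlonglongrightarrow> indicat_real {0} t"
      proof (cases "t = 0")
        case True
        show ?thesis unfolding g using True by simp
      next
        case False
        have "(\<lambda>k. (?e k)\<^sup>2 / (t\<^sup>2 + (?e k)\<^sup>2)) \<longlonglongrightarrow> 0\<^sup>2 / (t\<^sup>2 + 0\<^sup>2)"
          using False by (intro tendsto_intros LIMSEQ_inverse_real_of_nat) auto
        then show ?thesis using False by (simp add: g)
      qed
    qed
    show "?g (?e k) \<in> borel_measurable \<nu>" for k
      using integrable_continuous[OF kernel_vertical_continuous[of "?e k"]] by simp
    show "AE t in \<nu>. norm (?g (?e k) t) \<le> 1" for k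
      unfolding g by (intro AE_I2) (simp add: divide_le_eq sum_power2_gt_zero_iff)
  qed (auto simp: sets_\<nu>)
  moreover have "(\<integral>t. indicat_real {0} t \<partial>\<nu>) < 1 - \<alpha>"
  proof -
    let ?h = "\<lambda>t. (cmod w0)\<^sup>2 / (cmod (w0 - of_real t))\<^sup>2"
    have i: "integrable \<nu> ?h" by (intro integrable_continuous continuous_on_w0_kernels continuous_on_const)
    have i0: "integrable \<nu> (indicat_real {0})"
      using sets_\<nu> by (intro integrable_real_indicator) (auto simp: emeasure_eq_measure)
    have pos: "0 < ?h t" for t using w0 ne0[of t] by (auto simp: complex_eq_iff)
    have le: "indicat_real {0} t \<le> ?h t" for t
      using pos[of t] pos[of 0] w0 by (auto simp: indicator_def complex_eq_iff)
    have "(\<integral>t. ?h t - indicat_real {0} t \<partial>\<nu>) \<noteq> 0"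
    proof
      assume "(\<integral>t. ?h t - indicat_real {0} t \<partial>\<nu>) = 0"
      then have "AE t in \<nu>. ?h t - indicat_real {0} t = 0"
        using integral_nonneg_eq_0_iff_AE[of \<nu> "\<lambda>t. ?h t - indicat_real {0} t"] i i0 le by simp
      then have "AE t in \<nu>. t = 0"
      proof eventually_elim
        case (elim t)
        then show ?case using pos[of t] by (auto simp: indicator_def split: if_splits)
      qed
      then show False using nondegenerate by simp
    qed
    moreover have "0 \<le> (\<integral>t. ?h t - indicat_real {0} t \<partial>\<nu>)"
      using le by (intro integral_nonneg_AE) simp
    ultimately show ?thesis using w0_mass i i0 by simp
  qed
  ultimately have "\<forall>\<^sub>F k in sequentially. (\<integral>t. ?g (?e k) t \<partial>\<nu>) < 1 - \<alpha>"
    by (rule order_tendstoD(2))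
  then obtain k where "(\<integral>t. ?g (?e k) t \<partial>\<nu>) < 1 - \<alpha>"
    using eventually_happens' sequentially_bot by blast
  then show thesis by (intro that[of "?e k"]) auto
qed

lemma ln_kernel_integrable: "0 < Im z \<Longrightarrow> integrable \<nu> (\<lambda>t. ln (cmod (z - of_real t)))"
  using minus_of_real_nonzero[of z] by (intro integrable_continuous continuous_intros) auto

text \<open>\<open>ln_cmod_vertical\<close>, integrated with total weight P < 1 - \<alpha>, lets the
  logarithmic integral fall no faster than P ln \<eta>, while - (1 - \<alpha>) ln \<eta> grows
  faster. Hence \<open>H\<close> tends to infinity along the imaginary axis towards 0. The mass
  inequality is carried along because \<open>vertical_bound\<close> asks for it at the chosen
  height.\<close>

lemma H_near_0:
  assumes "0 < R"
  obtains \<epsilon> where "0 < \<epsilon>" "\<epsilon> < R" "H w0 < H (Complex 0 \<epsilon>)"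
    "(\<integral>t. \<epsilon>\<^sup>2 / (cmod (Complex 0 \<epsilon> - of_real t))\<^sup>2 \<partial>\<nu>) < 1 - \<alpha>"
proof -
  obtain e where e: "0 < e" "(\<integral>t. e\<^sup>2 / (cmod (Complex 0 e - of_real t))\<^sup>2 \<partial>\<nu>) < 1 - \<alpha>"
    by (rule small_mass)
  have i1: "integrable \<nu> (\<lambda>t. ln (cmod (Complex 0 e - of_real t)))"
    using e by (intro ln_kernel_integrable) simp
  have i2: "integrable \<nu> (\<lambda>t. e\<^sup>2 / (cmod (Complex 0 e - of_real t))\<^sup>2)"
    by (intro integrable_continuous kernel_vertical_continuous e)
  define P where "P = (\<integral>t. e\<^sup>2 / (cmod (Complex 0 e - of_real t))\<^sup>2 \<partial>\<nu>)"
  have low: "H (Complex 0 e) + (1 - \<alpha> - P) * ln (e / \<eta>) \<le> H (Complex 0 \<eta>)" if \<eta>: "0 < \<eta>" for \<eta>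
  proof -
    have "(\<integral>t. ln (cmod (Complex 0 e - of_real t)) + e\<^sup>2 / (cmod (Complex 0 e - of_real t))\<^sup>2 * ln (\<eta> / e) \<partial>\<nu>)
        \<le> (\<integral>t. ln (cmod (Complex 0 \<eta> - of_real t)) \<partial>\<nu>)"
    proof (rule integral_mono)
      show "integrable \<nu> (\<lambda>t. ln (cmod (Complex 0 e - of_real t)) + e\<^sup>2 / (cmod (Complex 0 e - of_real t))\<^sup>2 * ln (\<eta> / e))"
        by (intro Bochner_Integration.integrable_add integrable_mult_left i1 i2)
      show "integrable \<nu> (\<lambda>t. ln (cmod (Complex 0 \<eta> - of_real t)))"
        using \<eta> by (intro ln_kernel_integrable) simp
    qed (rule ln_cmod_vertical[OF e(1) \<eta>])
    also have "(\<integral>t. ln (cmod (Complex 0 e - of_real t)) + e\<^sup>2 / (cmod (Complex 0 e - of_real t))\<^sup>2 * ln (\<eta> / e) \<partial>\<nu>)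
        = (\<integral>t. ln (cmod (Complex 0 e - of_real t)) \<partial>\<nu>) + P * ln (\<eta> / e)"
      unfolding P_def
      by (subst Bochner_Integration.integral_add) (simp_all only: integrable_mult_left i1 i2 integral_mult_left_zero)
    finally show ?thesis using \<eta> e
      by (simp add: H_def ln_div algebra_simps cmod_def)
  qed
  have c: "0 < 1 - \<alpha> - P" using e by (simp add: P_def)
  have "LIM \<eta> at_right 0. H (Complex 0 e) + (1 - \<alpha> - P) * ln (e / \<eta>) :> at_top"
    using c e(1) by real_asymp
  then have "\<forall>\<^sub>F \<eta> in at_right 0. H w0 < H (Complex 0 e) + (1 - \<alpha> - P) * ln (e / \<eta>)"
    by (simp add: filterlim_at_top_dense)
  moreover have "\<forall>\<^sub>F \<eta> in at_right 0. 0 < \<eta> \<and> \<eta> < min R e"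
    using eventually_at_right_real[of 0 "min R e"] assms e by (auto elim: eventually_mono)
  ultimately have "\<forall>\<^sub>F \<eta> in at_right (0::real). 0 < \<eta> \<and> \<eta> < min R e \<and> H w0 < H (Complex 0 \<eta>)"
    by eventually_elim (use low in force)
  then obtain \<eta> where \<eta>: "0 < \<eta>" "\<eta> < R" "\<eta> < e" "H w0 < H (Complex 0 \<eta>)"
    using eventually_happens'[of "at_right (0::real)"] by (auto simp: trivial_limit_at_right_real)
  have "(\<integral>t. \<eta>\<^sup>2 / (cmod (Complex 0 \<eta> - of_real t))\<^sup>2 \<partial>\<nu>) \<le> P"
    unfolding P_def
  proof (intro integral_mono integrable_continuous kernel_vertical_continuous)
    fix t :: real
    have "\<eta>\<^sup>2 * (t\<^sup>2 + e\<^sup>2) \<le> e\<^sup>2 * (t\<^sup>2 + \<eta>\<^sup>2)"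
      using mult_right_mono[of "\<eta>\<^sup>2" "e\<^sup>2" "t\<^sup>2"] power_mono[of \<eta> e 2] \<eta> by (simp add: algebra_simps)
    then show "\<eta>\<^sup>2 / (cmod (Complex 0 \<eta> - of_real t))\<^sup>2 \<le> e\<^sup>2 / (cmod (Complex 0 e - of_real t))\<^sup>2"
      using \<eta> e by (simp add: sq_cmod_minus_of_real frac_le_eq divide_simps sum_power2_gt_zero_iff)
  qed (use \<eta> e in auto)
  with c have "(\<integral>t. \<eta>\<^sup>2 / (cmod (Complex 0 \<eta> - of_real t))\<^sup>2 \<partial>\<nu>) < 1 - \<alpha>" by linarith
  with \<eta> show thesis by (intro that[of \<eta>]) auto
qed

lemma H_imaginary_ge: "0 < \<eta> \<Longrightarrow> \<alpha> * ln \<eta> \<le> H (Complex 0 \<eta>)"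
proof -
  assume \<eta>: "0 < \<eta>"
  have "(\<integral>t. ln \<eta> \<partial>\<nu>) \<le> (\<integral>t. ln (cmod (Complex 0 \<eta> - of_real t)) \<partial>\<nu>)"
  proof (intro integral_mono ln_kernel_integrable)
    fix t
    have "\<eta> \<le> cmod (Complex 0 \<eta> - of_real t)"
      using abs_Im_le_cmod[of "Complex 0 \<eta> - of_real t"] by simp
    then show "ln \<eta> \<le> ln (cmod (Complex 0 \<eta> - of_real t))" using \<eta> by (intro ln_mono)
  qed (use \<eta> in auto)
  then show ?thesis using \<eta> by (simp add: H_def cmod_def prob_space algebra_simps)
qed

lemma superlevel_path:
  assumes I: "open I" "connected I" "\<And>r. r \<in> I \<Longrightarrow> 0 < r \<and> r \<noteq> cmod w0"
    and ab: "0 < Im z1" "cmod z1 \<in> I" "H w0 < H z1" "0 < Im z2" "cmod z2 \<in> I" "H w0 < H z2"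
  obtains p C where "valid_path p" "pathstart p = z1" "pathfinish p = z2"
    "\<And>z. z \<in> path_image p \<Longrightarrow> 0 < Im z \<and> cmod z \<in> I \<and> H w0 < H z"
    "0 \<le> C" "\<And>f B. \<lbrakk>f contour_integrable_on p; 0 \<le> B; \<And>z. z \<in> path_image p \<Longrightarrow> cmod (f z) \<le> B\<rbrakk>
      \<Longrightarrow> cmod (contour_integral p f) \<le> C * B"
proof -
  let ?S = "{z. 0 < Im z \<and> cmod z \<in> I \<and> H w0 < H z}"
  obtain p where p: "polynomial_function p" "path_image p \<subseteq> ?S" "pathstart p = z1" "pathfinish p = z2"
    using connected_open_polynomial_connected[OF connected_superlevel[OF I], of z1 z2] ab by auto
  obtain C where C: "0 \<le> C" "\<And>f B. \<lbrakk>f contour_integrable_on p; 0 \<le> B; \<And>z. z \<in> path_image p \<Longrightarrow> cmod (f z) \<le> B\<rbrakk>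
      \<Longrightarrow> cmod (contour_integral p f) \<le> C * B"
    by (rule polynomial_path_bound[OF p(1)]) blast
  show thesis
    by (rule that[OF valid_path_polynomial_function[OF p(1)] p(3,4) _ C]) (use p(2) in auto)
qed

end

subsection \<open>Estimates on the contours\<close>

text \<open>The two weakly singular weights of the estimates: e = 1/4 along the radial segment and e
  = 1/2 along the circle.\<close>

lemma has_integral_abs_powr:
  fixes a b c e :: real
  assumes "a \<le> c" "c \<le> b" "0 < e"
  shows "((\<lambda>x. \<bar>x - c\<bar> powr (e - 1)) has_integral ((c - a) powr e + (b - c) powr e) / e) {a..b}"
proof -
  have left: "((\<lambda>x. \<bar>x - c\<bar> powr (e - 1)) has_integral (- ((c - c) powr e / e) - - ((c - a) powr e / e))) {a..c}"
  proof (rule fundamental_theorem_of_calculus_interior)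
    show "continuous_on {a..c} (\<lambda>x. - ((c - x) powr e / e))"
      using assms by (intro continuous_intros continuous_on_powr') auto
    show "((\<lambda>x. - ((c - x) powr e / e)) has_vector_derivative \<bar>x - c\<bar> powr (e - 1)) (at x)" if "x \<in> {a<..<c}" for x
      unfolding has_real_derivative_iff_has_vector_derivative [symmetric]
      using that assms by (auto intro!: derivative_eq_intros simp: abs_if powr_diff)
  qed (rule assms)
  have right: "((\<lambda>x. \<bar>x - c\<bar> powr (e - 1)) has_integral ((b - c) powr e / e - (c - c) powr e / e)) {c..b}"
  proof (rule fundamental_theorem_of_calculus_interior)
    show "continuous_on {c..b} (\<lambda>x. (x - c) powr e / e)"
      using assms by (intro continuous_intros continuous_on_powr') auto
    show "((\<lambda>x. (x - c) powr e / e) has_vector_derivative \<bar>x - c\<bar> powr (e - 1)) (at x)" if "x \<in> {c<..<b}" for x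
      unfolding has_real_derivative_iff_has_vector_derivative [symmetric]
      using that assms by (auto intro!: derivative_eq_intros simp: abs_if powr_diff)
  qed (rule assms)
  show ?thesis
    using has_integral_combine[OF assms(1,2) left right] by (simp add: add_divide_distrib)
qed

lemma norm_integral_le_off_finite:
  fixes f :: "real \<Rightarrow> complex" and g :: "real \<Rightarrow> real"
  assumes f: "f integrable_on {a..b}" and g: "(g has_integral J) {a..b}" and "finite S"
    and le: "\<And>x. x \<in> {a..b} - S \<Longrightarrow> cmod (f x) \<le> g x"
  shows "cmod (integral {a..b} f) \<le> J"
proof -
  define g' where "g' x = (if x \<in> S then cmod (f x) else g x)" for x
  have "(g' has_integral J) {a..b}"
    by (rule has_integral_spike_finite[OF \<open>finite S\<close> _ g]) (auto simp: g'_def)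
  then have "cmod (integral {a..b} f) \<le> integral {a..b} g'"
    using le by (intro integral_norm_bound_integral f) (auto simp: g'_def)
  also have "integral {a..b} g' = J" using \<open>(g' has_integral J) {a..b}\<close> by (rule integral_unique)
  finally show ?thesis .
qed

lemma contour_integral_join_bound:
  assumes "valid_path g" "valid_path h" "pathfinish g = pathstart h"
    and S: "open S" "f holomorphic_on S" "path_image g \<subseteq> S" "path_image h \<subseteq> S"
    and "cmod (contour_integral g f) \<le> A" "cmod (contour_integral h f) \<le> B"
  shows "cmod (contour_integral (g +++ h) f) \<le> A + B"
proof -
  have "contour_integral (g +++ h) f = contour_integral g f + contour_integral h f"
    using assms by (intro contour_integral_join contour_integrable_holomorphic_simple[OF S(2,1)])
  then show ?thesis using assms norm_triangle_ineq[of "contour_integral g f" "contour_integral h f"] by simp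
qed

lemma not_of_real_if_Im_pos: "0 < Im z \<Longrightarrow> z \<notin> of_real ` A"
  by auto

text \<open>For x = n \<kappa> s^2 this trades Gaussian decay for \<open>n powr (-1/8)\<close> and
  \<open>|s| powr (-1/4)\<close>. Together with \<open>|s| powr (-1/2)\<close> from the distance to
  the circle the singularity \<open>|s| powr (-3/4)\<close> is integrable; any positive exponent
  below 1/4 in place of 1/8 would do the same.\<close>

lemma exp_minus_le_powr:
  fixes x :: real
  assumes "0 < x"
  shows "exp (- x) \<le> x powr (- (1 / 8))"
proof -
  have "x powr (1 / 8) \<le> exp x"
  proof (cases "x \<le> 1")
    case True
    then have "x powr (1 / 8) \<le> 1 powr (1 / 8)" using assms by (intro powr_mono2) auto
    also have "\<dots> \<le> exp x" using assms by simp
    finally show ?thesis .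
  next
    case False
    then have "x powr (1 / 8) \<le> x powr 1" by (intro powr_mono) auto
    also have "\<dots> \<le> exp x"
    proof -
      have "x \<le> exp x" using exp_ge_add_one_self[of x] by linarith
      then show ?thesis using assms by simp
    qed
    finally show ?thesis .
  qed
  then show ?thesis using assms by (simp add: exp_minus powr_minus)
qed

context saddle_point
begin

abbreviation G :: "nat \<Rightarrow> real \<Rightarrow> complex \<Rightarrow> complex" where
  "G n u \<equiv> pf_sum n (y n) (n - q n - 1) u"

text \<open>Replacing u by 0 costs a factor
  \<open>(1 + M / (n \<rho>)) ^ m \<le> exp (M / \<rho>)\<close>. Besides the potential one factor 1
  / |z| remains, because the numerator has exponent m = n - q n - 1, one less than the power of |z|
  in \<open>Hn\<close>.\<close>

lemma pf_sum_bound: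
  assumes n: "0 < n" "q n + 2 \<le> n" and M: "0 \<le> M" "\<bar>u\<bar> \<le> M / n" and \<rho>: "0 < \<rho>" "\<rho> \<le> cmod z"
    and z: "z \<notin> of_real ` y n ` {1..n}"
  shows "cmod (G n u z) \<le> exp (M / \<rho>) / \<rho> * exp (- (n * Hn n z))"
proof -
  define m where "m = n - q n - 1"
  have m: "0 < m" "m < n" "n - q n = Suc m" using n q[of n] by (auto simp: m_def)
  define t where "t = M / (n * \<rho>)"
  have t: "0 \<le> t" using n M \<rho> by (simp add: t_def)
  have z0: "z \<noteq> 0" "0 < cmod z" using \<rho> by auto
  have "cmod (z - of_real u) \<le> cmod z + \<bar>u\<bar>"
    using norm_triangle_ineq4[of z "of_real u"] by simp
  also have "\<bar>u\<bar> \<le> cmod z * t"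
  proof -
    have "M / n = \<rho> * t" using n \<rho> by (simp add: t_def)
    also have "\<dots> \<le> cmod z * t" using \<rho> t by (intro mult_right_mono)
    finally show ?thesis using M by linarith
  qed
  finally have "cmod (z - of_real u) \<le> cmod z * (1 + t)" by (simp add: algebra_simps)
  also have "\<dots> \<le> cmod z * exp t" by (intro mult_left_mono) (auto simp: exp_ge_add_one_self)
  finally have "cmod (z - of_real u) ^ m \<le> (cmod z * exp t) ^ m" by (intro power_mono) auto
  also have "\<dots> = cmod z ^ m * exp (m * t)" by (simp add: power_mult_distrib exp_of_nat_mult)
  also have "\<dots> \<le> cmod z ^ m * exp (M / \<rho>)"
  proof -
    have "m * t \<le> n * t" using m t by (intro mult_right_mono) auto
    also have "\<dots> = M / \<rho>" using n by (simp add: t_def)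
    finally show ?thesis by (intro mult_left_mono) auto
  qed
  finally have num: "cmod (z - of_real u) ^ m \<le> cmod z ^ m * exp (M / \<rho>)" .
  have "cmod (G n u z) = cmod (z - of_real u) ^ m / (exp (n * Hn n z) * cmod z ^ Suc m)"
    using pf_sum_eq[OF inj m(1,2) z, of u] cmod_node_poly_eq_exp[OF z z0(1) n(1)]
    by (simp add: norm_divide norm_power m(3) flip: m_def)
  also have "\<dots> \<le> cmod z ^ m * exp (M / \<rho>) / (exp (n * Hn n z) * cmod z ^ Suc m)"
    using num z0 by (intro divide_right_mono) auto
  also have "\<dots> = exp (M / \<rho>) / cmod z * exp (- (n * Hn n z))"
    using z0 by (simp add: exp_minus field_simps)
  also have "\<dots> \<le> exp (M / \<rho>) / \<rho> * exp (- (n * Hn n z))"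
    using \<rho> z0 by (intro mult_right_mono divide_left_mono) auto
  finally show ?thesis .
qed

text \<open>\<open>circle_maximum\<close> bounds the numerator by its value at the critical point,
  so the estimate covers the whole circle including its real points. Replacing v by 0 costs
  \<open>exp (2 M / \<rho>)\<close>, and the last power of the denominator, at least \<rho> / 2,
  gives the factor 2 / \<rho>.\<close>

lemma weight_bound:
  assumes F: "Fn n wn = 0" "0 < Im wn" "0 < n" and n: "q n + 2 \<le> n"
    and M: "0 \<le> M" "\<bar>v\<bar> \<le> M / n" "M / n \<le> \<rho> / 2" and \<rho>: "0 < \<rho>" "\<rho> \<le> cmod wn" and w: "cmod w = cmod wn"
  shows "cmod (node_poly n (y n) w) / cmod (w - of_real v) ^ (n - q n + 1)
    \<le> 2 * exp (2 * M / \<rho>) / \<rho> * exp (n * Hn n wn)"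
proof -
  define N where "N = n - q n"
  have N: "N \<le> n" by (simp add: N_def)
  define t where "t = M / (n * \<rho>)"
  have t: "0 \<le> t" "t \<le> 1 / 2" using F M \<rho> by (auto simp: t_def divide_simps mult.commute)
  have R: "0 < cmod wn" using \<rho> by auto
  have "- 2 * t \<le> - t - 2 * t\<^sup>2"
    using mult_left_mono[OF t(2), of t] t by (simp add: power2_eq_square)
  also have "\<dots> \<le> ln (1 - t)" using t by (intro ln_one_minus_pos_lower_bound) auto
  finally have "exp (- 2 * t) \<le> 1 - t" using t by (simp add: ln_ge_iff)
  have "M / n = \<rho> * t" using F \<rho> by (simp add: t_def)
  also have "\<dots> \<le> cmod w * t" using \<rho> t w by (intro mult_right_mono) auto
  finally have "\<bar>v\<bar> \<le> cmod w * t" using M by linarith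
  then have low: "cmod wn * (1 - t) \<le> cmod (w - of_real v)"
    using norm_triangle_ineq2[of w "of_real v"] w by (simp add: algebra_simps)
  then have "cmod wn * exp (- 2 * t) \<le> cmod (w - of_real v)"
    using mult_left_mono[OF \<open>exp (- 2 * t) \<le> 1 - t\<close>, of "cmod wn"] R by linarith
  then have "(cmod wn * exp (- 2 * t)) ^ N \<le> cmod (w - of_real v) ^ N" by (intro power_mono) auto
  moreover have "cmod wn ^ N * exp (- (2 * M / \<rho>)) \<le> (cmod wn * exp (- 2 * t)) ^ N"
  proof -
    have "N * t \<le> n * t" using N t by (intro mult_right_mono) auto
    also have "\<dots> = M / \<rho>" using F by (simp add: t_def)
    finally have "- (2 * M / \<rho>) \<le> N * (- 2 * t)" by simp
    then show ?thesis unfolding power_mult_distrib exp_of_nat_mult [symmetric] by (intro mult_left_mono) auto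
  qed
  ultimately have 1: "cmod wn ^ N * exp (- (2 * M / \<rho>)) \<le> cmod (w - of_real v) ^ N" by linarith
  have "\<rho> / 2 \<le> cmod wn * (1 - t)"
    using mult_mono[OF \<rho>(2), of "1 / 2" "1 - t"] t R by simp
  then have 2: "\<rho> / 2 \<le> cmod (w - of_real v)" using low by linarith
  have den: "cmod wn ^ N * exp (- (2 * M / \<rho>)) * (\<rho> / 2) \<le> cmod (w - of_real v) ^ (N + 1)"
    using mult_mono[OF 1 2] \<rho> by (simp add: mult.commute)
  have "wn \<notin> of_real ` y n ` {1..n}" "wn \<noteq> 0" using F by auto
  then have "cmod (node_poly n (y n) w) \<le> exp (n * Hn n wn) * cmod wn ^ N"
    using circle_maximum[OF F w] cmod_node_poly_eq_exp[of wn n] F by (simp add: N_def)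
  then have "cmod (node_poly n (y n) w) / cmod (w - of_real v) ^ (N + 1)
      \<le> exp (n * Hn n wn) * cmod wn ^ N / (cmod wn ^ N * exp (- (2 * M / \<rho>)) * (\<rho> / 2))"
    using den R \<rho> by (intro frac_le) auto
  also have "\<dots> = 2 * exp (2 * M / \<rho>) / \<rho> * exp (n * Hn n wn)"
    using R by (simp add: exp_minus field_simps)
  finally show ?thesis by (simp add: N_def)
qed

text \<open>At height \<eta> above u the numerator of \<open>G\<close> has modulus
  \<open>\<eta> ^ m\<close>. By \<open>ln_cmod_vertical\<close> the node polynomial shrinks no
  faster than \<eta> / \<epsilon> to the power given by the left side of \<open>mass\<close>, which
  is at most m. So \<open>G\<close> is dominated by its value at the top of the segment, however
  close the nodes are to u.\<close>

lemma vertical_bound: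
  assumes n: "0 < n" "q n + 2 \<le> n" and \<eta>: "0 < \<eta>" "\<eta> \<le> \<epsilon>"
    and mass: "n * mean n (y n) (\<lambda>t. \<epsilon>\<^sup>2 / (cmod (Complex u \<epsilon> - of_real t))\<^sup>2) \<le> real (n - q n - 1)"
  shows "cmod (G n u (Complex u \<eta>)) \<le> cmod (G n u (Complex u \<epsilon>))"
proof -
  define m where "m = n - q n - 1"
  have m: "0 < m" "m < n" using n q[of n] by (auto simp: m_def)
  have \<epsilon>: "0 < \<epsilon>" using \<eta> by simp
  let ?p = "\<lambda>t. \<epsilon>\<^sup>2 / (cmod (Complex u \<epsilon> - of_real t))\<^sup>2"
  have notN: "Complex u s \<notin> of_real ` y n ` {1..n}" if "0 < s" for s
    using that by (auto simp: complex_eq_iff)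
  have P: "cmod (node_poly n (y n) (Complex u s)) = exp (\<Sum>i=1..n. ln (cmod (Complex u s - of_real (y n i))))"
    if "0 < s" for s
    using cmod_minus_of_real_pos[of "Complex u s"] that by (simp add: cmod_node_poly exp_sum)
  have "(\<Sum>i=1..n. ?p (y n i)) \<le> m" using mass n by (simp add: mean_def m_def)
  moreover have "ln (\<eta> / \<epsilon>) \<le> 0" using \<eta> by simp
  ultimately have "m * ln (\<eta> / \<epsilon>) \<le> (\<Sum>i=1..n. ?p (y n i)) * ln (\<eta> / \<epsilon>)"
    by (rule mult_right_mono_neg)
  moreover have "(\<Sum>i=1..n. ln (cmod (Complex u \<epsilon> - of_real (y n i)))) + (\<Sum>i=1..n. ?p (y n i)) * ln (\<eta> / \<epsilon>)
      \<le> (\<Sum>i=1..n. ln (cmod (Complex u \<eta> - of_real (y n i))))"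
    unfolding sum_distrib_right sum.distrib [symmetric]
    by (intro sum_mono ln_cmod_vertical \<epsilon> \<eta>)
  ultimately have "exp ((\<Sum>i=1..n. ln (cmod (Complex u \<epsilon> - of_real (y n i)))) + m * ln (\<eta> / \<epsilon>))
      \<le> exp (\<Sum>i=1..n. ln (cmod (Complex u \<eta> - of_real (y n i))))"
    by simp
  also have "exp (m * ln (\<eta> / \<epsilon>)) = (\<eta> / \<epsilon>) ^ m"
    using \<eta> \<epsilon> by (simp add: exp_of_nat_mult)
  then have "exp ((\<Sum>i=1..n. ln (cmod (Complex u \<epsilon> - of_real (y n i)))) + m * ln (\<eta> / \<epsilon>))
      = cmod (node_poly n (y n) (Complex u \<epsilon>)) * (\<eta> / \<epsilon>) ^ m"
    by (simp add: exp_add P[OF \<epsilon>])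
  finally have le: "cmod (node_poly n (y n) (Complex u \<epsilon>)) * (\<eta> / \<epsilon>) ^ m \<le> cmod (node_poly n (y n) (Complex u \<eta>))"
    by (simp add: P[OF \<eta>(1)])
  have G: "cmod (G n u (Complex u s)) = s ^ m / cmod (node_poly n (y n) (Complex u s))" if "0 < s" for s
  proof -
    have "Complex u s - of_real u = of_real s * \<i>" by (simp add: complex_eq_iff)
    then show ?thesis
      unfolding m_def [symmetric] pf_sum_eq[OF inj m notN[OF that]] using that
      by (simp add: norm_divide norm_power norm_mult power_mult_distrib)
  qed
  have pos: "0 < cmod (node_poly n (y n) (Complex u \<epsilon>))" by (simp add: P[OF \<epsilon>])
  have "\<eta> ^ m / cmod (node_poly n (y n) (Complex u \<eta>)) \<le> \<eta> ^ m / (cmod (node_poly n (y n) (Complex u \<epsilon>)) * (\<eta> / \<epsilon>) ^ m)"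
    using le \<eta> \<epsilon> pos by (intro divide_left_mono mult_pos_pos) (auto simp: P)
  also have "\<dots> = \<epsilon> ^ m / cmod (node_poly n (y n) (Complex u \<epsilon>))"
    using \<eta> \<epsilon> pos by (simp add: power_divide field_simps)
  finally show ?thesis unfolding G[OF \<epsilon>] G[OF \<eta>(1)] .
qed

text \<open>On the segment \<open>z = wn + s wn\<close> the distance to a point \<open>w\<close> of the circle through \<open>wn\<close> is at least the
  geometric mean of \<open>|wn| |s|\<close> and \<open>|w - wn| / 2\<close>, which keeps the double integral over the two
  crossing contours absolutely convergent.\<close>

lemma near_bound:
  assumes F: "0 < Im wn" "0 < n" and n: "q n + 2 \<le> n"
    and M: "0 \<le> M" "\<bar>u\<bar> \<le> M / n" and \<rho>: "0 < \<rho>" "\<rho> \<le> cmod wn * (1 - \<sigma>)" and \<sigma>: "0 < \<sigma>" "\<sigma> < 1" and \<kappa>: "0 < \<kappa>"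
    and w: "cmod w = cmod wn" "w \<noteq> wn"
    and rad: "\<And>s. \<bar>s\<bar> \<le> \<sigma> \<Longrightarrow> Hn n wn + \<kappa> * s\<^sup>2 \<le> Hn n (wn + of_real s * wn)"
    and int: "(\<lambda>z. G n u z / (w - z)) contour_integrable_on linepath (wn + of_real (- \<sigma>) * wn) (wn + of_real \<sigma> * wn)"
  shows "cmod (contour_integral (linepath (wn + of_real (- \<sigma>) * wn) (wn + of_real \<sigma> * wn)) (\<lambda>z. G n u z / (w - z)))
    \<le> 16 * (exp (M / \<rho>) / \<rho>) * exp (- (n * Hn n wn)) * (n * \<kappa>) powr (- (1 / 8))
        * sqrt (2 * cmod wn) * cmod (w - wn) powr (- (1 / 2))"
proof -
  let ?a = "wn + of_real (- \<sigma>) * wn" and ?b = "wn + of_real \<sigma> * wn"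
  let ?f = "\<lambda>z. G n u z / (w - z)"
  define s where "s x = \<sigma> * (2 * x - 1)" for x
  define D where "D = exp (M / \<rho>) / \<rho> * exp (- (n * Hn n wn))"
  define K where "K = D * (n * \<kappa>) powr (- (1 / 8)) * sqrt (2 / (cmod wn * cmod (w - wn)))"
  have R: "0 < cmod wn" using F by auto
  have D: "0 \<le> D" using \<rho> by (simp add: D_def)
  have line: "linepath ?a ?b x = wn + of_real (s x) * wn" for x
    by (simp add: linepath_def s_def scaleR_conv_of_real algebra_simps)
  have int': "(\<lambda>x. ?f (linepath ?a ?b x) * (?b - ?a)) integrable_on {0..1}"
    "contour_integral (linepath ?a ?b) ?f = integral {0..1} (\<lambda>x. ?f (linepath ?a ?b x) * (?b - ?a))"
    using has_contour_integral_integral[OF int] unfolding has_contour_integral_linepath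
    by (auto simp: integral_unique integrable_on_def)
  have pointwise: "cmod (?f (linepath ?a ?b x) * (?b - ?a)) \<le> 2 * cmod wn * K * \<bar>x - 1 / 2\<bar> powr (1 / 4 - 1)"
    if x: "x \<in> {0..1} - {1 / 2}" for x
  proof -
    let ?z = "wn + of_real (s x) * wn"
    have s: "\<bar>s x\<bar> \<le> \<sigma>" "s x \<noteq> 0" "\<bar>s x\<bar> = 2 * \<sigma> * \<bar>x - 1 / 2\<bar>"
    proof -
      have "\<bar>2 * x - 1\<bar> \<le> 1" using x by auto
      then show "\<bar>s x\<bar> \<le> \<sigma>" using \<sigma> mult_left_mono[of "\<bar>2 * x - 1\<bar>" 1 \<sigma>] by (simp add: s_def abs_mult)
      show "s x \<noteq> 0" using x \<sigma> by (auto simp: s_def)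
      have "\<bar>2 * x - 1\<bar> = 2 * \<bar>x - 1 / 2\<bar>" by (auto simp: abs_if)
      then show "\<bar>s x\<bar> = 2 * \<sigma> * \<bar>x - 1 / 2\<bar>" using \<sigma> unfolding s_def abs_mult by simp
    qed
    have z: "?z = of_real (1 + s x) * wn" by (simp add: algebra_simps)
    have s1: "1 - \<sigma> \<le> 1 + s x" "0 < 1 + s x" using abs_le_D2[OF s(1)] \<sigma> by linarith+
    have cz: "cmod ?z = cmod wn * (1 + s x)" unfolding z norm_mult using s1 by (simp del: of_real_add)
    have imz: "0 < Im ?z" unfolding z using s1 F by (simp del: of_real_add)
    have "\<rho> \<le> cmod ?z" unfolding cz using \<rho>(2) mult_left_mono[OF s1(1), of "cmod wn"] by simp
    then have "cmod (G n u ?z) \<le> exp (M / \<rho>) / \<rho> * exp (- (n * Hn n ?z))"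
      by (intro pf_sum_bound F n M \<rho> not_of_real_if_Im_pos imz)
    also have "\<dots> \<le> exp (M / \<rho>) / \<rho> * exp (- (n * Hn n wn) - n * \<kappa> * (s x)\<^sup>2)"
      using mult_left_mono[OF rad[OF s(1)], of n] \<rho> by (intro mult_left_mono) (auto simp: algebra_simps)
    also have "\<dots> = D * exp (- (n * \<kappa> * (s x)\<^sup>2))"
      by (simp add: D_def exp_diff exp_minus field_simps)
    also have "\<dots> \<le> D * (n * \<kappa> * (s x)\<^sup>2) powr (- (1 / 8))"
      using s F \<kappa> D by (intro mult_left_mono exp_minus_le_powr) auto
    also have "(n * \<kappa> * (s x)\<^sup>2) powr (- (1 / 8)) = (n * \<kappa>) powr (- (1 / 8)) * \<bar>s x\<bar> powr (- (1 / 4))"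
    proof -
      have "(s x)\<^sup>2 = \<bar>s x\<bar> powr 2" using s(2) by simp
      then show ?thesis using F \<kappa> by (simp only: powr_mult powr_powr) simp
    qed
    finally have G_le: "cmod (G n u ?z) \<le> D * ((n * \<kappa>) powr (- (1 / 8)) * \<bar>s x\<bar> powr (- (1 / 4)))" .
    have "cmod wn * \<bar>s x\<bar> \<le> cmod (w - ?z)"
      using norm_triangle_ineq3[of w ?z] unfolding cz w(1) by (simp add: algebra_simps abs_mult flip: abs_mult)
    \<comment> \<open>From the first bound, because z has distance |wn| |s| from wn.\<close>
    moreover have "cmod (w - wn) / 2 \<le> cmod (w - ?z)"
      using norm_triangle_ineq[of "w - ?z" "of_real (s x) * wn"] calculation
      by (simp add: norm_mult mult.commute)
    ultimately have "(cmod wn * \<bar>s x\<bar>) * (cmod (w - wn) / 2) \<le> (cmod (w - ?z))\<^sup>2"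
      unfolding power2_eq_square by (intro mult_mono) auto
    then have le1: "sqrt (cmod wn * \<bar>s x\<bar> * (cmod (w - wn) / 2)) \<le> cmod (w - ?z)"
      by (intro real_le_lsqrt) auto
    have pos1: "0 < sqrt (cmod wn * \<bar>s x\<bar> * (cmod (w - wn) / 2))"
      using R s(2) w(2) by simp
    have "1 / cmod (w - ?z) \<le> 1 / sqrt (cmod wn * \<bar>s x\<bar> * (cmod (w - wn) / 2))"
      by (rule frac_le[OF zero_le_one order_refl pos1 le1])
    also have "\<dots> = sqrt (2 / (cmod wn * cmod (w - wn))) * \<bar>s x\<bar> powr (- (1 / 2))"
      using R s(2) w(2) by (simp add: real_sqrt_mult real_sqrt_divide powr_minus powr_half_sqrt field_simps)
    finally have inv: "1 / cmod (w - ?z) \<le> sqrt (2 / (cmod wn * cmod (w - wn))) * \<bar>s x\<bar> powr (- (1 / 2))" .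
    have "cmod (?f ?z) = cmod (G n u ?z) * (1 / cmod (w - ?z))" by (simp add: norm_divide)
    also have "\<dots> \<le> D * ((n * \<kappa>) powr (- (1 / 8)) * \<bar>s x\<bar> powr (- (1 / 4))) *
        (sqrt (2 / (cmod wn * cmod (w - wn))) * \<bar>s x\<bar> powr (- (1 / 2)))"
      using D by (intro mult_mono[OF G_le inv]) auto
    also have "\<dots> = K * (\<bar>s x\<bar> powr (- (1 / 4)) * \<bar>s x\<bar> powr (- (1 / 2)))" by (simp add: K_def)
    also have "\<bar>s x\<bar> powr (- (1 / 4)) * \<bar>s x\<bar> powr (- (1 / 2)) = \<bar>s x\<bar> powr (- (3 / 4))"
      by (simp flip: powr_add)
    finally have f_le: "cmod (?f ?z) \<le> K * \<bar>s x\<bar> powr (- (3 / 4))" .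
    have ba: "cmod (?b - ?a) = 2 * \<sigma> * cmod wn"
    proof -
      have "?b - ?a = of_real (2 * \<sigma>) * wn" by (simp add: algebra_simps)
      then show ?thesis using \<sigma> by (simp only: norm_mult norm_of_real)
    qed
    have "cmod (?f ?z * (?b - ?a)) \<le> K * \<bar>s x\<bar> powr (- (3 / 4)) * (2 * \<sigma> * cmod wn)"
      unfolding norm_mult[of "?f ?z"] ba using f_le \<sigma> by (intro mult_right_mono) auto
    also have "\<bar>s x\<bar> powr (- (3 / 4)) = (2 * \<sigma>) powr (- (3 / 4)) * \<bar>x - 1 / 2\<bar> powr (- (3 / 4))"
      unfolding s(3) using \<sigma> by (intro powr_mult)
    also have "K * ((2 * \<sigma>) powr (- (3 / 4)) * \<bar>x - 1 / 2\<bar> powr (- (3 / 4))) * (2 * \<sigma> * cmod wn)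
        = (cmod wn * K * \<bar>x - 1 / 2\<bar> powr (- (3 / 4))) * ((2 * \<sigma>) * (2 * \<sigma>) powr (- (3 / 4)))"
      by simp
    also have "(2 * \<sigma>) * (2 * \<sigma>) powr (- (3 / 4)) = (2 * \<sigma>) powr (1 / 4)"
      using \<sigma> powr_add[of "2 * \<sigma>" 1 "- (3 / 4)"] by simp
    also have "(cmod wn * K * \<bar>x - 1 / 2\<bar> powr (- (3 / 4))) * (2 * \<sigma>) powr (1 / 4)
        \<le> (cmod wn * K * \<bar>x - 1 / 2\<bar> powr (- (3 / 4))) * 2"
    proof (intro mult_left_mono)
      have "(2 * \<sigma>) powr (1 / 4) \<le> 2 powr (1 / 4)" using \<sigma> by (intro powr_mono2) auto
      also have "\<dots> \<le> 2 powr 1" by (intro powr_mono) auto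
      finally show "(2 * \<sigma>) powr (1 / 4) \<le> 2" by simp
      show "0 \<le> cmod wn * K * \<bar>x - 1 / 2\<bar> powr (- (3 / 4))" using D by (simp add: K_def)
    qed
    finally show ?thesis unfolding line by (simp add: mult_ac)
  qed
  have "((\<lambda>x. 2 * cmod wn * K * \<bar>x - 1 / 2\<bar> powr (1 / 4 - 1)) has_integral
      2 * cmod wn * K * (((1 / 2 - 0) powr (1 / 4) + (1 - 1 / 2) powr (1 / 4)) / (1 / 4))) {0..1}"
    by (intro has_integral_mult_right has_integral_abs_powr) auto
  then have "cmod (contour_integral (linepath ?a ?b) ?f) \<le>
      2 * cmod wn * K * (((1 / 2 - 0) powr (1 / 4) + (1 - 1 / 2) powr (1 / 4)) / (1 / 4))"
    unfolding int'(2) by (rule norm_integral_le_off_finite[OF int'(1) _ _ pointwise, where S = "{1 / 2}"]) auto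
  also have "\<dots> \<le> 2 * cmod wn * K * 8"
  proof (intro mult_left_mono)
    have "(1 / 2) powr (1 / 4) \<le> 1 powr (1 / 4 :: real)" by (intro powr_mono2) auto
    then show "((1 / 2 - 0) powr (1 / 4) + (1 - 1 / 2) powr (1 / 4)) / (1 / 4) \<le> (8::real)" by simp
    show "0 \<le> 2 * cmod wn * K" using D by (simp add: K_def)
  qed
  also have "2 * cmod wn * K * 8 = 16 * D * (n * \<kappa>) powr (- (1 / 8)) * (cmod wn * sqrt (2 / (cmod wn * cmod (w - wn))))"
    by (simp add: K_def)
  also have "cmod wn * sqrt (2 / (cmod wn * cmod (w - wn))) = sqrt (2 * cmod wn) * cmod (w - wn) powr (- (1 / 2))"
  proof -
    have "sqrt (cmod wn) * sqrt (cmod wn) = cmod wn" by simp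
    then show ?thesis using R w
      by (simp add: real_sqrt_mult real_sqrt_divide powr_minus powr_half_sqrt field_simps)
  qed
  finally show ?thesis by (simp add: D_def mult_ac)
qed

end

section \<open>Winding numbers on the circle and assembly of the z-contour\<close>

lemma connected_circle_arc:
  assumes "0 < R" "\<bar>c\<bar> < R"
  shows "connected {z. cmod z = R \<and> c < Re z}"
proof -
  define \<theta> where "\<theta> = arccos (c / R)"
  have cR: "- 1 \<le> c / R" "c / R \<le> 1" using assms by (auto simp: field_simps abs_less_iff)
  have \<theta>: "0 \<le> \<theta>" "\<theta> \<le> pi" "R * cos \<theta> = c"
    using cR arccos_bounded[OF cR] assms by (auto simp: \<theta>_def)
  have "connected ((\<lambda>t. of_real R * cis t) ` {- \<theta><..<\<theta>})"
    by (intro connected_continuous_image continuous_intros) auto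
  also have "(\<lambda>t. of_real R * cis t) ` {- \<theta><..<\<theta>} = {z. cmod z = R \<and> c < Re z}"
  proof (intro equalityI subsetI)
    fix z assume "z \<in> (\<lambda>t. of_real R * cis t) ` {- \<theta><..<\<theta>}"
    then obtain t where t: "z = of_real R * cis t" "t \<in> {- \<theta><..<\<theta>}" by blast
    then have t: "z = of_real R * cis t" "\<bar>t\<bar> < \<theta>" by (auto simp: abs_less_iff)
    have "cos \<theta> < cos \<bar>t\<bar>" using t \<theta> by (intro cos_monotone_0_pi) auto
    then show "z \<in> {z. cmod z = R \<and> c < Re z}"
      using t assms \<theta>(3) by (auto simp: norm_mult)
  next
    fix z assume z: "z \<in> {z. cmod z = R \<and> c < Re z}"
    have eq: "z = of_real R * cis (Arg z)"
      using z rcis_cmod_Arg[of z] by (simp add: rcis_def)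
    then have "Re z = R * cos \<bar>Arg z\<bar>" by (metis Re_complex_of_real Re_of_real_times cis.sel(1) cos_abs_real)
    then have "cos \<theta> < cos \<bar>Arg z\<bar>" using z \<theta>(3) assms by auto
    moreover have "\<bar>Arg z\<bar> \<le> pi" using Arg_bounded[of z] by (auto simp: abs_le_iff)
    ultimately have "\<bar>Arg z\<bar> < \<theta>" using \<theta> by (meson abs_ge_zero cos_mono_less_eq)
    then show "z \<in> (\<lambda>t. of_real R * cis t) ` {- \<theta><..<\<theta>}"
      using eq by (intro image_eqI[of _ _ "Arg z"]) (auto simp: abs_less_iff)
  qed
  finally show ?thesis .
qed

text \<open>Meant for the vertical segment above \<open>u\<close>, where
  \<open>vertical_bound\<close> applies at positive heights only.\<close>

lemma contour_integral_bound_linepath_off_start: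
  assumes int: "f contour_integrable_on linepath a b" and "a \<noteq> b"
    and le: "\<And>z. z \<in> closed_segment a b - {a} \<Longrightarrow> cmod (f z) \<le> K"
  shows "cmod (contour_integral (linepath a b) f) \<le> K * cmod (b - a)"
proof -
  let ?g = "\<lambda>x. f (linepath a b x) * (b - a)"
  have I: "(?g has_integral contour_integral (linepath a b) f) {0..1}"
    using has_contour_integral_integral[OF int] by (simp add: has_contour_integral_linepath)
  have J: "((\<lambda>x. K * cmod (b - a)) has_integral K * cmod (b - a)) {0..1::real}"
    using has_integral_const_real[of "K * cmod (b - a)" 0 1] by simp
  have "cmod (integral {0..1} ?g) \<le> K * cmod (b - a)"
  proof (rule norm_integral_le_off_finite[OF _ J, of _ "{0}"])
    fix x :: real assume x: "x \<in> {0..1} - {0}"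
    then have "linepath a b x \<in> closed_segment a b" using linepath_in_path[of x a b] by simp
    moreover have "linepath a b x - a = x *\<^sub>R (b - a)" by (simp add: linepath_def algebra_simps)
    then have "linepath a b x \<noteq> a" using x \<open>a \<noteq> b\<close> by auto
    ultimately show "cmod (?g x) \<le> K * cmod (b - a)"
      unfolding norm_mult by (intro mult_right_mono le) auto
  qed (use I in \<open>auto simp: integrable_on_def\<close>)
  then show ?thesis unfolding integral_unique[OF I] .
qed

context upper_path
begin

lemma winding_number_real:
  assumes "x \<noteq> u" "x < B" "of_real x \<notin> path_image double"
  shows "winding_number double (of_real x) = (if u < x then - 1 else 0)"
proof -
  let ?I = "contour_integral \<gamma> (\<lambda>z. 1 / (z - of_real x))"
  have "2 * pi * \<i> * winding_number double (of_real x) = ?I - cnj ?I"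
    using contour_integral_double[OF assms(3)] by simp
  also have "\<dots> = 2 * pi * \<i> * (if u < x then - 1 else 0)"
    by (rule complex_eqI) (simp_all add: Im_contour_integral_Cauchy_kernel[OF assms(1,2)])
  finally show ?thesis by (simp split: if_splits)
qed

text \<open>The doubled contour meets the circle at most in w and \<open>cnj w\<close>, so its
  winding number is constant on the open arcs to the right and to the left of them and can be read
  off at the real points R and - R.\<close>

lemma winding_number_circle:
  assumes R: "\<bar>u\<bar> < R" "R < B" and w: "cmod w = R" "0 < Im w" "path_image \<gamma> \<inter> sphere 0 R \<subseteq> {w}"
    and v: "cmod v = R" "0 \<le> Im v" "v \<noteq> w"
  shows "v \<notin> path_image double" "winding_number double v = (if Re w < Re v then - 1 else 0)"
proof -
  have meet: "z = w \<or> z = cnj w" if "z \<in> path_image double" "cmod z = R" for z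
    using that w(3) unfolding path_image_double by fastforce
  show v': "v \<notin> path_image double"
    using meet[of v] v w by auto
  have ReR: "\<bar>Re w\<bar> < R"
  proof -
    have "\<bar>Re w\<bar>\<^sup>2 < R\<^sup>2" using w(2) unfolding w(1)[symmetric] cmod_power2 by simp
    then show ?thesis by (rule power2_less_imp_less) (use R in auto)
  qed
  have Rv: "Re v \<noteq> Re w"
  proof
    assume "Re v = Re w"
    then have "(Im v)\<^sup>2 = (Im w)\<^sup>2" using v w by (metis add_left_cancel cmod_power2)
    then have "Im v = Im w" using v w by (simp add: power2_eq_iff_nonneg)
    then show False using \<open>Re v = Re w\<close> v by (simp add: complex_eq_iff)
  qed
  have const: "winding_number double v = winding_number double z"
    if "connected S" "S \<inter> path_image double = {}" "v \<in> S" "z \<in> S" for S z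
    using winding_number_constant[OF valid_path_imp_path[OF valid_double] closed_double that(1,2)] that(3,4)
    unfolding constant_on_def by metis
  show "winding_number double v = (if Re w < Re v then - 1 else 0)"
  proof (cases "Re w < Re v")
    case True
    let ?S = "{z. cmod z = R \<and> Re w < Re z}"
    have S: "?S \<inter> path_image double = {}" using meet by fastforce
    have R0: "0 < R" "Re w < R" "- R < Re w" using R ReR by (auto simp: abs_less_iff)
    have m: "of_real R \<in> ?S" using R0 by simp
    have "winding_number double v = winding_number double (of_real R)"
      by (rule const[OF connected_circle_arc[OF R0(1) ReR] S]) (use True v(1) m in simp_all)
    also have "\<dots> = - 1"
    proof -
      have "of_real R \<notin> path_image double" using S m by blast
      moreover have "u < R" using R(1) by linarith
      ultimately show ?thesis using winding_number_real[of R] R(2) by simp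
    qed
    finally show ?thesis using True by simp
  next
    case False
    let ?S = "uminus ` {z. cmod z = R \<and> - Re w < Re z}"
    have mem: "z \<in> ?S \<longleftrightarrow> cmod z = R \<and> Re z < Re w" for z
    proof
      assume "cmod z = R \<and> Re z < Re w"
      then show "z \<in> ?S" by (intro image_eqI[of _ _ "- z"]) auto
    qed auto
    have S: "?S \<inter> path_image double = {}"
    proof (rule equals0I)
      fix z assume z: "z \<in> ?S \<inter> path_image double"
      then have "cmod z = R \<and> Re z < Re w" by (intro mem[THEN iffD1]) (rule IntD1)
      moreover from this have "z = w \<or> z = cnj w" using z by (intro meet) (simp_all only: Int_iff)
      ultimately show False by auto
    qed
    have R0: "0 < R" "- R < Re w" using R ReR by (auto simp: abs_less_iff)
    have "\<bar>- Re w\<bar> < R" using ReR by simp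
    then have conn: "connected ?S"
      by (intro connected_continuous_image continuous_intros connected_circle_arc R0)
    have m: "of_real (- R) \<in> ?S" unfolding mem using R0 by simp
    have "v \<in> ?S" unfolding mem using v(1) False Rv by simp
    then have "winding_number double v = winding_number double (of_real (- R))"
      by (rule const[OF conn S _ m])
    also have "\<dots> = 0"
    proof -
      have "of_real (- R) \<notin> path_image double" using S m by blast
      moreover have "- R < u" using R(1) by linarith
      ultimately show ?thesis using winding_number_real[of "- R"] R(2) R0 by simp
    qed
    finally show ?thesis using False by simp
  qed
qed

end

context saddle_point
begin

lemma pf_sum_holomorphic:
  assumes "\<And>j. \<lbrakk>j \<in> {1..n}; x j \<noteq> u\<rbrakk> \<Longrightarrow> of_real (x j) \<notin> S"
  shows "pf_sum n x m u holomorphic_on S"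
proof -
  have "z - of_real (x j) \<noteq> 0" if "z \<in> S" "j \<in> {1..n}" "x j \<noteq> u" for z j
    using assms that by auto
  then show ?thesis unfolding pf_sum_def[abs_def] by (intro holomorphic_intros) auto
qed

text \<open>The contour goes up from u to height \<epsilon>, over to i \<epsilon>, along the fixed
  path p1, through the critical point on the ray, along the fixed path p2 to i B, and down to B.
  Outside the ray every piece keeps distance d in modulus from the circle and its integrand is
  governed by the level L. In the first constant \<epsilon>, C1, C2 and 2 B come from the vertical
  piece, the two paths and the last segment, and 3 from the connecting segments, each of length at
  most 1.\<close>

lemma contour_bound:
  fixes p1 p2 :: "real \<Rightarrow> complex" and n :: nat and L d u M B \<epsilon> \<rho> \<sigma> \<kappa> C1 C2 :: real
  assumes n: "0 < n" "q n + 2 \<le> n" and wn: "0 < Im wn"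
    and M: "0 \<le> M" "\<bar>u\<bar> \<le> M / n" and \<rho>: "0 < \<rho>" "\<rho> \<le> cmod wn * (1 - \<sigma>)" and \<sigma>: "0 < \<sigma>" "\<sigma> < 1" and \<kappa>: "0 < \<kappa>"
    and rad: "\<And>s. \<bar>s\<bar> \<le> \<sigma> \<Longrightarrow> Hn n wn + \<kappa> * s\<^sup>2 \<le> Hn n (wn + of_real s * wn)"
    and p1: "valid_path p1" "pathstart p1 = Complex 0 \<epsilon>" "pathfinish p1 = z1"
      "0 \<le> C1" "\<And>f b. \<lbrakk>f contour_integrable_on p1; 0 \<le> b; \<And>z. z \<in> path_image p1 \<Longrightarrow> cmod (f z) \<le> b\<rbrakk>
      \<Longrightarrow> cmod (contour_integral p1 f) \<le> C1 * b"
    and p2: "valid_path p2" "pathstart p2 = z2" "pathfinish p2 = Complex 0 B"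
      "0 \<le> C2" "\<And>f b. \<lbrakk>f contour_integrable_on p2; 0 \<le> b; \<And>z. z \<in> path_image p2 \<Longrightarrow> cmod (f z) \<le> b\<rbrakk>
      \<Longrightarrow> cmod (contour_integral p2 f) \<le> C2 * b"
    and K1: "closed_segment (Complex u \<epsilon>) (Complex 0 \<epsilon>) \<subseteq> K1" "path_image p1 \<subseteq> K1"
      "closed_segment z1 (wn + of_real (- \<sigma>) * wn) \<subseteq> K1"
      "\<And>z. z \<in> K1 \<Longrightarrow> 0 < Im z \<and> \<rho> \<le> cmod z \<and> cmod z + d \<le> cmod wn \<and> L \<le> Hn n z"
    and K2: "closed_segment (wn + of_real \<sigma> * wn) z2 \<subseteq> K2" "path_image p2 \<subseteq> K2"
      "\<And>z. z \<in> K2 \<Longrightarrow> 0 < Im z \<and> \<rho> \<le> cmod z \<and> cmod wn + d \<le> cmod z \<and> L \<le> Hn n z"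
    and B: "Y < B" "0 < B" "\<And>z. z \<in> closed_segment (Complex 0 B) (of_real B) \<Longrightarrow>
       \<rho> \<le> cmod z \<and> cmod wn + d \<le> cmod z \<and> L \<le> Hn n z"
    and \<epsilon>: "0 < \<epsilon>" "\<bar>u\<bar> + \<epsilon> + d \<le> cmod wn" and d: "0 < d"
    and mass: "n * mean n (y n) (\<lambda>t. \<epsilon>\<^sup>2 / (cmod (Complex u \<epsilon> - of_real t))\<^sup>2) \<le> real (n - q n - 1)"
    and len: "\<bar>u\<bar> \<le> 1" "cmod (wn + of_real (- \<sigma>) * wn - z1) \<le> 1" "cmod (z2 - (wn + of_real \<sigma> * wn)) \<le> 1"
  obtains \<gamma> where "upper_path \<gamma> u B" "path_image \<gamma> \<inter> sphere 0 (cmod wn) \<subseteq> {wn}"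
    "\<And>v. \<lbrakk>cmod v = cmod wn; v \<noteq> wn\<rbrakk> \<Longrightarrow> cmod (contour_integral \<gamma> (\<lambda>z. G n u z / (v - z))) \<le>
        (\<epsilon> + C1 + C2 + 2 * B + 3) * (exp (M / \<rho>) / \<rho> * exp (- (n * L)) / d)
        + 16 * (exp (M / \<rho>) / \<rho>) * exp (- (n * Hn n wn)) * (n * \<kappa>) powr (- (1 / 8))
          * sqrt (2 * cmod wn) * cmod (v - wn) powr (- (1 / 2))"
proof -
  let ?a0 = "complex_of_real u" and ?a1 = "Complex u \<epsilon>" and ?a2 = "Complex 0 \<epsilon>"
  let ?a3 = "wn + of_real (- \<sigma>) * wn" and ?a4 = "wn + of_real \<sigma> * wn"
  let ?b = "Complex 0 B"
  define l1 l2 l4 l5 l6 l8 where "l1 = linepath ?a0 ?a1" and "l2 = linepath ?a1 ?a2"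
    and "l4 = linepath z1 ?a3" and "l5 = linepath ?a3 ?a4" and "l6 = linepath ?a4 z2"
    and "l8 = linepath ?b (complex_of_real B)"
  note l_defs = l1_def l2_def l4_def l5_def l6_def l8_def
  define \<gamma> where "\<gamma> = l1 +++ (l2 +++ (p1 +++ (l4 +++ (l5 +++ (l6 +++ (p2 +++ l8))))))"
  have ends: "pathstart p1 = ?a2" "pathfinish p1 = z1" "pathstart p2 = z2" "pathfinish p2 = ?b"
    using p1 p2 by auto
  have valid: "valid_path \<gamma>"
    unfolding \<gamma>_def l_defs using p1(1) p2(1) ends by (intro valid_path_join) auto
  have l1_img: "\<exists>\<eta>. 0 \<le> \<eta> \<and> \<eta> \<le> \<epsilon> \<and> z = Complex u \<eta>" if z: "z \<in> path_image l1" for z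
  proof -
    obtain t where t: "0 \<le> t" "t \<le> 1" "z = (1 - t) *\<^sub>R ?a0 + t *\<^sub>R ?a1"
      using z unfolding l1_def path_image_linepath closed_segment_def by blast
    have "z = Complex u (t * \<epsilon>)" using t(3) by (simp add: complex_eq_iff algebra_simps)
    then show ?thesis using t \<epsilon> mult_right_mono[OF t(2), of \<epsilon>] by (intro exI[of _ "t * \<epsilon>"]) auto
  qed
  have l5_img: "\<exists>s. \<bar>s\<bar> \<le> \<sigma> \<and> z = of_real (1 + s) * wn" if z: "z \<in> path_image l5" for z
  proof -
    obtain t where t: "0 \<le> t" "t \<le> 1" "z = (1 - t) *\<^sub>R ?a3 + t *\<^sub>R ?a4"
      using z unfolding l5_def path_image_linepath closed_segment_def by blast
    have "z = of_real (1 + \<sigma> * (2 * t - 1)) * wn" using t(3) by (simp add: scaleR_conv_of_real algebra_simps)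
    moreover have "\<bar>2 * t - 1\<bar> \<le> 1" using t by auto
    then have "\<bar>\<sigma> * (2 * t - 1)\<bar> \<le> \<sigma>" using \<sigma> mult_left_mono[of "\<bar>2 * t - 1\<bar>" 1 \<sigma>] by (simp add: abs_mult)
    ultimately show ?thesis by blast
  qed
  have l8_img: "z = of_real B \<or> 0 < Im z" if z: "z \<in> path_image l8" for z
  proof -
    obtain t where t: "0 \<le> t" "t \<le> 1" "z = (1 - t) *\<^sub>R ?b + t *\<^sub>R of_real B"
      using z unfolding l8_def path_image_linepath closed_segment_def by blast
    show ?thesis
    proof (cases "t = 1")
      case False
      then have "0 < (1 - t) * B" using t B by (intro mult_pos_pos) auto
      then show ?thesis using t(3) by simp
    qed (use t in simp)
  qed
  have img: "path_image \<gamma> = path_image l1 \<union> (path_image l2 \<union> (path_image p1 \<union> (path_image l4 \<union> (path_image l5 \<union>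
      (path_image l6 \<union> (path_image p2 \<union> path_image l8))))))"
    unfolding \<gamma>_def l_defs using ends by (simp add: path_image_join)
  have seg: "path_image l2 \<subseteq> K1" "path_image l4 \<subseteq> K1" "path_image l6 \<subseteq> K2"
    using K1 K2 by (simp_all add: l_defs)
  have l5_facts: "0 < Im z" "cmod z = cmod wn \<Longrightarrow> z = wn" if z: "z \<in> path_image l5" for z
  proof -
    obtain s where s: "\<bar>s\<bar> \<le> \<sigma>" "z = of_real (1 + s) * wn" using l5_img[OF z] by blast
    have s1: "0 < 1 + s" using abs_le_D2[OF s(1)] \<sigma> by linarith
    show "0 < Im z" unfolding s(2) using s1 wn by (simp del: of_real_add)
    have "cmod z = (1 + s) * cmod wn" unfolding s(2) norm_mult using s1 by (simp del: of_real_add)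
    moreover have "0 < cmod wn" using wn by auto
    ultimately show "z = wn" if "cmod z = cmod wn" using that s(2) by simp
  qed
  have im: "0 < Im z \<or> z = of_real u \<or> z = of_real B" if z: "z \<in> path_image \<gamma>" for z
  proof -
    have "0 < Im z \<or> z = of_real u" if "z \<in> path_image l1"
      using l1_img[OF that] by (auto simp: complex_eq_iff less_le)
    moreover have "0 < Im z" if "z \<in> K1 \<union> K2" using that K1(4) K2(3) by blast
    moreover have "z \<in> K1 \<union> K2" if "z \<in> path_image l2 \<union> path_image p1 \<union> path_image l4 \<union> path_image l6 \<union> path_image p2"
      using that seg K1(2) K2(2) by blast
    ultimately show ?thesis using z l5_facts(1)[of z] l8_img[of z] unfolding img by blast
  qed
  have upper: "upper_path \<gamma> u B"
  proof
    show "path_image \<gamma> \<subseteq> {z. 0 < Im z} \<union> {complex_of_real u, complex_of_real B}" using im by blast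
  qed (use valid in \<open>auto simp: \<gamma>_def l_defs\<close>)
  have far_mod: "d \<le> \<bar>cmod z - cmod wn\<bar>"
    if z: "z \<in> path_image l1 \<or> z \<in> K1 \<or> z \<in> K2 \<or> z \<in> path_image l8" for z
  proof -
    have "d \<le> \<bar>cmod z - cmod wn\<bar>" if z: "z \<in> path_image l1"
    proof -
      obtain \<eta> where \<eta>: "0 \<le> \<eta>" "\<eta> \<le> \<epsilon>" "z = Complex u \<eta>" using l1_img[OF z] by blast
      have "cmod z \<le> \<bar>u\<bar> + \<eta>" using cmod_le[of z] \<eta> by simp
      then show ?thesis using \<eta> \<epsilon> by linarith
    qed
    moreover have "d \<le> \<bar>cmod z - cmod wn\<bar>" if "z \<in> K1" using K1(4)[OF that] by linarith
    moreover have "d \<le> \<bar>cmod z - cmod wn\<bar>" if "z \<in> K2" using K2(3)[OF that] by linarith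
    moreover have "d \<le> \<bar>cmod z - cmod wn\<bar>" if "z \<in> path_image l8"
      using B(3)[of z] that by (simp add: l8_def) linarith
    ultimately show ?thesis using z by blast
  qed
  have meet: "path_image \<gamma> \<inter> sphere 0 (cmod wn) \<subseteq> {wn}"
  proof
    fix z assume z: "z \<in> path_image \<gamma> \<inter> sphere 0 (cmod wn)"
    then have cz: "cmod z = cmod wn" by simp
    then have "\<not> (z \<in> path_image l1 \<or> z \<in> K1 \<or> z \<in> K2 \<or> z \<in> path_image l8)"
      using far_mod[of z] d by auto
    then have "z \<in> path_image l5" using z seg K1(2) K2(2) unfolding img by blast
    then show "z \<in> {wn}" using l5_facts(2)[OF _ cz] by simp
  qed
  show thesis
  proof (rule that[OF upper meet])
    fix v assume v: "cmod v = cmod wn" "v \<noteq> wn"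
    let ?f = "\<lambda>z. G n u z / (v - z)"
    \<comment> \<open>A node at \<open>u\<close> is not removed: \<open>pf_sum\<close> omits it, so
      the integrand is holomorphic at the starting point of the contour.\<close>
    define S where "S = - ({v} \<union> of_real ` {y n j | j. j \<in> {1..n} \<and> y n j \<noteq> u})"
    have "finite {y n j | j. j \<in> {1..n} \<and> y n j \<noteq> u}" by simp
    then have openS: "open S" unfolding S_def by (intro open_Compl finite_imp_closed) auto
    have hol: "?f holomorphic_on S"
      by (intro holomorphic_intros pf_sum_holomorphic) (auto simp: S_def)
    have sub: "path_image \<gamma> \<subseteq> S"
    proof
      fix z assume z: "z \<in> path_image \<gamma>"
      have "z \<noteq> v" using meet z v by auto
      moreover have "z \<noteq> of_real (y n j)" if "j \<in> {1..n}" "y n j \<noteq> u" for j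
        using im[OF z] nodes[OF that(1)] that(2) B(1) by auto
      ultimately show "z \<in> S" by (auto simp: S_def)
    qed
    have sub': "path_image l1 \<subseteq> S" "path_image l2 \<subseteq> S" "path_image p1 \<subseteq> S" "path_image l4 \<subseteq> S"
      "path_image l5 \<subseteq> S" "path_image l6 \<subseteq> S" "path_image p2 \<subseteq> S" "path_image l8 \<subseteq> S"
      using sub unfolding img by auto
    have int: "?f contour_integrable_on g" if "valid_path g" "path_image g \<subseteq> S" for g
      using contour_integrable_holomorphic_simple[OF hol openS that] .
    define D where "D = exp (M / \<rho>) / \<rho> * exp (- (n * L))"
    have D: "0 \<le> D" "0 \<le> D / d" using \<rho> d by (auto simp: D_def)
    have dist: "d \<le> cmod (v - z)" if "d \<le> \<bar>cmod z - cmod wn\<bar>" for z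
      using that norm_triangle_ineq3[of v z] v by (simp add: abs_minus_commute)
    have frac: "cmod (?f z) \<le> D / d" if "cmod (G n u z) \<le> D" "d \<le> \<bar>cmod z - cmod wn\<bar>" for z
      unfolding norm_divide using that dist[OF that(2)] d D by (intro frac_le) auto
    have G_le: "cmod (G n u z) \<le> D" if "\<rho> \<le> cmod z" "L \<le> Hn n z" "z \<notin> of_real ` y n ` {1..n}" for z
    proof -
      have "cmod (G n u z) \<le> exp (M / \<rho>) / \<rho> * exp (- (n * Hn n z))"
        by (intro pf_sum_bound n M \<rho>(1) that)
      also have "\<dots> \<le> D"
        unfolding D_def using mult_left_mono[OF that(2), of "real n"] \<rho> by (intro mult_left_mono) auto
      finally show ?thesis .
    qed
    have K1_le: "cmod (?f z) \<le> D / d" if "z \<in> K1" for z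
      using K1(4)[OF that] far_mod[of z] that by (intro frac G_le not_of_real_if_Im_pos) auto
    have K2_le: "cmod (?f z) \<le> D / d" if "z \<in> K2" for z
      using K2(3)[OF that] far_mod[of z] that by (intro frac G_le not_of_real_if_Im_pos) auto
    have l8_le: "cmod (?f z) \<le> D / d" if z: "z \<in> closed_segment ?b (of_real B)" for z
    proof (intro frac G_le)
      show "z \<notin> of_real ` y n ` {1..n}"
        using l8_img[of z] z B(1) nodes[of _ n] by (fastforce simp: l8_def)
    qed (use B(3)[OF z] far_mod[of z] z in \<open>auto simp: l8_def\<close>)
    have l1_le: "cmod (?f z) \<le> D / d" if z: "z \<in> closed_segment ?a0 ?a1 - {?a0}" for z
    proof -
      obtain \<eta> where \<eta>: "0 \<le> \<eta>" "\<eta> \<le> \<epsilon>" "z = Complex u \<eta>" using l1_img[of z] z by (auto simp: l1_def)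
      then have "0 < \<eta>" using z by (cases "\<eta> = 0") (auto simp: complex_eq_iff)
      \<comment> \<open>No lower bound for the potential is known on the vertical piece, but its top
        lies in \<open>K1\<close> and dominates it.\<close>
      have "?a1 \<in> K1" using K1(1) by auto
      then have "cmod (G n u ?a1) \<le> D"
        using K1(4)[OF \<open>?a1 \<in> K1\<close>] by (intro G_le not_of_real_if_Im_pos) (simp_all only:)
      then have "cmod (G n u z) \<le> D"
        using vertical_bound[OF n \<open>0 < \<eta>\<close> \<eta>(2) mass] unfolding \<eta>(3) by linarith
      then show ?thesis using z far_mod[of z] by (intro frac) (auto simp: l1_def)
    qed
    have b1: "cmod (contour_integral l1 ?f) \<le> D / d * \<epsilon>"
    proof -
      have "cmod (contour_integral l1 ?f) \<le> D / d * cmod (?a1 - ?a0)"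
        unfolding l1_def
        by (rule contour_integral_bound_linepath_off_start[OF _ _ l1_le])
          (use int[of l1] sub' \<epsilon> in \<open>auto simp: l1_def complex_eq_iff\<close>)
      also have "cmod (?a1 - ?a0) = \<epsilon>" using \<epsilon> by (simp add: cmod_def)
      finally show ?thesis .
    qed
    have seg_bound: "cmod (contour_integral (linepath a c) ?f) \<le> D / d * 1"
      if "path_image (linepath a c) \<subseteq> S" "closed_segment a c \<subseteq> K1 \<or> closed_segment a c \<subseteq> K2" "cmod (c - a) \<le> 1" for a c
    proof -
      have "cmod (contour_integral (linepath a c) ?f) \<le> D / d * cmod (c - a)"
        using that K1_le K2_le D by (intro contour_integral_bound_linepath int) auto
      also have "\<dots> \<le> D / d * 1" using that D by (intro mult_left_mono) auto
      finally show ?thesis .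
    qed
    have b2: "cmod (contour_integral l2 ?f) \<le> D / d * 1"
      unfolding l2_def using K1(1) sub' len(1)
      by (intro seg_bound) (auto simp: l_defs cmod_def)
    have b3: "cmod (contour_integral p1 ?f) \<le> C1 * (D / d)"
      using K1_le K1(2) D by (intro p1(5) int p1(1) sub') auto
    have b4: "cmod (contour_integral l4 ?f) \<le> D / d * 1"
      unfolding l4_def by (rule seg_bound) (use K1(3) sub' len in \<open>auto simp: l_defs\<close>)
    have b5: "cmod (contour_integral l5 ?f) \<le> 16 * (exp (M / \<rho>) / \<rho>) * exp (- (n * Hn n wn)) * (n * \<kappa>) powr (- (1 / 8))
          * sqrt (2 * cmod wn) * cmod (v - wn) powr (- (1 / 2))"
      unfolding l5_def
      by (rule near_bound[OF wn n M \<rho> \<sigma> \<kappa> v rad]) (use int[of l5] sub' in \<open>auto simp: l5_def\<close>)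
    have b6: "cmod (contour_integral l6 ?f) \<le> D / d * 1"
      unfolding l6_def by (rule seg_bound) (use K2(1) sub' len in \<open>auto simp: l_defs\<close>)
    have b7: "cmod (contour_integral p2 ?f) \<le> C2 * (D / d)"
      using K2_le K2(2) D by (intro p2(5) int p2(1) sub') auto
    have b8: "cmod (contour_integral l8 ?f) \<le> D / d * (2 * B)"
    proof -
      have "cmod (contour_integral l8 ?f) \<le> D / d * cmod (of_real B - ?b)"
        unfolding l8_def using l8_le D int[of l8] sub' by (intro contour_integral_bound_linepath) (auto simp: l8_def)
      also have "\<dots> \<le> D / d * (2 * B)"
        using norm_triangle_ineq4[of "of_real B" ?b] B(2) D by (intro mult_left_mono) (auto simp: cmod_def)
      finally show ?thesis .
    qed
    let ?near = "16 * (exp (M / \<rho>) / \<rho>) * exp (- (n * Hn n wn)) * (n * \<kappa>) powr (- (1 / 8))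
          * sqrt (2 * cmod wn) * cmod (v - wn) powr (- (1 / 2))"
    have "cmod (contour_integral \<gamma> ?f) \<le> D / d * \<epsilon> + (D / d * 1 + (C1 * (D / d) + (D / d * 1 + (?near + (D / d * 1 + (C2 * (D / d) + D / d * (2 * B)))))))"
      unfolding \<gamma>_def
      by (intro contour_integral_join_bound[where S = S] valid_path_join openS hol b1 b2 b3 b4 b5 b6 b7 b8 sub' p1(1) p2(1))
        (use sub' ends in \<open>auto simp: l_defs path_image_join\<close>)
    also have "\<dots> = (\<epsilon> + C1 + C2 + 2 * B + 3) * (D / d) + ?near" by (simp add: algebra_simps)
    finally show "cmod (contour_integral \<gamma> ?f) \<le> (\<epsilon> + C1 + C2 + 2 * B + 3) * (exp (M / \<rho>) / \<rho> * exp (- (n * L)) / d) + ?near"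
      by (simp add: D_def)
  qed
qed

end

section \<open>Choice of the constants and the error term\<close>

lemma compact_gap:
  fixes f :: "complex \<Rightarrow> real"
  assumes "compact K" "continuous_on K f" "\<And>z. z \<in> K \<Longrightarrow> a < f z"
  obtains \<eta> where "0 < \<eta>" "\<And>z. z \<in> K \<Longrightarrow> a + \<eta> \<le> f z"
proof (cases "K = {}")
  case False
  then obtain z0 where z0: "z0 \<in> K" "\<And>z. z \<in> K \<Longrightarrow> f z0 \<le> f z"
    using continuous_attains_inf[OF assms(1) _ assms(2)] by blast
  then show thesis using assms(3)[OF z0(1)] by (intro that[of "f z0 - a"]) auto
qed (use that[of 1] in auto)

context node_limit
begin

lemma mean_tendsto_at:
  fixes k :: "complex \<Rightarrow> real \<Rightarrow> real"
  assumes cont: "continuous_on (upper_halfplane \<times> UNIV) (\<lambda>(z, t). k z t)" and z: "z \<longlonglongrightarrow> v" "0 < Im v"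
  shows "(\<lambda>n. mean n (y n) (k (z n))) \<longlonglongrightarrow> (\<integral>t. k v t \<partial>\<nu>)"
proof -
  obtain r where r: "0 < r" "cball v r \<subseteq> upper_halfplane"
    using open_contains_cball open_upper_halfplane z(2) by (metis mem_Collect_eq)
  let ?J = "\<lambda>z. \<integral>t. k z t \<partial>\<nu>"
  have "isCont ?J v"
    using continuous_on_integral_real[OF open_upper_halfplane cont] open_upper_halfplane z(2)
    by (simp add: continuous_on_eq_continuous_at)
  then have "(\<lambda>n. ?J (z n)) \<longlonglongrightarrow> ?J v" by (rule isCont_tendsto_compose[OF _ z(1)])
  moreover have "(\<lambda>n. mean n (y n) (k (z n)) - ?J (z n)) \<longlonglongrightarrow> 0"
  proof (rule tendstoI)
    fix e :: real assume "0 < e"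
    have "continuous_on (cball v r \<times> UNIV) (\<lambda>(z, t). k z t)"
      using r by (intro continuous_on_subset[OF cont]) auto
    then have "\<forall>\<^sub>F n in sequentially. \<forall>z\<in>cball v r. dist (mean n (y n) (k z)) (?J z) < e"
      by (rule uniform_limitD[OF mean_uniform_limit_real[OF compact_cball] \<open>0 < e\<close>])
    moreover have "\<forall>\<^sub>F n in sequentially. dist (z n) v < r"
      using z(1) r(1) by (rule tendstoD)
    ultimately show "\<forall>\<^sub>F n in sequentially. dist (mean n (y n) (k (z n)) - ?J (z n)) 0 < e"
    proof eventually_elim
      case (elim n)
      then have "z n \<in> cball v r" by (simp add: dist_commute)
      with elim(1) show ?case by (simp add: dist_real_def)
    qed
  qed
  ultimately show ?thesis using tendsto_add by fastforce
qed

end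

context saddle_point
begin

lemma outer_segment:
  assumes z: "z \<in> closed_segment (Complex 0 B) (of_real B)" and B: "0 < B"
  shows "B / 2 \<le> cmod z"
proof -
  obtain t where t: "0 \<le> t" "t \<le> 1" "z = (1 - t) *\<^sub>R Complex 0 B + t *\<^sub>R of_real B"
    using z unfolding closed_segment_def by blast
  have "B = t * B + (1 - t) * B" by (simp add: algebra_simps)
  also have "t * B \<le> cmod z" using abs_Re_le_cmod[of z] t(3) by simp
  also have "(1 - t) * B \<le> cmod z" using abs_Im_le_cmod[of z] t(3) by simp
  finally show ?thesis by simp
qed

text \<open>All nodes satisfy |t| \<le> Y \<le> B / 4 \<le> |z| / 2, so |z - t| \<ge> |z| / 2; the
  bound thus holds down to the real axis and grows with B because 1 - b n stays away from 0.\<close>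

lemma Hn_outer:
  assumes n: "0 < n" and z: "B / 2 \<le> cmod z" and B: "4 * Y \<le> B" "2 < B" and b: "\<alpha> / 2 \<le> 1 - b n"
  shows "\<alpha> / 2 * ln (B / 2) - ln 2 \<le> Hn n z"
proof -
  have zp: "0 < cmod z" using z B by linarith
  have "ln (cmod z / 2) \<le> ln (cmod (z - of_real (y n i)))" if "i \<in> {1..n}" for i
  proof -
    have "cmod z / 2 \<le> cmod z - \<bar>y n i\<bar>" using nodes[OF that] z B by linarith
    also have "\<dots> \<le> cmod (z - of_real (y n i))"
      using norm_triangle_ineq2[of z "of_real (y n i)"] by simp
    finally show ?thesis using zp by (intro ln_mono) auto
  qed
  then have "mean n (y n) (\<lambda>t. ln (cmod z / 2)) \<le> mean n (y n) (\<lambda>t. ln (cmod (z - of_real t)))"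
    by (rule mean_mono)
  then have "ln (cmod z) - ln 2 \<le> mean n (y n) (\<lambda>t. ln (cmod (z - of_real t)))"
    using n zp by (simp add: mean_const ln_div)
  moreover have "\<alpha> / 2 * ln (B / 2) \<le> (1 - b n) * ln (cmod z)"
    using b z B \<alpha> zp by (intro mult_mono ln_mono) auto
  ultimately show ?thesis by (simp add: Hn_def algebra_simps)
qed

text \<open>What is left of the weighted integrand on the circle after the residue has been removed
  to the right of w n. It is o(1) except for the singularity \<open>|z - w n| powr (-1/2)\<close> of
  the crossing, which is integrable along the circle.\<close>

lemma error_bound:
  fixes u v :: "nat \<Rightarrow> real"
  assumes w: "w \<longlonglongrightarrow> w0" "\<forall>\<^sub>F n in sequentially. Fn n (w n) = 0"
    and M: "0 \<le> M" "\<And>n. 0 < n \<Longrightarrow> \<bar>u n\<bar> \<le> M / n" "\<And>n. 0 < n \<Longrightarrow> \<bar>v n\<bar> \<le> M / n"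
  obtains e where "e \<longlonglongrightarrow> 0" "\<forall>\<^sub>F n in sequentially. \<forall>z. cmod z = cmod (w n) \<and> 0 \<le> Im z \<and> z \<noteq> w n \<and> z \<notin> of_real ` y n ` {1..n} \<longrightarrow>
      cmod (upper_interpolant n (y n) (n - q n - 1) (u n) z - of_bool (Re (w n) < Re z) * (z - of_real (u n)) ^ (n - q n - 1))
        / cmod (z - of_real (v n)) ^ (n - q n + 1) \<le> e n * (1 + cmod (z - w n) powr (- (1 / 2)))"
proof -
  obtain \<sigma> \<kappa> where \<sigma>: "0 < \<sigma>" "\<sigma> < 1" and \<kappa>: "0 < \<kappa>" and
    rad: "\<forall>\<^sub>F n in sequentially. \<forall>s. \<bar>s\<bar> \<le> \<sigma> \<longrightarrow> Hn n (w n) + \<kappa> * s\<^sup>2 \<le> Hn n (w n + of_real s * w n)"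
    by (rule radial_minimum[OF w])
  define R where "R = cmod w0"
  define L0 where "L0 = H w0"
  have R: "0 < R" using w0 by (auto simp: R_def)
  \<comment> \<open>The limit of the radial minimum: both ends of the ray segment lie strictly above
    the saddle level, so that superlevel paths can start there.\<close>
  have radH: "L0 < H (w0 + of_real s * w0)" "0 < Im (w0 + of_real s * w0)" "cmod (w0 + of_real s * w0) = R * (1 + s)"
    if s: "\<bar>s\<bar> \<le> \<sigma>" "s \<noteq> 0" for s
  proof -
    have eq: "w0 + of_real s * w0 = of_real (1 + s) * w0" by (simp add: algebra_simps)
    have s1: "0 < 1 + s" using abs_le_D2[OF s(1)] \<sigma> by linarith
    show im: "0 < Im (w0 + of_real s * w0)" unfolding eq using s1 w0 by (simp del: of_real_add)
    show "cmod (w0 + of_real s * w0) = R * (1 + s)" unfolding eq norm_mult R_def using s1 by (simp del: of_real_add)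
    have lim1: "(\<lambda>n. Hn n (w n) + \<kappa> * s\<^sup>2) \<longlonglongrightarrow> L0 + \<kappa> * s\<^sup>2"
      unfolding L0_def by (intro tendsto_intros Hn_tendsto w w0)
    have lim2: "(\<lambda>n. Hn n (w n + of_real s * w n)) \<longlonglongrightarrow> H (w0 + of_real s * w0)"
      by (intro Hn_tendsto tendsto_intros w im)
    have "\<forall>\<^sub>F n in sequentially. Hn n (w n) + \<kappa> * s\<^sup>2 \<le> Hn n (w n + of_real s * w n)"
      using rad by eventually_elim (use s in blast)
    then have "L0 + \<kappa> * s\<^sup>2 \<le> H (w0 + of_real s * w0)"
      by (rule tendsto_le[OF sequentially_bot lim2 lim1])
    moreover have "0 < \<kappa> * s\<^sup>2" using \<kappa> s by simp
    ultimately show "L0 < H (w0 + of_real s * w0)" by linarith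
  qed
  define z1 z2 where "z1 = w0 + of_real (- \<sigma>) * w0" and "z2 = w0 + of_real \<sigma> * w0"
  have z1: "L0 < H z1" "0 < Im z1" "cmod z1 = R * (1 - \<sigma>)" and z2: "L0 < H z2" "0 < Im z2" "cmod z2 = R * (1 + \<sigma>)"
    using radH[of "- \<sigma>"] radH[of \<sigma>] \<sigma> by (simp_all add: z1_def z2_def)
  have z1R: "0 < cmod z1" "cmod z1 < R" and z2R: "R < cmod z2" using z1 z2 R \<sigma> by simp_all
  obtain \<epsilon> where \<epsilon>: "0 < \<epsilon>" "\<epsilon> < R" "L0 < H (Complex 0 \<epsilon>)"
    "(\<integral>t. \<epsilon>\<^sup>2 / (cmod (Complex 0 \<epsilon> - of_real t))\<^sup>2 \<partial>\<nu>) < 1 - \<alpha>"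
    unfolding L0_def by (rule H_near_0[OF R])
  have "\<forall>\<^sub>F B in at_top. L0 + 1 < \<alpha> / 2 * ln (B / 2) - ln 2"
    using \<alpha> by real_asymp
  moreover have "\<forall>\<^sub>F B in at_top. L0 < \<alpha> * ln B"
    using \<alpha> by real_asymp
  moreover have "\<forall>\<^sub>F B in at_top. max (4 * Y) (2 * R + 2) < B \<and> Y < B"
    by (intro eventually_conj eventually_gt_at_top)
  ultimately have "\<forall>\<^sub>F B in at_top. L0 + 1 < \<alpha> / 2 * ln (B / 2) - ln 2 \<and> L0 < \<alpha> * ln B \<and> 4 * Y < B \<and> 2 * R + 2 < B \<and> Y < B"
    by eventually_elim auto
  \<comment> \<open>The first demand keeps \<open>Hn\<close> above the level L on the last segment,
    the second puts i B into the superlevel set, and the others place B beyond all nodes and the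
    circle.\<close>
  from eventually_happens'[OF trivial_limit_at_top_linorder this]
  obtain B where B: "L0 + 1 < \<alpha> / 2 * ln (B / 2) - ln 2" "L0 < \<alpha> * ln B" "4 * Y < B" "2 * R + 2 < B" "Y < B"
    by blast
  have B0: "0 < B" "2 < B" using B R by auto
  have HB: "L0 < H (Complex 0 B)" using H_imaginary_ge[OF B0(1)] B by linarith
  have I1: "open {0<..<R}" "connected {0<..<R}" "\<And>r. r \<in> {0<..<R} \<Longrightarrow> 0 < r \<and> r \<noteq> cmod w0"
    and I2: "open {R<..}" "connected {R<..}" "\<And>r. r \<in> {R<..} \<Longrightarrow> 0 < r \<and> r \<noteq> cmod w0"
    using R unfolding R_def [symmetric] by auto
  have cmodI: "cmod (Complex 0 s) = \<bar>s\<bar>" for s by (simp add: cmod_def)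
  obtain p1 C1 where p1: "valid_path p1" "pathstart p1 = Complex 0 \<epsilon>" "pathfinish p1 = z1"
    and p1_img: "\<And>z. z \<in> path_image p1 \<Longrightarrow> 0 < Im z \<and> cmod z \<in> {0<..<R} \<and> H w0 < H z"
    and C1: "0 \<le> C1" "\<And>f b. \<lbrakk>f contour_integrable_on p1; 0 \<le> b; \<And>z. z \<in> path_image p1 \<Longrightarrow> cmod (f z) \<le> b\<rbrakk>
      \<Longrightarrow> cmod (contour_integral p1 f) \<le> C1 * b"
    by (rule superlevel_path[OF I1, of "Complex 0 \<epsilon>" z1])
      (use \<epsilon> z1 z1R in \<open>auto simp: cmodI simp flip: L0_def\<close>)
  obtain p2 C2 where p2: "valid_path p2" "pathstart p2 = z2" "pathfinish p2 = Complex 0 B"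
    and p2_img: "\<And>z. z \<in> path_image p2 \<Longrightarrow> 0 < Im z \<and> cmod z \<in> {R<..} \<and> H w0 < H z"
    and C2: "0 \<le> C2" "\<And>f b. \<lbrakk>f contour_integrable_on p2; 0 \<le> b; \<And>z. z \<in> path_image p2 \<Longrightarrow> cmod (f z) \<le> b\<rbrakk>
      \<Longrightarrow> cmod (contour_integral p2 f) \<le> C2 * b"
    by (rule superlevel_path[OF I2, of z2 "Complex 0 B"])
      (use B B0 HB z2 z2R R in \<open>auto simp: cmodI simp flip: L0_def\<close>)
  define S1 where "S1 = {z. 0 < Im z \<and> cmod z \<in> {0<..<R} \<and> H w0 < H z}"
  define S2 where "S2 = {z. 0 < Im z \<and> cmod z \<in> {R<..} \<and> H w0 < H z}"
  have open12: "open S1" "open S2"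
    using connected_superlevel(1)[OF I1] connected_superlevel(1)[OF I2] by (simp_all only: S1_def S2_def)
  have "Complex 0 \<epsilon> \<in> S1" "z1 \<in> S1" "z2 \<in> S2"
    using \<epsilon>(1-3) z1 z1R z2 z2R by (auto simp: S1_def S2_def cmodI complex_eq_iff simp flip: L0_def)
  then obtain e1 e2 e3 where e: "0 < e1" "cball (Complex 0 \<epsilon>) e1 \<subseteq> S1" "0 < e2" "cball z1 e2 \<subseteq> S1" "0 < e3" "cball z2 e3 \<subseteq> S2"
    using open12 open_contains_cball by metis
  define \<delta> where "\<delta> = min 1 (min e1 (min e2 e3))"
  have \<delta>: "0 < \<delta>" "\<delta> \<le> 1" "cball (Complex 0 \<epsilon>) \<delta> \<subseteq> S1" "cball z1 \<delta> \<subseteq> S1" "cball z2 \<delta> \<subseteq> S2"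
    using e by (auto simp: \<delta>_def)
  \<comment> \<open>The \<delta>-balls around the ends of the fixed paths contain the connecting
    segments, which vary with n; all estimates off the ray and the axis thus take place on fixed
    compact sets.\<close>
  define K1 where "K1 = cball (Complex 0 \<epsilon>) \<delta> \<union> path_image p1 \<union> cball z1 \<delta>"
  define K2 where "K2 = cball z2 \<delta> \<union> path_image p2"
  have K12: "compact K1" "compact K2" "K1 \<subseteq> S1" "K2 \<subseteq> S2"
    using \<delta> p1 p2 p1_img p2_img unfolding K1_def K2_def S1_def S2_def
    by (auto intro!: compact_Un compact_path_image valid_path_imp_path)
  have K_up: "K1 \<union> K2 \<subseteq> upper_halfplane" using K12 by (auto simp: S1_def S2_def)
  have comp: "compact (K1 \<union> K2)" using K12 by (intro compact_Un)
  obtain \<eta>' where \<eta>': "0 < \<eta>'" "\<And>z. z \<in> K1 \<union> K2 \<Longrightarrow> L0 + \<eta>' \<le> H z"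
    by (rule compact_gap[OF comp continuous_on_subset[OF continuous_on_H K_up], of L0])
      (use K12 in \<open>auto simp: S1_def S2_def L0_def\<close>)
  define \<eta> where "\<eta> = min 1 \<eta>'"
  have \<eta>: "0 < \<eta>" "\<eta> \<le> 1" "\<And>z. z \<in> K1 \<union> K2 \<Longrightarrow> L0 + \<eta> \<le> H z"
    using \<eta>' by (auto simp: \<eta>_def min_def) (meson UnI1 UnI2 add_left_mono order.trans linear)+
  obtain d1 where d1: "0 < d1" "\<And>z. z \<in> K1 \<Longrightarrow> - R + d1 \<le> - cmod z"
    by (rule compact_gap[OF K12(1), of "\<lambda>z. - cmod z" "- R"])
      (use K12 in \<open>auto simp: S1_def intro!: continuous_intros\<close>)
  obtain d2 where d2: "0 < d2" "\<And>z. z \<in> K2 \<Longrightarrow> R + d2 \<le> cmod z"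
    by (rule compact_gap[OF K12(2), of cmod R]) (use K12 in \<open>auto simp: S2_def intro!: continuous_intros\<close>)
  obtain \<rho>1 where \<rho>1: "0 < \<rho>1" "\<And>z. z \<in> K1 \<Longrightarrow> 0 + \<rho>1 \<le> cmod z"
    by (rule compact_gap[OF K12(1), of cmod 0]) (use K12 in \<open>auto simp: S1_def intro!: continuous_intros\<close>)
  \<comment> \<open>The compact sets keep distance 2 d in modulus from R, and |w n| differs from R
    by less than d / 2, so distance d remains.\<close>
  define d where "d = min (1 / 2) (min (d1 / 2) (d2 / 2))"
  have d: "0 < d" "d \<le> 1 / 2" "\<And>z. z \<in> K1 \<Longrightarrow> cmod z + 2 * d \<le> R" "\<And>z. z \<in> K2 \<Longrightarrow> R + 2 * d \<le> cmod z"
    using d1(1) d2(1) by (auto simp: d_def dest!: d1(2) d2(2))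
  define \<rho> where "\<rho> = min \<rho>1 (R * (1 - \<sigma>) / 2)"
  have \<rho>: "0 < \<rho>" "\<rho> \<le> \<rho>1" "2 * \<rho> \<le> R * (1 - \<sigma>)" using \<rho>1 R \<sigma> by (auto simp: \<rho>_def)
  have \<rho>R: "\<rho> \<le> R"
  proof -
    have "R * (1 - \<sigma>) \<le> R * 1" using R \<sigma> by (intro mult_left_mono) auto
    then show ?thesis using \<rho> by linarith
  qed
  \<comment> \<open>Half of the gap pays for the convergence of \<open>Hn\<close>. Since
    \<open>Hn n (w n) < L0 + \<eta> / 4\<close> eventually, the pieces off the ray are smaller by
    \<open>exp (- n \<eta> / 4)\<close>.\<close>
  define L where "L = L0 + \<eta> / 2"
  have eu: "(\<lambda>n. u n) \<longlonglongrightarrow> 0"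
  proof (rule Lim_null_comparison)
    show "\<forall>\<^sub>F n in sequentially. norm (u n) \<le> M / real n"
      using eventually_gt_at_top[of 0] by eventually_elim (use M in auto)
    show "(\<lambda>n. M / real n) \<longlonglongrightarrow> 0" by real_asymp
  qed
  have Mn: "(\<lambda>n. M / real n) \<longlonglongrightarrow> 0" by real_asymp
  have lim_mod: "(\<lambda>n. cmod (w n)) \<longlonglongrightarrow> R" unfolding R_def by (intro tendsto_norm w)
  have E1: "\<forall>\<^sub>F n in sequentially. \<forall>z\<in>K1 \<union> K2. dist (Hn n z) (H z) < \<eta> / 2"
    using \<eta> by (intro uniform_limitD[OF Hn_uniform_limit[OF comp K_up]]) auto
  have E2: "\<forall>\<^sub>F n in sequentially. Hn n (w n) < L0 + \<eta> / 4"
    using order_tendstoD(2)[OF Hn_tendsto[OF w(1) w0], of "L0 + \<eta> / 4"] \<eta> by (simp add: L0_def)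
  have E3: "\<forall>\<^sub>F n in sequentially. \<bar>cmod (w n) - R\<bar> < min (d / 2) (R / 2)"
    using tendstoD[OF lim_mod, of "min (d / 2) (R / 2)"] d R by (simp add: dist_real_def)
  have E4: "\<forall>\<^sub>F n in sequentially. \<bar>u n\<bar> < min (d / 2) \<delta>"
    using tendstoD[OF eu, of "min (d / 2) \<delta>"] d \<delta> by (simp add: dist_real_def)
  have E5: "\<forall>\<^sub>F n in sequentially. M / real n < \<rho> / 2"
    using order_tendstoD(2)[OF Mn, of "\<rho> / 2"] \<rho> by simp
  have E6: "\<forall>\<^sub>F n in sequentially. 0 < Im (w n)"
    using order_tendstoD(1)[OF tendsto_Im[OF w(1)]] w0 by simp
  have E7: "\<forall>\<^sub>F n in sequentially. cmod (w n + of_real (- \<sigma>) * w n - z1) < \<delta>"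
  proof -
    have "(\<lambda>n. w n + of_real (- \<sigma>) * w n) \<longlonglongrightarrow> z1" unfolding z1_def by (intro tendsto_intros w)
    from tendstoD[OF this \<delta>(1)] show ?thesis by (simp add: dist_norm)
  qed
  have E8: "\<forall>\<^sub>F n in sequentially. cmod (w n + of_real \<sigma> * w n - z2) < \<delta>"
  proof -
    have "(\<lambda>n. w n + of_real \<sigma> * w n) \<longlonglongrightarrow> z2" unfolding z2_def by (intro tendsto_intros w)
    from tendstoD[OF this \<delta>(1)] show ?thesis by (simp add: dist_norm)
  qed
  have E9: "\<forall>\<^sub>F n in sequentially. b n < 1 - \<alpha> / 2"
    using order_tendstoD(2)[OF b_tendsto, of "1 - \<alpha> / 2"] \<alpha> by simp
  \<comment> \<open>The mass hypothesis of \<open>vertical_bound\<close> involves m = n - q n - 1 =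
    n (b n - 1 / n). The strict inequality obtained at i \<epsilon> absorbs both 1 / n and the shift
    by u n.\<close>
  have E10: "\<forall>\<^sub>F n in sequentially. q n + 2 \<le> n \<and>
      real n * mean n (y n) (\<lambda>t. \<epsilon>\<^sup>2 / (cmod (Complex (u n) \<epsilon> - of_real t))\<^sup>2) \<le> real (n - q n - 1)"
  proof -
    let ?k = "\<lambda>z t. \<epsilon>\<^sup>2 / (cmod (z - complex_of_real t))\<^sup>2"
    have "continuous_on (upper_halfplane \<times> UNIV) (\<lambda>(z, t). ?k z t)"
      unfolding case_prod_unfold
      by (intro continuous_intros ballI) (use cmod_minus_of_real_pos in force)
    moreover have "(\<lambda>n. Complex (u n) \<epsilon>) \<longlonglongrightarrow> Complex 0 \<epsilon>"
      by (intro tendsto_Complex eu tendsto_const)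
    ultimately have lim: "(\<lambda>n. mean n (y n) (?k (Complex (u n) \<epsilon>))) \<longlonglongrightarrow> (\<integral>t. ?k (Complex 0 \<epsilon>) t \<partial>\<nu>)"
      using \<epsilon>(1) by (intro mean_tendsto_at) auto
    have "(\<lambda>n. b n - 1 / real n - mean n (y n) (?k (Complex (u n) \<epsilon>))) \<longlonglongrightarrow> (1 - \<alpha>) - 0 - (\<integral>t. ?k (Complex 0 \<epsilon>) t \<partial>\<nu>)"
      by (intro tendsto_diff b_tendsto lim lim_const_over_n)
    from order_tendstoD(1)[OF this, of 0] \<epsilon>(4)
    have A: "\<forall>\<^sub>F n in sequentially. 0 < b n - 1 / real n - mean n (y n) (?k (Complex (u n) \<epsilon>))" by simp
    have "(\<lambda>n. b n - 1 / real n) \<longlonglongrightarrow> (1 - \<alpha>) - 0"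
      by (intro tendsto_diff b_tendsto lim_const_over_n)
    from order_tendstoD(1)[OF this, of 0] \<alpha>
    have "\<forall>\<^sub>F n in sequentially. 0 < b n - 1 / real n" by simp
    with A eventually_gt_at_top[of 0] show ?thesis
    proof eventually_elim
      case (elim n)
      have "1 < real (n - q n)" using elim(2,3) by (simp add: b_def field_simps)
      then have q2: "q n + 2 \<le> n" by linarith
      have "real n * (b n - 1 / real n) = real (n - q n - 1)"
        using elim(2) q2 by (simp add: b_def field_simps of_nat_diff)
      moreover have "real n * mean n (y n) (?k (Complex (u n) \<epsilon>)) \<le> real n * (b n - 1 / real n)"
        using elim by (intro mult_left_mono) auto
      ultimately show ?case using q2 by simp
    qed
  qed
  define E where "E = exp (M / \<rho>) / \<rho>"
  define W where "W = 2 * exp (2 * M / \<rho>) / \<rho>"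
  define \<Lambda> where "\<Lambda> = \<epsilon> + C1 + C2 + 2 * B + 3"
  \<comment> \<open>The factor 2 in c1, and 32 = 2 * 16 in c2, account for the integrals at z and at
    \<open>cnj z\<close>; 2 R bounds |w n|.\<close>
  define c1 where "c1 = 2 * W * \<Lambda> * E / d"
  define c2 where "c2 = 32 * W * E * sqrt (2 * (2 * R))"
  define e where "e n = c1 * exp (- (real n * (\<eta> / 4))) + c2 * (real n * \<kappa>) powr (- (1 / 8))" for n
  have pos: "0 < E" "0 < W" "0 < \<Lambda>" using \<rho> \<epsilon> C1 C2 B0 by (auto simp: E_def W_def \<Lambda>_def)
  have "e \<longlonglongrightarrow> 0"
  proof -
    have "(\<lambda>n. exp (- (real n * (\<eta> / 4)))) \<longlonglongrightarrow> 0" using \<eta>(1) by real_asymp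
    moreover have "(\<lambda>n. (real n * \<kappa>) powr (- (1 / 8))) \<longlonglongrightarrow> 0" using \<kappa> by real_asymp
    ultimately have "e \<longlonglongrightarrow> c1 * 0 + c2 * 0" unfolding e_def[abs_def] by (intro tendsto_intros)
    then show ?thesis by simp
  qed
  moreover have "\<forall>\<^sub>F n in sequentially. \<forall>z. cmod z = cmod (w n) \<and> 0 \<le> Im z \<and> z \<noteq> w n \<and> z \<notin> of_real ` y n ` {1..n} \<longrightarrow>
      cmod (upper_interpolant n (y n) (n - q n - 1) (u n) z - of_bool (Re (w n) < Re z) * (z - of_real (u n)) ^ (n - q n - 1))
        / cmod (z - of_real (v n)) ^ (n - q n + 1) \<le> e n * (1 + cmod (z - w n) powr (- (1 / 2)))"
    using w(2) rad E1 E2 E3 E4 E5 E6 E7 E8 E9 E10 eventually_gt_at_top[of 0]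
  proof eventually_elim
    case (elim n)
    note F0 = elim(1) and rad_n = elim(2) and unif = elim(3) and Hw = elim(4) and wR = elim(5) and u_small = elim(6)
      and M\<rho> = elim(7) and Imw = elim(8) and a3 = elim(9) and a4 = elim(10) and bn = elim(11) and q_mass = elim(12) and n0 = elim(13)
    have wR': "\<bar>cmod (w n) - R\<bar> < d / 2" "\<bar>cmod (w n) - R\<bar> < R / 2" using wR by auto
    have wb: "R - d / 2 < cmod (w n)" "cmod (w n) < R + d / 2" "R / 2 < cmod (w n)" "cmod (w n) < 2 * R"
      using wR' unfolding abs_less_iff by linarith+
    have Hn_K: "L \<le> Hn n z" if "z \<in> K1 \<union> K2" for z
      using unif[rule_format, OF that] \<eta>(3)[OF that] unfolding L_def dist_real_def by linarith
    have \<rho>w: "\<rho> \<le> cmod (w n) * (1 - \<sigma>)"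
    proof -
      have "R / 2 * (1 - \<sigma>) \<le> cmod (w n) * (1 - \<sigma>)" using wb(3) \<sigma> by (intro mult_right_mono) linarith+
      then show ?thesis using \<rho> by simp
    qed
    have \<rho>w': "\<rho> \<le> cmod (w n)"
    proof -
      have "cmod (w n) * (1 - \<sigma>) \<le> cmod (w n) * 1" using \<sigma> by (intro mult_left_mono) auto
      then show ?thesis using \<rho>w by simp
    qed
    have conv: "closed_segment a c \<subseteq> cball z \<delta>" if "cmod (a - z) \<le> \<delta>" "cmod (c - z) \<le> \<delta>" for a c z
      using that by (intro closed_segment_subset convex_cball) (auto simp: dist_norm norm_minus_commute)
    have dist_u: "cmod (Complex (u n) \<epsilon> - Complex 0 \<epsilon>) = \<bar>u n\<bar>" by (simp add: cmod_def)
    have K1_ok: "0 < Im z \<and> \<rho> \<le> cmod z \<and> cmod z + d \<le> cmod (w n) \<and> L \<le> Hn n z" if z: "z \<in> K1" for z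
      using K_up z \<rho>1(2)[OF z] \<rho>(2) d(1) d(3)[OF z] wb(1) Hn_K[of z] by auto
    have K2_ok: "0 < Im z \<and> \<rho> \<le> cmod z \<and> cmod (w n) + d \<le> cmod z \<and> L \<le> Hn n z" if z: "z \<in> K2" for z
      using K_up z \<rho>R d(1) d(4)[OF z] wb(2) Hn_K[of z] by auto
    have out_ok: "\<rho> \<le> cmod z \<and> cmod (w n) + d \<le> cmod z \<and> L \<le> Hn n z"
      if z: "z \<in> closed_segment (Complex 0 B) (of_real B)" for z
    proof -
      have zB: "B / 2 \<le> cmod z" by (rule outer_segment[OF z B0(1)])
      have "\<alpha> / 2 * ln (B / 2) - ln 2 \<le> Hn n z"
        using B bn by (intro Hn_outer[OF n0 zB _ B0(2)]) auto
      then have "L \<le> Hn n z" using B(1) \<eta>(2) unfolding L_def by linarith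
      then show ?thesis using zB B(4) wb(2) d(2) \<rho>R by linarith
    qed
    obtain \<gamma> where \<gamma>: "upper_path \<gamma> (u n) B" "path_image \<gamma> \<inter> sphere 0 (cmod (w n)) \<subseteq> {w n}"
      and I_le: "\<And>z. \<lbrakk>cmod z = cmod (w n); z \<noteq> w n\<rbrakk> \<Longrightarrow> cmod (contour_integral \<gamma> (\<lambda>\<zeta>. G n (u n) \<zeta> / (z - \<zeta>))) \<le>
        (\<epsilon> + C1 + C2 + 2 * B + 3) * (exp (M / \<rho>) / \<rho> * exp (- (n * L)) / d)
        + 16 * (exp (M / \<rho>) / \<rho>) * exp (- (n * Hn n (w n))) * (n * \<kappa>) powr (- (1 / 8))
          * sqrt (2 * cmod (w n)) * cmod (z - w n) powr (- (1 / 2))"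
    proof (rule contour_bound[OF n0 _ Imw M(1) M(2)[OF n0] \<rho>(1) \<rho>w \<sigma> \<kappa> _ p1 C1 p2 C2 _ _ _ K1_ok _ _ K2_ok B(5) B0(1) out_ok \<epsilon>(1) _ d(1)])
      show "closed_segment (Complex (u n) \<epsilon>) (Complex 0 \<epsilon>) \<subseteq> K1"
        using conv[of "Complex (u n) \<epsilon>" "Complex 0 \<epsilon>" "Complex 0 \<epsilon>"] u_small \<delta>(1) by (auto simp: K1_def dist_u)
      show "path_image p1 \<subseteq> K1" "path_image p2 \<subseteq> K2" by (auto simp: K1_def K2_def)
      show "closed_segment z1 (w n + of_real (- \<sigma>) * w n) \<subseteq> K1"
      proof -
        have "closed_segment z1 (w n + of_real (- \<sigma>) * w n) \<subseteq> cball z1 \<delta>"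
          by (rule conv[OF _ less_imp_le[OF a3]]) (use \<delta>(1) in simp)
        then show ?thesis unfolding K1_def by blast
      qed
      show "closed_segment (w n + of_real \<sigma> * w n) z2 \<subseteq> K2"
      proof -
        have "closed_segment (w n + of_real \<sigma> * w n) z2 \<subseteq> cball z2 \<delta>"
          by (rule conv[OF less_imp_le[OF a4]]) (use \<delta>(1) in simp)
        then show ?thesis unfolding K2_def by blast
      qed
      have "Complex 0 \<epsilon> \<in> K1" using \<delta>(1) by (simp add: K1_def)
      from d(3)[OF this] show "\<bar>u n\<bar> + \<epsilon> + d \<le> cmod (w n)"
        using u_small wb(1) \<epsilon>(1) unfolding cmodI by linarith
      show "\<bar>u n\<bar> \<le> 1" using u_small \<delta>(2) by auto
      show "cmod (w n + of_real (- \<sigma>) * w n - z1) \<le> 1" using a3 \<delta>(2) by linarith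
      show "cmod (z2 - (w n + of_real \<sigma> * w n)) \<le> 1" using a4 \<delta>(2) by (subst norm_minus_commute) linarith
    qed (use q_mass rad_n in auto)
    define A where "A = \<Lambda> * (E * exp (- (n * L)) / d)"
    define N where "N = 16 * E * exp (- (n * Hn n (w n))) * (n * \<kappa>) powr (- (1 / 8)) * sqrt (2 * cmod (w n))"
    have AN: "0 \<le> A" "0 \<le> N" using pos d by (auto simp: A_def N_def)
    interpret upper_path \<gamma> "u n" B by (rule \<gamma>(1))
    have uR: "\<bar>u n\<bar> < cmod (w n)"
    proof -
      have "\<bar>u n\<bar> \<le> M / n" using M(2) n0 by simp
      then show ?thesis using M\<rho> \<rho>w' \<rho>(1) by linarith
    qed
    have RB: "cmod (w n) < B" using wb(2) B(4) R d(2) by linarith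
    show ?case
    proof (intro allI impI, elim conjE)
      fix z assume z: "cmod z = cmod (w n)" "0 \<le> Im z" "z \<noteq> w n" "z \<notin> of_real ` y n ` {1..n}"
      let ?m = "n - q n - 1"
      let ?P = "node_poly n (y n) z"
      define I where "I \<zeta> = contour_integral \<gamma> (\<lambda>z. G n (u n) z / (\<zeta> - z))" for \<zeta>
      define p where "p = cmod (z - w n) powr (- (1 / 2))"
      have I_z: "cmod (I z) \<le> A + N * p"
        using I_le[OF z(1,3)] by (simp add: I_def A_def N_def p_def E_def \<Lambda>_def)
      have I_cz: "cmod (I (cnj z)) \<le> A + N * p"
      proof -
        have cz: "cnj z \<noteq> w n"
        proof
          assume "cnj z = w n"
          then have "Im (w n) = - Im z" by (metis cnj.sel(2))
          then show False using Imw z(2) by linarith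
        qed
        \<comment> \<open>Both z and w n are in the closed upper half-plane, so \<open>cnj z\<close>
          is at least as far from w n as z, and one singular factor covers both integrals.\<close>
        have "(cmod (z - w n))\<^sup>2 \<le> (cmod (cnj z - w n))\<^sup>2"
          using mult_nonneg_nonneg[OF z(2), of "Im (w n)"] Imw unfolding cmod_power2 by (simp add: power2_eq_square algebra_simps)
        then have "cmod (z - w n) \<le> cmod (cnj z - w n)" by (simp add: power2_le_iff_abs_le)
        then have "cmod (cnj z - w n) powr (- (1 / 2)) \<le> p"
          unfolding p_def using z(3) by (intro powr_mono2') auto
        then have "N * cmod (cnj z - w n) powr (- (1 / 2)) \<le> N * p" using AN by (intro mult_left_mono)
        moreover have "cmod (I (cnj z)) \<le> A + N * cmod (cnj z - w n) powr (- (1 / 2))"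
          using I_le[of "cnj z"] cz z(1) by (simp add: I_def A_def N_def E_def \<Lambda>_def)
        ultimately show ?thesis by linarith
      qed
      have wind: "z \<notin> path_image double" "winding_number double z = (if Re (w n) < Re z then - 1 else 0)"
        by (rule winding_number_circle[OF uR RB refl Imw \<gamma>(2) z(1-3)])+
      have "upper_interpolant n (y n) ?m (u n) z + winding_number double z * (z - of_real (u n)) ^ ?m
          = - ?P * (I z - cnj (I (cnj z))) / (2 * pi * \<i>)"
        unfolding I_def
      proof (rule upper_interpolant_contour[OF _ inj _ _ wind(1) z(4)])
        show "y n j < B" if "j \<in> {1..n}" for j using nodes[OF that] B(5) by linarith
        show "0 < ?m" "?m < n" using q_mass q[of n] n0 by auto
      qed
      then have "cmod (upper_interpolant n (y n) ?m (u n) z - of_bool (Re (w n) < Re z) * (z - of_real (u n)) ^ ?m)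
          = cmod (- ?P * (I z - cnj (I (cnj z))) / (2 * pi * \<i>))"
        by (simp add: wind(2) split: if_splits)
      also have "\<dots> = cmod ?P * cmod (I z - cnj (I (cnj z))) / (2 * pi)"
        by (simp add: norm_mult norm_divide)
      also have "\<dots> \<le> cmod ?P * cmod (I z - cnj (I (cnj z))) / 1"
        using pi_gt3 by (intro divide_left_mono) auto
      also have "\<dots> \<le> cmod ?P * (2 * (A + N * p))"
        using norm_triangle_ineq4[of "I z" "cnj (I (cnj z))"] I_z I_cz by (simp add: mult_left_mono)
      finally have "cmod (upper_interpolant n (y n) ?m (u n) z - of_bool (Re (w n) < Re z) * (z - of_real (u n)) ^ ?m)
            / cmod (z - of_real (v n)) ^ (n - q n + 1)
          \<le> cmod ?P * (2 * (A + N * p)) / cmod (z - of_real (v n)) ^ (n - q n + 1)"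
        by (rule divide_right_mono) simp
      also have "\<dots> = cmod ?P / cmod (z - of_real (v n)) ^ (n - q n + 1) * (2 * (A + N * p))" by simp
      also have "\<dots> \<le> W * exp (n * Hn n (w n)) * (2 * (A + N * p))"
        unfolding W_def using q_mass M\<rho> AN
        by (intro mult_right_mono weight_bound F0 Imw n0 M(1) M(3)[OF n0] \<rho>(1) \<rho>w' z(1)) (auto simp: p_def)
      also have "\<dots> = 2 * W * (exp (n * Hn n (w n)) * A) + 2 * W * (exp (n * Hn n (w n)) * N) * p"
        by (simp add: algebra_simps)
      also have "\<dots> \<le> c1 * exp (- (n * (\<eta> / 4))) + c2 * (n * \<kappa>) powr (- (1 / 8)) * p"
      proof (intro add_mono mult_right_mono)
        have "n * Hn n (w n) - n * L \<le> - (n * (\<eta> / 4))"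
          using mult_left_mono[of "Hn n (w n)" "L - \<eta> / 4" "real n"] Hw by (simp add: L_def algebra_simps)
        then have "exp (n * Hn n (w n)) * exp (- (n * L)) \<le> exp (- (n * (\<eta> / 4)))"
          by (simp flip: exp_add)
        then have "c1 * (exp (n * Hn n (w n)) * exp (- (n * L))) \<le> c1 * exp (- (n * (\<eta> / 4)))"
          using pos d by (intro mult_left_mono) (auto simp: c1_def)
        then show "2 * W * (exp (n * Hn n (w n)) * A) \<le> c1 * exp (- (n * (\<eta> / 4)))"
          by (simp add: c1_def A_def mult_ac)
        have "sqrt (2 * cmod (w n)) \<le> sqrt (2 * (2 * R))" using wb(4) by simp
        then have "32 * W * E * (n * \<kappa>) powr (- (1 / 8)) * sqrt (2 * cmod (w n))
            \<le> 32 * W * E * (n * \<kappa>) powr (- (1 / 8)) * sqrt (2 * (2 * R))"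
          using pos by (intro mult_left_mono) auto
        moreover have "exp (n * Hn n (w n)) * N = 16 * E * (n * \<kappa>) powr (- (1 / 8)) * sqrt (2 * cmod (w n))"
          by (simp add: N_def exp_minus)
        ultimately show "2 * W * (exp (n * Hn n (w n)) * N) \<le> c2 * (n * \<kappa>) powr (- (1 / 8))"
          by (simp add: c2_def mult_ac)
      qed (simp add: p_def)
      also have "\<dots> \<le> e n * (1 + p)"
      proof -
        have "0 \<le> c1" "0 \<le> c2" "0 \<le> p" using pos d R by (auto simp: c1_def c2_def p_def)
        then show ?thesis by (simp add: e_def algebra_simps)
      qed
      finally show "cmod (upper_interpolant n (y n) ?m (u n) z - of_bool (Re (w n) < Re z) * (z - of_real (u n)) ^ ?m)
            / cmod (z - of_real (v n)) ^ (n - q n + 1) \<le> e n * (1 + cmod (z - w n) powr (- (1 / 2)))"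
        by (simp add: p_def)
    qed
  qed
  ultimately show thesis by (rule that)
qed

end

subsection \<open>The sine kernel\<close>

text \<open>The chord is 2 sin x with x = |t - s| / 2. Since x \<le> pi / 2 < 2, one has x^3 / 6
  \<le> 2 x / 3, and the Taylor estimate gives sin x \<ge> x / 3.\<close>

lemma norm_cis_diff_ge:
  assumes "s \<in> {0..pi}" "t \<in> {0..pi}"
  shows "\<bar>t - s\<bar> / 3 \<le> cmod (cis t - cis s)"
proof -
  define x where "x = \<bar>t - s\<bar> / 2"
  have x: "0 \<le> x" "x \<le> 2" using assms pi_less_4 by (auto simp: x_def abs_if)
  have "\<bar>sin x - x\<bar> \<le> x ^ 3 / 6"
    using Maclaurin_sin_bound[of x 3] x
    by (simp add: sin_coeff_def eval_nat_numeral lessThan_Suc)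
  moreover have "x ^ 3 \<le> 4 * x"
    using mult_mono[OF x(2) x(2)] mult_right_mono[of "x * x" 4 x] x by (simp add: power3_eq_cube)
  ultimately have "x / 3 \<le> sin x" by linarith
  have "cis t - cis s = cis s * (exp (\<i> * of_real (t - s)) - 1)"
    unfolding cis_conv_exp [symmetric] by (simp add: right_diff_distrib cis_mult)
  then have "cmod (cis t - cis s) = 2 * \<bar>sin ((t - s) / 2)\<bar>"
    using dist_exp_i_1[of "t - s"] by (simp only: norm_mult norm_cis mult_1_left)
  also have "\<bar>sin ((t - s) / 2)\<bar> = \<bar>sin x\<bar>"
  proof (cases "s \<le> t")
    case False
    then have "(t - s) / 2 = - x" by (simp add: x_def field_simps)
    then show ?thesis by simp
  qed (simp add: x_def)
  finally have "cmod (cis t - cis s) = 2 * \<bar>sin x\<bar>" .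
  then show ?thesis using \<open>x / 3 \<le> sin x\<close> by (simp add: x_def)
qed

text \<open>The arc runs from the real point R to R cis \<theta>, and dz = i z dt, so the integral
  is - i times the increment of the primitive; its real part sees only the upper end point because
  the primitive is real at R.\<close>

lemma main_arc_integral:
  fixes \<Phi> :: "complex \<Rightarrow> complex"
  assumes "0 \<le> \<theta>" and \<Phi>: "\<And>z. cmod z = R \<Longrightarrow> (\<Phi> has_field_derivative g z) (at z)"
    and R: "0 < R" and real: "Im (\<Phi> (of_real R)) = 0"
  shows "(\<lambda>t. g (R * cis t) * (R * cis t)) integrable_on {0..\<theta>}"
    "Re (integral {0..\<theta>} (\<lambda>t. g (R * cis t) * (R * cis t))) = Im (\<Phi> (R * cis \<theta>))"
proof -
  let ?F = "\<lambda>t. - \<i> * \<Phi> (R * cis t)"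
  have "((\<lambda>t. g (R * cis t) * (R * cis t)) has_integral ?F \<theta> - ?F 0) {0..\<theta>}"
  proof (rule fundamental_theorem_of_calculus[OF \<open>0 \<le> \<theta>\<close>])
    fix t assume "t \<in> {0..\<theta>}"
    have d1: "((\<lambda>t. of_real R * cis t) has_vector_derivative of_real R * (\<i> * cis t)) (at t within {0..\<theta>})"
    proof -
      have "((\<lambda>z. exp (\<i> * z)) has_field_derivative \<i> * exp (\<i> * of_real t)) (at (of_real t))"
        by (auto intro!: derivative_eq_intros)
      then have "(cis has_vector_derivative \<i> * cis t) (at t within {0..\<theta>})"
        unfolding cis_conv_exp by (rule has_vector_derivative_real_field)
      then show ?thesis by (rule has_vector_derivative_mult_right)
    qed
    have d2: "(\<Phi> has_field_derivative g (of_real R * cis t)) (at (of_real R * cis t))"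
      using R by (intro \<Phi>) (simp add: norm_mult)
    have "(\<Phi> \<circ> (\<lambda>t. of_real R * cis t) has_vector_derivative
        of_real R * (\<i> * cis t) * g (of_real R * cis t)) (at t within {0..\<theta>})"
      by (rule field_vector_diff_chain_within[OF d1 has_field_derivative_at_within[OF d2]])
    then have "((\<lambda>t. - \<i> * \<Phi> (of_real R * cis t)) has_vector_derivative
        - \<i> * (of_real R * (\<i> * cis t) * g (of_real R * cis t))) (at t within {0..\<theta>})"
      unfolding o_def by (rule has_vector_derivative_mult_right)
    then show "(?F has_vector_derivative g (R * cis t) * (R * cis t)) (at t within {0..\<theta>})"
      by (simp add: mult_ac)
  qed
  then show "(\<lambda>t. g (R * cis t) * (R * cis t)) integrable_on {0..\<theta>}"
    "Re (integral {0..\<theta>} (\<lambda>t. g (R * cis t) * (R * cis t))) = Im (\<Phi> (R * cis \<theta>))"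
    using real by (auto simp: integral_unique)
qed

text \<open>The value at 0 removes the singularity, so that the rate \<open>k\<close> of the main
  term is defined and continuous also for u = v.\<close>

definition ln_quotient :: "complex \<Rightarrow> complex" where
  "ln_quotient d = (if d = 0 then 1 else Ln (1 + d) / d)"

lemma ln_quotient_tendsto: "(ln_quotient \<longlongrightarrow> 1) (nhds 0)"
proof -
  have "((\<lambda>d. Ln (1 + d)) has_field_derivative 1) (at 0)"
    by (auto intro!: derivative_eq_intros)
  then have "((\<lambda>d. Ln (1 + d) / d) \<longlongrightarrow> 1) (at 0)"
    by (simp add: has_field_derivative_iff)
  moreover have "\<forall>\<^sub>F d in at 0. Ln (1 + d) / d = ln_quotient d"
    by (simp add: ln_quotient_def eventually_at_filter)
  ultimately have "(ln_quotient \<longlongrightarrow> 1) (at 0)" by (rule Lim_transform_eventually)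
  moreover have "ln_quotient 0 = 1" by (simp add: ln_quotient_def)
  ultimately show ?thesis using tendsto_at_iff_tendsto_nhds[of ln_quotient 0] by simp
qed

lemma ln_quotient_mult: "d * ln_quotient d = Ln (1 + d)"
  by (simp add: ln_quotient_def)

text \<open>The residue at \<open>z = w\<close> leaves \<open>((w - u) / (w - v)) ^ N\<close>; writing this power as an exponential
in \<open>v - u\<close> treats the diagonal \<open>u = v\<close> on the same footing.\<close>

lemma main_term:
  fixes u v \<tau> R \<theta> :: real and m :: nat
  assumes \<theta>: "0 < \<theta>" and R: "\<bar>u\<bar> < R" "\<bar>v\<bar> < R" and \<tau>: "0 < \<tau>"
  defines "w \<equiv> of_real R * cis \<theta>" and "l \<equiv> \<tau> * (v - u)"
  defines "k \<equiv> of_real (real (m + 1) / \<tau>) * ln_quotient (of_real (v - u) / (w - of_real v)) / (w - of_real v)"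
  shows "(\<lambda>t. (R * cis t - of_real u) ^ m / (R * cis t - of_real v) ^ (m + 2) * (R * cis t)) integrable_on {0..\<theta>}"
    "real (m + 1) / \<tau> / pi * Re (integral {0..\<theta>} (\<lambda>t. (R * cis t - of_real u) ^ m / (R * cis t - of_real v) ^ (m + 2) * (R * cis t)))
      = exp (l * Re k) * (- Im k / pi) * sinc (l * Im k)"
proof -
  let ?g = "\<lambda>z. (z - of_real u) ^ m / (z - of_real v) ^ (m + 2)"
  have nz: "z - of_real v \<noteq> 0" "z - of_real u \<noteq> 0" if "cmod z = R" for z using that R by auto
  have R0: "0 < R" using R by linarith
  have cw: "cmod w = R" using R0 by (simp add: w_def norm_mult)
  define N where "N = real (m + 1)"
  have N: "0 < N" by (simp add: N_def)
  show "(\<lambda>t. ?g (R * cis t) * (R * cis t)) integrable_on {0..\<theta>}"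
    using nz R0 by (intro integrable_continuous_real continuous_intros) (auto simp: norm_mult)
  show "real (m + 1) / \<tau> / pi * Re (integral {0..\<theta>} (\<lambda>t. ?g (R * cis t) * (R * cis t)))
      = exp (l * Re k) * (- Im k / pi) * sinc (l * Im k)"
  proof (cases "u = v")
    case True
    have "Re (integral {0..\<theta>} (\<lambda>t. ?g (R * cis t) * (R * cis t))) = Im (- 1 / (w - of_real v))"
      unfolding w_def
    proof (rule main_arc_integral(2)[where g = ?g and \<Phi> = "\<lambda>z. - 1 / (z - of_real v)"])
      fix z :: complex assume z: "cmod z = R"
      show "((\<lambda>z. - 1 / (z - of_real v)) has_field_derivative ?g z) (at z)"
        using nz[OF z] True by (auto intro!: derivative_eq_intros simp: power2_eq_square)
    next
      show "Im (- 1 / (complex_of_real R - of_real v)) = 0"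
        by (metis Im_complex_of_real of_real_1 of_real_diff of_real_divide of_real_minus)
    qed (use \<theta> R0 in auto)
    then have int: "Re (integral {0..\<theta>} (\<lambda>t. ?g (R * cis t) * (R * cis t))) = - Im (1 / (w - of_real v))"
      by simp
    have k_eq: "k = of_real (N / \<tau>) * (1 / (w - of_real v))"
      using True by (simp add: k_def ln_quotient_def N_def)
    have "Im k = N / \<tau> * Im (1 / (w - of_real v))"
      unfolding k_eq by (simp only: times_complex.sel Re_complex_of_real Im_complex_of_real mult_zero_left add_0_right)
    moreover have "l = 0" using True by (simp add: l_def)
    ultimately show ?thesis unfolding int N_def[symmetric] by (simp only:) simp
  next
    case False
    define r where "r z = (z - of_real u) / (z - of_real v)" for z :: complex
    let ?\<Phi> = "\<lambda>z. r z ^ (m + 1) / of_real (N * (u - v))"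
    have "Re (integral {0..\<theta>} (\<lambda>t. ?g (R * cis t) * (R * cis t))) = Im (?\<Phi> w)"
      unfolding w_def
    proof (rule main_arc_integral(2)[where g = ?g and \<Phi> = ?\<Phi>])
      fix z :: complex assume z: "cmod z = R"
      have r': "(r has_field_derivative of_real (u - v) / (z - of_real v)\<^sup>2) (at z)"
        unfolding r_def[abs_def] using nz[OF z] by (auto intro!: derivative_eq_intros simp: power2_eq_square)
      have "(?\<Phi> has_field_derivative (of_nat (m + 1) * (of_real (u - v) / (z - of_real v)\<^sup>2 * r z ^ m)) / of_real (N * (u - v))) (at z)"
        using DERIV_power[OF r', of "m + 1"] by (intro DERIV_cdivide) (simp add: algebra_simps)
      moreover have "(of_nat (m + 1) * (of_real (u - v) / (z - of_real v)\<^sup>2 * r z ^ m)) / of_real (N * (u - v)) = ?g z"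
      proof -
        have "complex_of_real (u - v) \<noteq> 0" using False by simp
        moreover have "complex_of_real N \<noteq> 0" using N unfolding of_real_eq_0_iff by linarith
        moreover have "of_nat (m + 1) = complex_of_real N" by (simp only: N_def of_real_of_nat_eq)
        ultimately have "(of_nat (m + 1) * (of_real (u - v) / (z - of_real v)\<^sup>2 * r z ^ m)) / of_real (N * (u - v))
            = r z ^ m / (z - of_real v)\<^sup>2"
          by (simp del: of_real_diff of_nat_add)
        also have "\<dots> = ?g z" by (simp add: r_def power_divide power2_eq_square)
        finally show ?thesis .
      qed
      ultimately show "(?\<Phi> has_field_derivative ?g z) (at z)" by simp
    next
      have "r (of_real R) = of_real ((R - u) / (R - v))" by (simp add: r_def)
      then have "?\<Phi> (of_real R) = of_real (((R - u) / (R - v)) ^ (m + 1) / (N * (u - v)))" by simp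
      then show "Im (?\<Phi> (of_real R)) = 0" by (simp only: Im_complex_of_real)
    qed (use \<theta> R0 in auto)
    also have "\<dots> = Im (r w ^ (m + 1)) / (N * (u - v))" by (simp only: Im_divide_of_real)
    finally have int: "Re (integral {0..\<theta>} (\<lambda>t. ?g (R * cis t) * (R * cis t))) = Im (r w ^ (m + 1)) / (N * (u - v))" .
    define d where "d = of_real (v - u) / (w - of_real v)"
    have rw: "r w = 1 + d" using nz[OF cw] by (simp add: r_def d_def field_simps)
    have d1: "1 + d \<noteq> 0" using nz[OF cw] by (simp add: r_def flip: rw)
    have "r w ^ (m + 1) = exp (of_nat (m + 1) * Ln (1 + d))"
      unfolding rw exp_of_nat_mult exp_Ln[OF d1] by (rule refl)
    \<comment> \<open>\<open>ln_quotient\<close> takes the factor v - u out of the logarithm and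
      \<tau> rescales it: for \<tau> = n rho the number l stays bounded and k converges.\<close>
    also have "of_nat (m + 1) * Ln (1 + d) = of_real l * k"
    proof -
      have "of_nat (m + 1) * Ln (1 + d) = of_real N * (d * ln_quotient d)"
        by (simp only: ln_quotient_mult N_def of_real_of_nat_eq)
      also have "\<dots> = of_real (N * (v - u)) * (ln_quotient d / (w - of_real v))"
        unfolding of_real_mult by (simp add: d_def del: of_real_diff)
      also have "N * (v - u) = l * (N / \<tau>)" using \<tau> by (simp add: l_def)
      also have "of_real (l * (N / \<tau>)) * (ln_quotient d / (w - of_real v)) = of_real l * k"
        unfolding of_real_mult k_def d_def N_def by (simp only: mult.assoc times_divide_eq_right)
      finally show ?thesis .
    qed
    also have "Im (exp (of_real l * k)) = exp (l * Re k) * sin (l * Im k)"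
      by (simp add: Im_exp)
    finally have Imr: "Im (r w ^ (m + 1)) = exp (l * Re k) * sin (l * Im k)" .
    have l0: "l \<noteq> 0" using False \<tau> by (simp add: l_def)
    have "N / \<tau> / pi * (Im (r w ^ (m + 1)) / (N * (u - v))) = - (exp (l * Re k) * sin (l * Im k)) / (pi * l)"
      unfolding Imr using N \<tau> False by (simp add: l_def divide_simps) (simp add: algebra_simps)
    also have "\<dots> = exp (l * Re k) * (- Im k / pi) * sinc (l * Im k)"
      using l0 by (auto simp: divide_simps)
    finally show ?thesis unfolding int N_def .
  qed
qed

context saddle_point
begin

text \<open>Arbitrary bounded sequences in place of fixed u and v, from which uniformity follows
  later. The half circle splits at the argument \<theta> of w n: to the right the residue gives
  \<open>main\<close>, and all that remains is bounded by integrating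
  \<open>error_bound\<close>.\<close>

lemma kernel_limit:
  fixes us vs :: "nat \<Rightarrow> real"
  assumes K: "\<And>n. \<bar>us n\<bar> \<le> K" "\<And>n. \<bar>vs n\<bar> \<le> K"
  shows "(\<lambda>n. conj_const w0 powr (vs n - us n) / (n * rho \<alpha> w0) *
      minor_kernel n (y n) (q n, us n / (n * rho \<alpha> w0)) (q n, vs n / (n * rho \<alpha> w0)) - sinc (pi * (vs n - us n))) \<longlonglongrightarrow> 0"
proof -
  obtain w where w: "w \<longlonglongrightarrow> w0" "\<forall>\<^sub>F n in sequentially. Fn n (w n) = 0" by (rule Fn_zero_sequence)
  define \<rho> where "\<rho> = rho \<alpha> w0"
  have w0nz: "w0 \<noteq> 0" using w0 by auto
  have Im_inv: "Im (inverse w0) < 0"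
    using w0 by (simp add: divide_neg_pos sum_power2_gt_zero_iff)
  have \<rho>: "0 < \<rho>"
    unfolding \<rho>_def rho_def using Im_inv \<alpha> by (intro mult_neg_neg) auto
  define u v where "u n = us n / (n * \<rho>)" and "v n = vs n / (n * \<rho>)" for n
  define l where "l n = vs n - us n" for n
  define M where "M = K / \<rho>"
  have K0: "0 \<le> K" using K(1)[of 0] by linarith
  have M: "0 \<le> M" "\<And>n. 0 < n \<Longrightarrow> \<bar>u n\<bar> \<le> M / n" "\<And>n. 0 < n \<Longrightarrow> \<bar>v n\<bar> \<le> M / n"
  proof -
    have *: "\<bar>a / (real n * \<rho>)\<bar> \<le> M / real n" if "\<bar>a\<bar> \<le> K" for a n
    proof -
      have "\<bar>a / (real n * \<rho>)\<bar> = \<bar>a\<bar> / (real n * \<rho>)" using \<rho> by (simp add: abs_mult)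
      also have "\<dots> \<le> K / (real n * \<rho>)" using that \<rho> by (intro divide_right_mono) auto
      also have "\<dots> = M / real n" by (simp add: M_def mult.commute)
      finally show ?thesis .
    qed
    show "0 \<le> M" using K0 \<rho> by (simp add: M_def)
    show "\<bar>u n\<bar> \<le> M / n" "\<bar>v n\<bar> \<le> M / n" for n
      unfolding u_def v_def by (intro * K)+
  qed
  obtain e where e: "e \<longlonglongrightarrow> 0" and err: "\<forall>\<^sub>F n in sequentially. \<forall>z. cmod z = cmod (w n) \<and> 0 \<le> Im z \<and> z \<noteq> w n \<and> z \<notin> of_real ` y n ` {1..n} \<longrightarrow>
      cmod (upper_interpolant n (y n) (n - q n - 1) (u n) z - of_bool (Re (w n) < Re z) * (z - of_real (u n)) ^ (n - q n - 1))
        / cmod (z - of_real (v n)) ^ (n - q n + 1) \<le> e n * (1 + cmod (z - w n) powr (- (1 / 2)))"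
    by (rule error_bound[OF w M])
  define k where "k n = of_real (b n / \<rho>) * ln_quotient (of_real (v n - u n) / (w n - of_real (v n))) / (w n - of_real (v n))" for n
  define main where "main n = exp (l n * Re (k n)) * (- Im (k n) / pi) * sinc (l n * Im (k n))" for n
  \<comment> \<open>The integral of 1 + (R / 3 * |t - \<theta>|) powr (-1/2) over [0, pi] for R = |w
    n|; the antiderivative of the singular part contributes 2 sqrt \<theta> + 2 sqrt (pi -
    \<theta>), at most 4 sqrt pi.\<close>
  define rest where "rest n = cmod (w n) * \<bar>e n\<bar> * (pi + (cmod (w n) / 3) powr (- (1 / 2)) * (4 * sqrt pi)) / \<rho>" for n
  define c where "c = cmod w0"
  have lim_mod: "(\<lambda>n. cmod (w n)) \<longlonglongrightarrow> c" unfolding c_def by (intro tendsto_norm w)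
  have c0: "0 < c" using w0nz by (simp add: c_def)
  have ker: "\<forall>\<^sub>F n in sequentially. \<bar>minor_kernel n (y n) (q n, u n) (q n, v n) / (n * \<rho>) - main n\<bar> \<le> rest n"
  proof -
    have "\<forall>\<^sub>F n in sequentially. M / real n < cmod (w n)"
    proof -
      have "(\<lambda>n. cmod (w n) - M / real n) \<longlonglongrightarrow> c - 0" by (intro tendsto_diff lim_mod lim_const_over_n)
      from order_tendstoD(1)[OF this, of 0] c0 show ?thesis by simp
    qed
    moreover have "\<forall>\<^sub>F n in sequentially. 0 < b n - 2 / real n"
    proof -
      have "(\<lambda>n. b n - 2 / real n) \<longlonglongrightarrow> (1 - \<alpha>) - 0" by (intro tendsto_diff b_tendsto lim_const_over_n)
      from order_tendstoD(1)[OF this, of 0] \<alpha> show ?thesis by simp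
    qed
    moreover have "\<forall>\<^sub>F n in sequentially. 0 < Im (w n)"
      using order_tendstoD(1)[OF tendsto_Im[OF w(1)]] w0 by simp
    ultimately show ?thesis using err eventually_gt_at_top[of 0]
    proof eventually_elim
      case (elim n)
      note Mw = elim(1) and bn = elim(2) and Imw = elim(3) and err_n = elim(4) and n0 = elim(5)
      define m where "m = n - q n - 1"
      define R where "R = cmod (w n)"
      define \<theta> where "\<theta> = Arg (w n)"
      have q2: "q n + 2 \<le> n"
      proof -
        have "2 < real (n - q n)" using bn n0 by (simp add: b_def field_simps)
        then show ?thesis by linarith
      qed
      then have m: "m + 1 = n - q n" "m + 2 = n - q n + 1" by (auto simp: m_def)
      have R: "0 < R" using Imw by (auto simp: R_def)
      have wR: "w n = R * cis \<theta>" using rcis_cmod_Arg[of "w n"] by (simp add: R_def \<theta>_def rcis_def)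
      have \<theta>: "0 < \<theta>" "\<theta> < pi" using Imw Arg_lt_pi[of "w n"] by (auto simp: \<theta>_def)
      have uv: "\<bar>u n\<bar> < R" "\<bar>v n\<bar> < R" using M(2,3)[OF n0] Mw by (auto simp: R_def)
      let ?f = "\<lambda>t. upper_interpolant n (y n) m (u n) (R * cis t) / (R * cis t - v n) ^ (m + 2) * (R * cis t)"
      let ?g = "\<lambda>t. (R * cis t - of_real (u n)) ^ m / (R * cis t - of_real (v n)) ^ (m + 2) * (R * cis t)"
      have nz: "complex_of_real R * cis t \<noteq> v n" for t
      proof
        assume "complex_of_real R * cis t = v n"
        then have "cmod (complex_of_real R * cis t) = \<bar>v n\<bar>" by simp
        then show False using uv R by (simp add: norm_mult)
      qed
      have intf: "?f integrable_on {s..t}" for s t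
      proof -
        have "continuous_on {s..t} (\<lambda>t. upper_interpolant n (y n) m (u n) (R * cis t))"
          by (rule continuous_on_compose2[OF continuous_on_upper_interpolant[of UNIV]]) (auto intro!: continuous_intros)
        then show ?thesis using nz by (intro integrable_continuous_real continuous_intros) auto
      qed
      have kern: "minor_kernel n (y n) (q n, u n) (q n, v n) = real (n - q n) / pi * Re (integral {0..pi} ?f)"
        using minor_kernel_half_circle[OF inj q2 uv(2), of "u n"] by (simp only: m_def)
      have intg: "?g integrable_on {0..\<theta>}"
        and main_eq: "real (m + 1) / (n * \<rho>) / pi * Re (integral {0..\<theta>} ?g) = main n"
      proof -
        have n\<rho>: "0 < n * \<rho>" using n0 \<rho> by simp
        note mt = main_term[OF \<theta>(1) uv n\<rho>, of m]
        show "?g integrable_on {0..\<theta>}" by (rule mt(1))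
        \<comment> \<open>The scale \<tau> = n \<rho> turns the difference of the arguments back
          into vs n - us n, which stays bounded.\<close>
        have 1: "n * \<rho> * (v n - u n) = l n" using n0 \<rho> by (simp add: u_def v_def l_def right_diff_distrib)
        have 2: "real (m + 1) / (n * \<rho>) = b n / \<rho>" unfolding m(1) b_def by simp
        show "real (m + 1) / (n * \<rho>) / pi * Re (integral {0..\<theta>} ?g) = main n"
          using mt(2) unfolding 1 2 main_def k_def wR[symmetric] .
      qed
      let ?h = "\<lambda>t. R * \<bar>e n\<bar> * (1 + (R / 3) powr (- (1 / 2)) * \<bar>t - \<theta>\<bar> powr (1 / 2 - 1))"
      \<comment> \<open>At 0 and pi the circle is real and may hit a node; at \<theta> the bound is
        singular.\<close>
      have bound: "cmod (?f t - of_bool (t < \<theta>) * ?g t) \<le> ?h t" if t: "t \<in> {0..pi} - {0, \<theta>, pi}" for t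
      proof -
        let ?z = "complex_of_real R * cis t"
        have cz: "cmod ?z = R" using R by (simp add: norm_mult)
        have sin: "0 < sin t" using t by (intro sin_gt_zero) auto
        then have Imz: "0 < Im ?z" using R by simp
        have "cos \<theta> < cos t \<longleftrightarrow> t < \<theta>"
          using t \<theta> by (intro cos_mono_less_eq) auto
        then have Re_iff: "Re (w n) < Re ?z \<longleftrightarrow> t < \<theta>" unfolding wR using R by simp
        have far: "R / 3 * \<bar>t - \<theta>\<bar> \<le> cmod (?z - w n)"
        proof -
          have "?z - w n = of_real R * (cis t - cis \<theta>)" unfolding wR by (simp add: right_diff_distrib)
          then have "cmod (?z - w n) = R * cmod (cis t - cis \<theta>)" using R by (simp add: norm_mult)
          then show ?thesis using mult_left_mono[OF norm_cis_diff_ge[of \<theta> t], of R] t \<theta> R by simp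
        qed
        have pos: "0 < R / 3 * \<bar>t - \<theta>\<bar>" using R t by simp
        have zw: "?z \<noteq> w n" using far pos by auto
        have "cmod (upper_interpolant n (y n) m (u n) ?z - of_bool (t < \<theta>) * (?z - of_real (u n)) ^ m) / cmod (?z - of_real (v n)) ^ (m + 2)
            \<le> e n * (1 + cmod (?z - w n) powr (- (1 / 2)))"
          using err_n[rule_format, of ?z] cz Imz zw not_of_real_if_Im_pos[OF Imz]
          unfolding R_def[symmetric] m_def[symmetric] m(2)[symmetric] Re_iff by simp
        also have "\<dots> \<le> \<bar>e n\<bar> * (1 + (R / 3 * \<bar>t - \<theta>\<bar>) powr (- (1 / 2)))"
        proof (intro mult_mono add_left_mono)
          show "cmod (?z - w n) powr (- (1 / 2)) \<le> (R / 3 * \<bar>t - \<theta>\<bar>) powr (- (1 / 2))"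
            using far pos by (intro powr_mono2') auto
        qed auto
        also have "(R / 3 * \<bar>t - \<theta>\<bar>) powr (- (1 / 2)) = (R / 3) powr (- (1 / 2)) * \<bar>t - \<theta>\<bar> powr (1 / 2 - 1)"
          using R by (subst powr_mult) auto
        finally have bd: "cmod (upper_interpolant n (y n) m (u n) ?z - of_bool (t < \<theta>) * (?z - of_real (u n)) ^ m) / cmod (?z - of_real (v n)) ^ (m + 2) * R
            \<le> \<bar>e n\<bar> * (1 + (R / 3) powr (- (1 / 2)) * \<bar>t - \<theta>\<bar> powr (1 / 2 - 1)) * R"
          using R by (intro mult_right_mono) auto
        have eqn: "?f t - of_bool (t < \<theta>) * ?g t =
            (upper_interpolant n (y n) m (u n) ?z - of_bool (t < \<theta>) * (?z - of_real (u n)) ^ m) / (?z - of_real (v n)) ^ (m + 2) * ?z"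
          by (simp add: diff_divide_distrib left_diff_distrib)
        show ?thesis
          unfolding eqn norm_mult[of _ ?z] norm_divide norm_power cz using bd by (simp only: mult_ac)
      qed
      have hint: "(?h has_integral R * \<bar>e n\<bar> * ((d - a) + (R / 3) powr (- (1 / 2)) * (((\<theta> - a) powr (1 / 2) + (d - \<theta>) powr (1 / 2)) / (1 / 2)))) {a..d}"
        if "a \<le> \<theta>" "\<theta> \<le> d" for a d
        using has_integral_const_real[of "1::real" a d] that
        by (intro has_integral_mult_right has_integral_add has_integral_abs_powr) auto
      have fin: "finite {0, \<theta>, pi}" by simp
      have 1: "cmod (integral {0..\<theta>} (\<lambda>t. ?f t - ?g t)) \<le> R * \<bar>e n\<bar> * ((\<theta> - 0) + (R / 3) powr (- (1 / 2)) * (((\<theta> - 0) powr (1 / 2) + (\<theta> - \<theta>) powr (1 / 2)) / (1 / 2)))"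
      proof (rule norm_integral_le_off_finite[OF _ hint fin])
        show "(\<lambda>t. ?f t - ?g t) integrable_on {0..\<theta>}" by (intro Henstock_Kurzweil_Integration.integrable_diff intf intg)
        show "cmod (?f t - ?g t) \<le> ?h t" if "t \<in> {0..\<theta>} - {0, \<theta>, pi}" for t
          using bound[of t] that \<theta> by simp
      qed (use \<theta> in auto)
      have 2: "cmod (integral {\<theta>..pi} ?f) \<le> R * \<bar>e n\<bar> * ((pi - \<theta>) + (R / 3) powr (- (1 / 2)) * (((\<theta> - \<theta>) powr (1 / 2) + (pi - \<theta>) powr (1 / 2)) / (1 / 2)))"
      proof (rule norm_integral_le_off_finite[OF intf hint fin])
        show "cmod (?f t) \<le> ?h t" if "t \<in> {\<theta>..pi} - {0, \<theta>, pi}" for t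
          using bound[of t] that \<theta> by simp
      qed (use \<theta> in auto)
      have split: "integral {0..pi} ?f - integral {0..\<theta>} ?g = integral {0..\<theta>} (\<lambda>t. ?f t - ?g t) + integral {\<theta>..pi} ?f"
        using Henstock_Kurzweil_Integration.integral_combine[OF _ _ intf, of 0 \<theta> pi] \<theta>
          Henstock_Kurzweil_Integration.integral_diff[OF intf intg] by simp
      have "cmod (integral {0..pi} ?f - integral {0..\<theta>} ?g) \<le> R * \<bar>e n\<bar> * (pi + (R / 3) powr (- (1 / 2)) * (4 * sqrt pi))"
      proof -
        let ?c = "(R / 3) powr (- (1 / 2))"
        have "cmod (integral {0..pi} ?f - integral {0..\<theta>} ?g) \<le>
            R * \<bar>e n\<bar> * ((\<theta> - 0) + ?c * (((\<theta> - 0) powr (1 / 2) + (\<theta> - \<theta>) powr (1 / 2)) / (1 / 2))) +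
            R * \<bar>e n\<bar> * ((pi - \<theta>) + ?c * (((\<theta> - \<theta>) powr (1 / 2) + (pi - \<theta>) powr (1 / 2)) / (1 / 2)))"
          unfolding split by (rule order_trans[OF norm_triangle_ineq add_mono[OF 1 2]])
        also have "\<dots> = R * \<bar>e n\<bar> * (pi + ?c * (2 * sqrt \<theta> + 2 * sqrt (pi - \<theta>)))"
          using \<theta> by (simp add: powr_half_sqrt algebra_simps)
        also have "\<dots> \<le> R * \<bar>e n\<bar> * (pi + ?c * (4 * sqrt pi))"
        proof (intro mult_left_mono add_left_mono)
          have "sqrt \<theta> \<le> sqrt pi" "sqrt (pi - \<theta>) \<le> sqrt pi" using \<theta> by auto
          then show "2 * sqrt \<theta> + 2 * sqrt (pi - \<theta>) \<le> 4 * sqrt pi" by linarith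
        qed (use R in auto)
        finally show ?thesis .
      qed
      then have re: "\<bar>Re (integral {0..pi} ?f) - Re (integral {0..\<theta>} ?g)\<bar> \<le> R * \<bar>e n\<bar> * (pi + (R / 3) powr (- (1 / 2)) * (4 * sqrt pi))"
        using abs_Re_le_cmod[of "integral {0..pi} ?f - integral {0..\<theta>} ?g"] unfolding minus_complex.sel by linarith
      have eq1: "minor_kernel n (y n) (q n, u n) (q n, v n) / (n * \<rho>) - main n
          = real (m + 1) / (n * \<rho>) / pi * (Re (integral {0..pi} ?f) - Re (integral {0..\<theta>} ?g))"
        unfolding kern main_eq[symmetric] m(1)[symmetric] by (simp add: right_diff_distrib)
      have nn: "0 \<le> real (m + 1) / (n * \<rho>) / pi" and le1: "real (m + 1) / (n * \<rho>) / pi \<le> 1 / \<rho>"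
      proof -
        have b1: "real (m + 1) / (n * \<rho>) = b n / \<rho>" unfolding m(1) b_def by simp
        have "b n / \<rho> / pi \<le> b n / \<rho> / 1"
          using b_le[of n] \<rho> pi_gt3 by (intro divide_left_mono) auto
        also have "\<dots> \<le> 1 / \<rho>" using b_le[of n] \<rho> by (simp add: divide_right_mono)
        finally show "real (m + 1) / (n * \<rho>) / pi \<le> 1 / \<rho>" unfolding b1 .
        show "0 \<le> real (m + 1) / (n * \<rho>) / pi" using \<rho> by simp
      qed
      have "\<bar>minor_kernel n (y n) (q n, u n) (q n, v n) / (n * \<rho>) - main n\<bar>
          \<le> 1 / \<rho> * (R * \<bar>e n\<bar> * (pi + (R / 3) powr (- (1 / 2)) * (4 * sqrt pi)))"
        unfolding eq1 abs_mult abs_of_nonneg[OF nn] using \<rho> by (intro mult_mono le1 re) auto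
      then show ?case by (simp add: rest_def R_def)
    qed
  qed
  have rest0: "rest \<longlonglongrightarrow> 0"
  proof -
    have "rest \<longlonglongrightarrow> c * \<bar>0\<bar> * (pi + (c / 3) powr (- (1 / 2)) * (4 * sqrt pi)) / \<rho>"
      unfolding rest_def[abs_def] using c0 \<rho> by (intro tendsto_intros lim_mod e) auto
    then show ?thesis by simp
  qed
  \<comment> \<open>The definition of \<open>rho\<close> makes Im k0 = - pi, which is the scale of
    the sine kernel, and \<open>conj_const\<close> is exp (- Re k0), which cancels the exponential
    in \<open>main\<close>.\<close>
  define k0 where "k0 = of_real ((1 - \<alpha>) / \<rho>) * inverse w0"
  have lim_uv: "u \<longlonglongrightarrow> 0" "v \<longlonglongrightarrow> 0"
  proof -
    have *: "f \<longlonglongrightarrow> 0" if "\<And>n. 0 < n \<Longrightarrow> \<bar>f n\<bar> \<le> M / real n" for f :: "nat \<Rightarrow> real"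
    proof (rule Lim_null_comparison)
      show "\<forall>\<^sub>F n in sequentially. norm (f n) \<le> M / real n"
        using eventually_gt_at_top[of 0] by eventually_elim (use that in auto)
    qed (rule lim_const_over_n)
    show "u \<longlonglongrightarrow> 0" "v \<longlonglongrightarrow> 0" using M by (auto intro: *)
  qed
  have k_lim: "k \<longlonglongrightarrow> k0"
  proof -
    have d: "(\<lambda>n. complex_of_real (v n - u n) / (w n - of_real (v n))) \<longlonglongrightarrow> of_real (0 - 0) / (w0 - of_real 0)"
      using w0nz by (intro tendsto_intros w lim_uv) auto
    then have "(\<lambda>n. ln_quotient (of_real (v n - u n) / (w n - of_real (v n)))) \<longlonglongrightarrow> 1"
      by (intro filterlim_compose[OF ln_quotient_tendsto]) simp
    then have "k \<longlonglongrightarrow> of_real ((1 - \<alpha>) / \<rho>) * 1 / (w0 - of_real 0)"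
      unfolding k_def[abs_def] using w0nz \<rho> by (intro tendsto_intros w lim_uv b_tendsto) auto
    then show ?thesis by (simp add: k0_def divide_inverse)
  qed
  have quot: "(1 - \<alpha>) / \<rho> = - pi / Im (inverse w0)"
  proof -
    have "a / (- (a / pi) * I) = - pi / I" if "0 < a" "I < 0" for a I :: real
      using that by (simp add: field_simps)
    from this[of "1 - \<alpha>", OF _ Im_inv] \<alpha> show ?thesis unfolding \<rho>_def rho_def by simp
  qed
  have Im_k0: "Im k0 = - pi"
  proof -
    have "Im k0 = - pi / Im (inverse w0) * Im (inverse w0)"
      unfolding k0_def quot times_complex.sel Re_complex_of_real Im_complex_of_real by (simp only: mult_zero_left add_0_right)
    then show ?thesis using Im_inv by (simp del: inverse_complex.sel)
  qed
  have conj: "conj_const w0 powr s = exp (- s * Re k0)" for s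
  proof -
    have "Re k0 = - pi * (Re (inverse w0) / Im (inverse w0))"
      unfolding k0_def quot Re_of_real_times by (simp only: times_divide_eq_left times_divide_eq_right)
    then show ?thesis by (simp add: conj_const_def exp_powr_real mult.commute)
  qed
  have l_le: "\<bar>l n\<bar> \<le> 2 * K" for n using K[of n] by (simp add: l_def)
  have bounded_mult: "(\<lambda>n. l n * f n) \<longlonglongrightarrow> 0" if "f \<longlonglongrightarrow> 0" for f :: "nat \<Rightarrow> real"
  proof (rule Lim_null_comparison)
    show "\<forall>\<^sub>F n in sequentially. norm (l n * f n) \<le> 2 * K * \<bar>f n\<bar>"
      using l_le by (intro always_eventually allI) (auto simp: abs_mult intro: mult_right_mono)
    show "(\<lambda>n. 2 * K * \<bar>f n\<bar>) \<longlonglongrightarrow> 0"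
      using tendsto_mult_right_zero[OF tendsto_rabs_zero[OF that], of "2 * K"] .
  qed
  have Re_lim: "(\<lambda>n. Re (k n) - Re k0) \<longlonglongrightarrow> 0" and Im_lim: "(\<lambda>n. Im (k n) - Im k0) \<longlonglongrightarrow> 0"
    using tendsto_Re[OF k_lim] tendsto_Im[OF k_lim] by (simp_all add: LIM_zero)
  have exp_lim: "(\<lambda>n. exp (l n * (Re (k n) - Re k0))) \<longlonglongrightarrow> 1"
    using tendsto_exp[OF bounded_mult[OF Re_lim]] by simp
  have Imk_lim: "(\<lambda>n. - Im (k n) / pi) \<longlonglongrightarrow> 1"
  proof -
    have "(\<lambda>n. - Im (k n) / pi) \<longlonglongrightarrow> - Im k0 / pi" by (intro tendsto_intros k_lim) simp
    then show ?thesis by (simp add: Im_k0)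
  qed
  have sinc_cont: "continuous_on {- X..X} sinc" for X
    using isCont_sinc by (intro continuous_at_imp_continuous_on) blast
  \<comment> \<open>Eventually |Im (k n)| \<le> pi + 1, and |l n| \<le> 2 K, so all arguments of
    \<open>sinc\<close> lie in [- X, X], where it is uniformly continuous.\<close>
  define X where "X = 2 * K * (pi + 1)"
  have sinc_even: "sinc (l n * Im k0) = sinc (pi * l n)" for n
    by (simp add: Im_k0 mult.commute)
  have sinc_lim: "(\<lambda>n. sinc (l n * Im (k n)) - sinc (pi * l n)) \<longlonglongrightarrow> 0"
  proof (rule tendstoI)
    fix r :: real assume r: "0 < r"
    have "uniformly_continuous_on {- X..X} sinc" by (intro compact_uniformly_continuous sinc_cont) auto
    then obtain d where d: "0 < d" "\<And>s t. \<lbrakk>s \<in> {- X..X}; t \<in> {- X..X}; dist t s < d\<rbrakk> \<Longrightarrow> dist (sinc t) (sinc s) < r"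
      unfolding uniformly_continuous_on_def using r by blast
    have "\<forall>\<^sub>F n in sequentially. \<bar>l n * (Im (k n) - Im k0)\<bar> < d"
      using tendstoD[OF bounded_mult[OF Im_lim] d(1)] by simp
    moreover have "\<forall>\<^sub>F n in sequentially. \<bar>Im (k n) - Im k0\<bar> < 1"
      using tendstoD[OF Im_lim, of 1] by simp
    ultimately show "\<forall>\<^sub>F n in sequentially. dist (sinc (l n * Im (k n)) - sinc (pi * l n)) 0 < r"
    proof eventually_elim
      case (elim n)
      have mem: "l n * t \<in> {- X..X}" if "\<bar>t\<bar> \<le> pi + 1" for t
      proof -
        have "\<bar>l n * t\<bar> \<le> X"
          unfolding abs_mult X_def using l_le[of n] that K0 by (intro mult_mono) auto
        then show ?thesis by (auto simp: abs_le_iff)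
      qed
      have "\<bar>Im (k n)\<bar> \<le> pi + 1" using elim(2) pi_gt_zero unfolding Im_k0 by linarith
      moreover have "\<bar>Im k0\<bar> \<le> pi + 1" using pi_gt_zero unfolding Im_k0 by linarith
      ultimately have "dist (sinc (l n * Im (k n))) (sinc (l n * Im k0)) < r"
        using elim(1) by (intro d(2) mem) (simp_all add: dist_real_def right_diff_distrib)
      then show ?case unfolding sinc_even dist_real_def by simp
    qed
  qed
  have sinc_le: "\<bar>sinc x\<bar> \<le> 1" for x
    using abs_sin_x_le_abs_x[of x] by (auto simp: divide_le_eq)
  have main_lim: "(\<lambda>n. exp (- l n * Re k0) * main n - sinc (pi * l n)) \<longlonglongrightarrow> 0"
  proof -
    define g where "g n = exp (l n * (Re (k n) - Re k0)) * (- Im (k n) / pi)" for n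
    have g: "(\<lambda>n. g n - 1) \<longlonglongrightarrow> 0"
      unfolding g_def[abs_def] using tendsto_mult[OF exp_lim Imk_lim] by (simp add: LIM_zero)
    have "(\<lambda>n. (g n - 1) * sinc (l n * Im (k n))) \<longlonglongrightarrow> 0"
    proof (rule Lim_null_comparison)
      show "\<forall>\<^sub>F n in sequentially. norm ((g n - 1) * sinc (l n * Im (k n))) \<le> \<bar>g n - 1\<bar>"
        using sinc_le by (intro always_eventually allI) (simp only: real_norm_def abs_mult mult_left_le abs_ge_zero)
      show "(\<lambda>n. \<bar>g n - 1\<bar>) \<longlonglongrightarrow> 0" by (rule tendsto_rabs_zero[OF g])
    qed
    from tendsto_add[OF this sinc_lim]
    have "(\<lambda>n. g n * sinc (l n * Im (k n)) - sinc (pi * l n)) \<longlonglongrightarrow> 0"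
      by (simp only: left_diff_distrib mult_1_left diff_add_eq diff_diff_eq add_0_left add_diff_cancel diff_add_cancel add_diff_eq)
    moreover have "exp (- l n * Re k0) * main n = g n * sinc (l n * Im (k n))" for n
    proof -
      have "exp (l n * (Re (k n) - Re k0)) = exp (- l n * Re k0) * exp (l n * Re (k n))"
        by (simp add: right_diff_distrib flip: exp_add)
      then show ?thesis unfolding g_def main_def by (simp only: mult_ac)
    qed
    ultimately show ?thesis by (simp only:)
  qed
  have err_lim: "(\<lambda>n. exp (- l n * Re k0) * (minor_kernel n (y n) (q n, u n) (q n, v n) / (n * \<rho>) - main n)) \<longlonglongrightarrow> 0"
  proof (rule Lim_null_comparison)
    show "\<forall>\<^sub>F n in sequentially. norm (exp (- l n * Re k0) * (minor_kernel n (y n) (q n, u n) (q n, v n) / (n * \<rho>) - main n))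
        \<le> exp (2 * K * \<bar>Re k0\<bar>) * rest n"
      using ker
    proof eventually_elim
      case (elim n)
      have "- l n * Re k0 \<le> \<bar>l n\<bar> * \<bar>Re k0\<bar>" using abs_ge_self[of "- l n * Re k0"] by (simp add: abs_mult)
      also have "\<dots> \<le> 2 * K * \<bar>Re k0\<bar>" using l_le by (intro mult_right_mono) auto
      finally show ?case using elim unfolding real_norm_def abs_mult by (intro mult_mono) auto
    qed
    show "(\<lambda>n. exp (2 * K * \<bar>Re k0\<bar>) * rest n) \<longlonglongrightarrow> 0" by (rule tendsto_mult_right_zero[OF rest0])
  qed
  from tendsto_add[OF err_lim main_lim]
  have "(\<lambda>n. exp (- l n * Re k0) * (minor_kernel n (y n) (q n, u n) (q n, v n) / (n * \<rho>)) - sinc (pi * l n)) \<longlonglongrightarrow> 0"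
    by (simp only: right_diff_distrib diff_add_cancel add_0_left add_diff_eq)
  then show ?thesis
    unfolding conj \<rho>_def[symmetric] l_def u_def v_def by (simp only: times_divide_eq_left times_divide_eq_right)
qed

end

subsection \<open>Empirical measures\<close>

text \<open>The complement of the support is a union of open null sets; second countability reduces
  it to a countable one.\<close>

lemma AE_in_measure_support:
  fixes M :: "'a::second_countable_topology measure"
  assumes sets: "sets M = sets borel" and sub: "measure_support M \<subseteq> S"
  shows "AE x in M. x \<in> S"
proof -
  let ?F = "{U. open U \<and> emeasure M U = 0}"
  obtain F where F: "F \<subseteq> ?F" "countable F" "\<Union>F = \<Union>?F"
    by (rule Lindelof[of ?F]) auto
  have "\<Union>F \<in> null_sets M"
  proof (rule null_sets_UN'[OF F(2), of "\<lambda>U. U", simplified])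
    show "U \<in> null_sets M" if "U \<in> F" for U
      using F(1) that sets by (auto simp: null_sets_def)
  qed
  moreover have "{x \<in> space M. x \<notin> S} \<subseteq> \<Union>F"
    unfolding F(3) using sub by (auto simp: measure_support_def zero_less_iff_neq_zero)
  ultimately show ?thesis by (rule AE_I')
qed

lemma real_distribution_empirical:
  assumes "0 < n"
  shows "real_distribution (empirical_measure n x)"
proof -
  interpret prob_space "uniform_count_measure {1..n}"
    using assms by (intro prob_space_uniform_count_measure) auto
  have "x \<in> borel_measurable (uniform_count_measure {1..n})"
    by (simp add: measurable_def sets_uniform_count_measure space_uniform_count_measure)
  then have "prob_space (empirical_measure n x)"
    unfolding empirical_measure_def by (rule prob_space_distr)
  then show ?thesis
    by (simp add: real_distribution_def real_distribution_axioms_def empirical_measure_def)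
qed

lemma integral_empirical:
  fixes g :: "real \<Rightarrow> real"
  assumes "g \<in> borel_measurable borel"
  shows "(\<integral>t. g t \<partial>empirical_measure n x) = mean n x g"
proof -
  have "x \<in> borel_measurable (uniform_count_measure {1..n})"
    by (simp add: measurable_def sets_uniform_count_measure space_uniform_count_measure)
  then have "(\<integral>t. g t \<partial>empirical_measure n x) = (\<integral>i. g (x i) \<partial>uniform_count_measure {1..n})"
    unfolding empirical_measure_def using assms by (intro integral_distr) auto
  then show ?thesis by (simp add: integral_uniform_count_measure mean_def)
qed

lemma mean_tendsto_integral:
  fixes g :: "real \<Rightarrow> real"
  assumes \<mu>: "real_distribution \<mu>" and conv: "weak_conv_m (\<lambda>n. empirical_measure n (x n)) \<mu>"
    and g: "continuous_on UNIV g" "\<And>t. \<bar>g t\<bar> \<le> C"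
  shows "(\<lambda>n. mean n (x n) g) \<longlonglongrightarrow> (\<integral>t. g t \<partial>\<mu>)"
proof -
  \<comment> \<open>The index is shifted because the empirical measure for n = 0 is no probability
    measure.\<close>
  have "weak_conv_m (\<lambda>n. empirical_measure (Suc n) (x (Suc n))) \<mu>"
    using conv unfolding weak_conv_m_def weak_conv_def by (auto intro: LIMSEQ_Suc)
  then have "(\<lambda>n. \<integral>t. g t \<partial>empirical_measure (Suc n) (x (Suc n))) \<longlonglongrightarrow> (\<integral>t. g t \<partial>\<mu>)"
    using g by (intro weak_conv_imp_integral_bdd_continuous_conv[where B = C] real_distribution_empirical \<mu>)
      (auto simp: continuous_on_eq_continuous_at)
  then have "(\<lambda>n. mean (Suc n) (x (Suc n)) g) \<longlonglongrightarrow> (\<integral>t. g t \<partial>\<mu>)"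
    using borel_measurable_continuous_onI[OF g(1)] by (simp add: integral_empirical)
  then show ?thesis by (rule filterlim_sequentially_Suc[THEN iffD1])
qed

lemma node_limit_shift:
  fixes \<mu> :: "real measure" and x :: "nat \<Rightarrow> nat \<Rightarrow> real"
  assumes \<mu>: "real_distribution \<mu>" and conv: "weak_conv_m (\<lambda>n. empirical_measure n (x n)) \<mu>"
    and supp: "measure_support \<mu> \<subseteq> {a..b}" and x: "\<And>n i. i \<in> {1..n} \<Longrightarrow> x n i \<in> {a..b}" and c: "c \<in> {a<..<b}"
  shows "node_limit (distr \<mu> borel (\<lambda>t. t - c)) (b - a) (\<lambda>n i. x n i - c)"
proof -
  interpret \<mu>: real_distribution \<mu> by (rule \<mu>)
  have shift: "(\<lambda>t. t - c) \<in> measurable \<mu> borel" by measurable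
  have AE: "AE t in \<mu>. t \<in> {a..b}"
    by (rule AE_in_measure_support[OF _ supp]) simp
  show ?thesis
  proof (rule node_limit.intro)
    show "prob_space (distr \<mu> borel (\<lambda>t. t - c))" using shift by (rule \<mu>.prob_space_distr)
    show "AE t in distr \<mu> borel (\<lambda>t. t - c). \<bar>t\<bar> \<le> b - a"
    proof (subst AE_distr_iff[OF shift])
      show "AE t in \<mu>. \<bar>t - c\<bar> \<le> b - a"
        using AE by (rule eventually_mono) (use c in auto)
    qed auto
    show "\<bar>x n i - c\<bar> \<le> b - a" if "i \<in> {1..n}" for n i using x[OF that] c by auto
    fix g :: "real \<Rightarrow> complex" assume g: "continuous_on UNIV g"
    \<comment> \<open>Weak convergence tests bounded functions only. Clamping the argument to [a, b]
      makes g bounded without changing it at the nodes or almost everywhere for the limit.\<close>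
    define h where "h t = g (max a (min b t) - c)" for t
    have h: "continuous_on UNIV h"
      unfolding h_def by (rule continuous_on_compose2[OF g]) (auto intro!: continuous_intros)
    have ab: "a \<le> b" using c by auto
    have "compact (g ` {a - c..b - c})"
      by (intro compact_continuous_image continuous_on_subset[OF g]) auto
    then obtain C where C: "\<forall>t\<in>{a - c..b - c}. cmod (g t) \<le> C"
      using compact_imp_bounded[of "g ` {a - c..b - c}"] unfolding bounded_iff by auto
    have hC: "cmod (h t) \<le> C" for t
      unfolding h_def using ab by (intro C[rule_format]) (auto simp: max_def min_def)
    have hm: "h \<in> borel_measurable borel" by (rule borel_measurable_continuous_onI[OF h])
    then have int: "integrable \<mu> h"
      by (intro \<mu>.integrable_const_bound[where B = C]) (auto simp: hC)
    have "(\<lambda>n. mean n (x n) (\<lambda>t. Re (h t))) \<longlonglongrightarrow> (\<integral>t. Re (h t) \<partial>\<mu>)"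
      "(\<lambda>n. mean n (x n) (\<lambda>t. Im (h t))) \<longlonglongrightarrow> (\<integral>t. Im (h t) \<partial>\<mu>)"
      using order_trans[OF abs_Re_le_cmod hC] order_trans[OF abs_Im_le_cmod hC]
      by (intro mean_tendsto_integral[OF \<mu> conv, where C = C] continuous_intros h; simp)+
    then have "(\<lambda>n. mean n (x n) h) \<longlonglongrightarrow> (\<integral>t. h t \<partial>\<mu>)"
      using int by (simp add: tendsto_complex_iff Re_mean Im_mean)
    moreover have "mean n (x n) h = mean n (\<lambda>i. x n i - c) g" for n
      unfolding mean_def h_def
    proof (intro arg_cong2[where f = "(/)"] sum.cong refl)
      fix i assume "i \<in> {1..n}"
      then have "max a (min b (x n i)) = x n i" using x[of i n] by auto
      then show "g (max a (min b (x n i)) - c) = g (x n i - c)" by simp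
    qed
    moreover have "(\<integral>t. h t \<partial>\<mu>) = (\<integral>t. g t \<partial>distr \<mu> borel (\<lambda>t. t - c))"
    proof -
      have gm: "g \<in> borel_measurable borel" by (rule borel_measurable_continuous_onI[OF g])
      have "(\<integral>t. h t \<partial>\<mu>) = (\<integral>t. g (t - c) \<partial>\<mu>)"
      proof (rule integral_cong_AE)
        show "AE t in \<mu>. h t = g (t - c)"
          using AE by (rule eventually_mono) (auto simp: h_def max_def min_def)
      qed (use hm gm in auto)
      also have "\<dots> = (\<integral>t. g t \<partial>distr \<mu> borel (\<lambda>t. t - c))"
        using shift gm by (subst integral_distr) auto
      finally show ?thesis .
    qed
    ultimately show "(\<lambda>n. mean n (\<lambda>i. x n i - c) g) \<longlonglongrightarrow> (\<integral>t. g t \<partial>distr \<mu> borel (\<lambda>t. t - c))"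
      by simp
  qed simp
qed

lemma eq_return_if_AE_eq:
  assumes "prob_space M" "sets M = sets borel" "AE x in M. x = (c :: real)"
  shows "M = return borel c"
proof (rule measure_eqI)
  interpret prob_space M by (rule assms(1))
  fix A assume A: "A \<in> sets M"
  show "emeasure M A = emeasure (return borel c) A"
  proof (cases "c \<in> A")
    case True
    then have "emeasure M A = emeasure M (space M)"
      using assms(3) A by (intro emeasure_eq_AE) (auto elim!: eventually_mono dest: sets.sets_into_space)
    then show ?thesis using True A assms(2) by (simp add: emeasure_space_1)
  next
    case False
    then have "emeasure M A = emeasure M {}"
      using assms(3) A by (intro emeasure_eq_AE) (auto elim!: eventually_mono)
    then show ?thesis using False A assms(2) by simp
  qed
qed (simp add: assms)

lemma nonreal_roots_shift:
  assumes "real_distribution \<mu>"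
  shows "nonreal_roots \<mu> \<alpha> c =
    {w. Im w \<noteq> 0 \<and> (\<integral>t. w / (w - of_real t) \<partial>distr \<mu> borel (\<lambda>t. t - c)) = of_real (1 - \<alpha>)}"
proof -
  interpret \<mu>: real_distribution \<mu> by (rule assms)
  have "w * cauchy_transform \<mu> (w + of_real c) = (\<integral>t. w / (w - of_real t) \<partial>distr \<mu> borel (\<lambda>t. t - c))" for w
  proof -
    have "(\<integral>t. w / (w - of_real t) \<partial>distr \<mu> borel (\<lambda>t. t - c)) = (\<integral>t. w / (w - of_real (t - c)) \<partial>\<mu>)"
      by (subst integral_distr) auto
    also have "\<dots> = (\<integral>t. w * (1 / (w + of_real c - of_real t)) \<partial>\<mu>)"
      by (simp add: algebra_simps)
    also have "\<dots> = w * cauchy_transform \<mu> (w + of_real c)"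
      unfolding cauchy_transform_def by (rule integral_mult_right_zero)
    finally show ?thesis by simp
  qed
  then show ?thesis by (simp add: nonreal_roots_def complex_is_Real_iff)
qed

text \<open>For each n take a pair at which the difference exceeds \<epsilon>, if there is one, and
  (0, 0) otherwise. Convergence along this single sequence of pairs excludes such a pair for all
  large n, so the supremum need not be attained.\<close>

lemma uniform_from_bounded_sequences:
  fixes D :: "nat \<Rightarrow> real \<Rightarrow> real \<Rightarrow> real"
  assumes seq: "\<And>us vs. \<lbrakk>\<And>n. \<bar>us n\<bar> \<le> K; \<And>n. \<bar>vs n\<bar> \<le> K\<rbrakk> \<Longrightarrow> (\<lambda>n. D n (us n) (vs n)) \<longlonglongrightarrow> 0"
    and UV: "\<And>u. u \<in> U \<Longrightarrow> \<bar>u\<bar> \<le> K" "\<And>v. v \<in> V \<Longrightarrow> \<bar>v\<bar> \<le> K" and K: "0 \<le> K"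
  shows "(\<lambda>n. SUP (u, v) \<in> U \<times> V. ennreal \<bar>D n u v\<bar>) \<longlonglongrightarrow> 0"
proof (rule order_tendstoI)
  fix r :: ennreal assume "0 < r"
  then obtain \<epsilon>' where \<epsilon>': "0 < \<epsilon>'" "\<epsilon>' < r" using dense by blast
  then obtain \<epsilon> where \<epsilon>: "\<epsilon>' = ennreal \<epsilon>" "0 < \<epsilon>" by (cases \<epsilon>') auto
  have "\<exists>p. \<bar>fst p\<bar> \<le> K \<and> \<bar>snd p\<bar> \<le> K \<and> ((\<exists>u\<in>U. \<exists>v\<in>V. \<epsilon> < \<bar>D n u v\<bar>) \<longrightarrow> \<epsilon> < \<bar>D n (fst p) (snd p)\<bar>)" for n
  proof (cases "\<exists>u\<in>U. \<exists>v\<in>V. \<epsilon> < \<bar>D n u v\<bar>")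
    case True
    then obtain u v where "u \<in> U" "v \<in> V" "\<epsilon> < \<bar>D n u v\<bar>" by blast
    then show ?thesis using UV by (intro exI[of _ "(u, v)"]) simp
  next
    case False
    then show ?thesis using K by (intro exI[of _ "(0, 0)"]) simp
  qed
  then obtain p where p: "\<And>n. \<bar>fst (p n)\<bar> \<le> K" "\<And>n. \<bar>snd (p n)\<bar> \<le> K"
    "\<And>n. \<exists>u\<in>U. \<exists>v\<in>V. \<epsilon> < \<bar>D n u v\<bar> \<Longrightarrow> \<epsilon> < \<bar>D n (fst (p n)) (snd (p n))\<bar>"
    by metis
  have "\<forall>\<^sub>F n in sequentially. dist (D n (fst (p n)) (snd (p n))) 0 < \<epsilon>"
    using tendstoD[OF seq[OF p(1,2)] \<epsilon>(2)] .
  then show "\<forall>\<^sub>F n in sequentially. (SUP (u, v) \<in> U \<times> V. ennreal \<bar>D n u v\<bar>) < r"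
  proof eventually_elim
    case (elim n)
    then have "\<not> (\<exists>u\<in>U. \<exists>v\<in>V. \<epsilon> < \<bar>D n u v\<bar>)" using p(3)[of n] by (auto simp: dist_real_def)
    then have le: "\<bar>D n u v\<bar> \<le> \<epsilon>" if "u \<in> U" "v \<in> V" for u v
      using that by (meson linorder_not_less)
    have "(SUP (u, v) \<in> U \<times> V. ennreal \<bar>D n u v\<bar>) \<le> ennreal \<epsilon>"
      by (intro SUP_least) (auto intro!: ennreal_leI le)
    also have "\<dots> < r" using \<epsilon>' \<epsilon> by simp
    finally show ?case .
  qed
qed simp

theorem theorem1p6:
  fixes a b \<alpha> :: real and q :: "nat \<Rightarrow> nat" and x :: "nat \<Rightarrow> nat \<Rightarrow> real"
    and \<mu> :: "real measure"
  assumes "a < b"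
    and "\<And>n. n \<ge> 1 \<Longrightarrow> q n \<in> {1..n}"
    and "\<And>n i. i \<in> {1..n} \<Longrightarrow> x n i \<in> {a..b}"
    and "\<And>n. strict_antimono_on {1..n} (x n)"
    and "real_distribution \<mu>"
    and "\<And>y. \<mu> \<noteq> return borel y"
    and "measure_support \<mu> \<subseteq> {a..b}"
    and "weak_conv_m (\<lambda>n. empirical_measure n (x n)) \<mu>"
    and "0 < \<alpha>" and "\<alpha> < 1"
    and "(\<lambda>n. real (q n) / real n) \<longlonglongrightarrow> \<alpha>"
  shows "\<forall>c \<in> A_set a b \<mu> \<alpha>. \<exists>w. Im w > 0 \<and> nonreal_roots \<mu> \<alpha> c = {w, cnj w} \<and>
    (\<forall>U V. compact U \<longrightarrow> compact V \<longrightarrow>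
      (\<lambda>n. SUP (u, v) \<in> U \<times> V. ennreal \<bar>
          conj_const w powr (v - u) / (real n * rho \<alpha> w) *
            minor_kernel n (x n) (q n, c + u / (real n * rho \<alpha> w))
                                 (q n, c + v / (real n * rho \<alpha> w))
          - sinc (pi * (v - u))\<bar>) \<longlonglongrightarrow> 0)"
proof
  fix c assume "c \<in> A_set a b \<mu> \<alpha>"
  then have c: "c \<in> {a<..<b}" and ex: "\<exists>w. w \<in> nonreal_roots \<mu> \<alpha> c" by (auto simp: A_set_def)
  interpret \<mu>: real_distribution \<mu> by fact
  define \<nu> where "\<nu> = distr \<mu> borel (\<lambda>t. t - c)"
  define y where "y n i = x n i - c" for n i
  let ?R = "\<lambda>w. \<integral>t. w / (w - of_real t) \<partial>\<nu>"
  have roots: "nonreal_roots \<mu> \<alpha> c = {w. Im w \<noteq> 0 \<and> ?R w = of_real (1 - \<alpha>)}"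
    unfolding \<nu>_def by (rule nonreal_roots_shift) fact
  have lim: "node_limit \<nu> (b - a) y"
    unfolding \<nu>_def y_def[abs_def] by (rule node_limit_shift) (fact | use assms in blast)+
  have shift: "(\<lambda>t. t - c) \<in> measurable \<mu> borel" by measurable
  have "\<not> (AE t in \<nu>. t = 0)"
  proof
    assume "AE t in \<nu>. t = 0"
    then have "AE t in \<mu>. t - c = 0" unfolding \<nu>_def by (subst (asm) AE_distr_iff[OF shift]) auto
    then have "AE t in \<mu>. t = c" by eventually_elim simp
    then have "\<mu> = return borel c"
      by (intro eq_return_if_AE_eq \<mu>.prob_space_axioms) auto
    with assms(6) show False by blast
  qed
  then have nondeg: "nondegenerate_node_limit \<nu> (b - a) y"
    using lim by (intro nondegenerate_node_limit.intro nondegenerate_node_limit_axioms.intro)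
  have cnj: "?R (cnj w) = cnj (?R w)" for w
    by (subst Bochner_Integration.integral_cnj [symmetric]) simp
  have cnj_root: "cnj w \<in> nonreal_roots \<mu> \<alpha> c \<longleftrightarrow> w \<in> nonreal_roots \<mu> \<alpha> c" for w
    unfolding roots mem_Collect_eq cnj by (simp add: complex_eq_iff)
  obtain w' where w': "w' \<in> nonreal_roots \<mu> \<alpha> c" using ex by blast
  define w where "w = (if 0 < Im w' then w' else cnj w')"
  have w_root: "w \<in> nonreal_roots \<mu> \<alpha> c" using w' by (simp add: w_def cnj_root)
  have Imw: "0 < Im w" using w' by (auto simp: w_def roots)
  have Rw: "?R w = of_real (1 - \<alpha>)" using w_root by (simp add: roots)
  have inj: "inj_on (y n) {1..n}" for n
  proof (rule inj_onI)
    fix i j assume ij: "i \<in> {1..n}" "j \<in> {1..n}" "y n i = y n j"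
    then have "x n i = x n j" by (simp add: y_def)
    then show "i = j"
      using assms(4)[of n] ij(1,2) unfolding monotone_on_def
      by (metis less_irrefl linorder_neqE_nat)
  qed
  interpret saddle_point \<nu> "b - a" y \<alpha> w q
    by (intro saddle_point.intro nondeg saddle_point_axioms.intro) (fact | use inj assms in blast)+
  have eq: "nonreal_roots \<mu> \<alpha> c = {w, cnj w}"
  proof (intro equalityI subsetI)
    fix z assume z: "z \<in> nonreal_roots \<mu> \<alpha> c"
    have unique: "z' = w" if "z' \<in> nonreal_roots \<mu> \<alpha> c" "0 < Im z'" for z'
      using that(1) unfolding roots mem_Collect_eq by (intro root_unique[OF that(2) Imw _ Rw]) simp
    show "z \<in> {w, cnj w}"
    proof (cases "0 < Im z")
      case True
      then show ?thesis using unique[OF z] by simp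
    next
      case False
      then have "0 < Im (cnj z)" using z by (simp add: roots)
      then have "cnj z = w" using z by (intro unique) (simp_all add: cnj_root)
      then show ?thesis by (metis complex_cnj_cnj insertCI)
    qed
  qed (use w_root cnj_root in auto)
  show "\<exists>w. Im w > 0 \<and> nonreal_roots \<mu> \<alpha> c = {w, cnj w} \<and>
    (\<forall>U V. compact U \<longrightarrow> compact V \<longrightarrow>
      (\<lambda>n. SUP (u, v) \<in> U \<times> V. ennreal \<bar>
          conj_const w powr (v - u) / (real n * rho \<alpha> w) *
            minor_kernel n (x n) (q n, c + u / (real n * rho \<alpha> w))
                                 (q n, c + v / (real n * rho \<alpha> w))
          - sinc (pi * (v - u))\<bar>) \<longlonglongrightarrow> 0)"
  proof (intro exI[of _ w] conjI allI impI)
    fix U V :: "real set" assume "compact U" "compact V"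
    then have "bounded (U \<union> V)" by (intro bounded_Un[THEN iffD2] conjI compact_imp_bounded)
    then obtain K where K: "\<forall>u\<in>U \<union> V. \<bar>u\<bar> \<le> K" unfolding bounded_iff real_norm_def by blast
    show "(\<lambda>n. SUP (u, v) \<in> U \<times> V. ennreal \<bar>
          conj_const w powr (v - u) / (real n * rho \<alpha> w) *
            minor_kernel n (x n) (q n, c + u / (real n * rho \<alpha> w))
                                 (q n, c + v / (real n * rho \<alpha> w))
          - sinc (pi * (v - u))\<bar>) \<longlonglongrightarrow> 0"
    \<comment> \<open>If U and V are both empty, K may be negative, hence the absolute
      value.\<close>
    proof (rule uniform_from_bounded_sequences[where K = "\<bar>K\<bar>"])
      fix us vs :: "nat \<Rightarrow> real" assume "\<And>n. \<bar>us n\<bar> \<le> \<bar>K\<bar>" "\<And>n. \<bar>vs n\<bar> \<le> \<bar>K\<bar>"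
      from kernel_limit[OF this]
      show "(\<lambda>n. conj_const w powr (vs n - us n) / (real n * rho \<alpha> w) *
            minor_kernel n (x n) (q n, c + us n / (real n * rho \<alpha> w)) (q n, c + vs n / (real n * rho \<alpha> w))
          - sinc (pi * (vs n - us n))) \<longlonglongrightarrow> 0"
        unfolding minor_kernel_shift y_def .
    qed (use K in \<open>auto intro: order_trans[OF _ abs_ge_self]\<close>)
  qed (rule Imw eq)+
qed

end
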